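(* Suppose $\lim_{n\to\infty}h_{n-1}/h_n=1$. Let $m_n$ be the minimum fixed point of $\sigma_n$ ($m_n=n+1$ if there is none), $M_n$ the maximum fixed point ($M_n=0$ if there is none), $\delta_n$ the minimum spacing between fixed points and $\Delta_n$ the maximum spacing, where the two extreme spacings of lengths $m_n$ and $n+1-M_n$ are also taken into account. Then $$\left(\frac{m_n}{n},\frac{M_n}{n},\frac{\delta_n}{n},\frac{\Delta_n}{n}\right)\xrightarrow{d}(m,M,\delta,\Delta),\qquad n\to\infty,$$ for a random vector $(m,M,\delta,\Delta)$ whose components satisfy $$\mathbb P\{m\le x\}=1-\exp\{-\theta_1x\},\qquad\mathbb P\{M\le x\}=\exp\{\theta_1(x-1)\},\qquad x\in[0,1),$$ $$\delta\overset{d}{=}\frac{X_{\nu+1}}{(\nu+1)\sum_{i=1}^{\nu+1}X_i},\qquad\Delta\overset{d}{=}\frac{\sum_{i=1}^{\nu+1}\frac{X_i}{i}}{\sum_{i=1}^{\nu+1}X_i},$$ where $\nu$ is Poisson distributed with parameter $\theta_1$, the $X_i$, $i\ge1$, are exponentially distributed with unit mean, and $\nu,X_1,X_2,\ldots$ are all independent.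
   Context: Weighted permutations: let $\theta_k\ge 0$, $k\ge1$. For $\pi$ in the symmetric group $\mathcal S_n$ (permutations of $\{1,\ldots,n\}$) let $C_k(\pi)$ be the number of $k$-cycles of $\pi$. The random permutation $\sigma_n$ has distribution $\mathbb P\{\sigma_n=\pi\}=\frac{1}{h_n n!}\prod_{k=1}^\infty\theta_k^{C_k(\pi)}$, $\pi\in\mathcal S_n$, where $h_n=\frac1{n!}\sum_{\pi\in\mathcal S_n}\prod_{k=1}^\infty\theta_k^{C_k(\pi)}$ is the normalization (the condition $h_{n-1}/h_n\to1$ presupposes $h_n>0$ for all large $n$, which are the $n$ considered). Spacings: if the fixed points of $\sigma_n$ are $p_1<\cdots<p_q$, the spacings are the differences of consecutive terms of $0,p_1,\ldots,p_q,n+1$ (a single spacing of length $n+1$ if $q=0$). The random variables $m,M$ take values in $[0,1]$. If $\theta_1=0$, then $\nu=0$ almost surely. $\xrightarrow{d}$ is convergence in distribution and $\overset{d}{=}$ is equality in distribution (the displayed equalities for $\delta$ and $\Delta$ are statements about each marginal). *)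

theory Defs
  imports "HOL-Probability.Probability" "HOL-Combinatorics.Orbits"
begin

definition cycle_count :: "nat \<Rightarrow> nat \<Rightarrow> (nat \<Rightarrow> nat) \<Rightarrow> nat" where
  "cycle_count n k \<pi> = card {C \<in> orbit \<pi> ` {1..n}. card C = k}"

(* The product over all k >= 1 stops at n, because a permutation of {1..n} has no longer
   cycles; see perm_weight_eq_prodinf below. *)
definition perm_weight :: "(nat \<Rightarrow> real) \<Rightarrow> nat \<Rightarrow> (nat \<Rightarrow> nat) \<Rightarrow> real" where
  "perm_weight \<theta> n \<pi> = (\<Prod>k=1..n. \<theta> k ^ cycle_count n k \<pi>)"

definition perm_norm :: "(nat \<Rightarrow> real) \<Rightarrow> nat \<Rightarrow> real" where
  "perm_norm \<theta> n = (\<Sum>\<pi> | \<pi> permutes {1..n}. perm_weight \<theta> n \<pi>) / fact n"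

(* The law of the random permutation: a probability measure when perm_norm is positive, and the
   null measure otherwise; the latter is possible for finitely many n only once
   perm_norm (n - 1) / perm_norm n tends to 1, because x / 0 = 0. *)
definition weighted_perm :: "(nat \<Rightarrow> real) \<Rightarrow> nat \<Rightarrow> (nat \<Rightarrow> nat) measure" where
  "weighted_perm \<theta> n =
     point_measure {\<pi>. \<pi> permutes {1..n}}
       (\<lambda>\<pi>. ennreal (perm_weight \<theta> n \<pi> / (perm_norm \<theta> n * fact n)))"

definition fixed_points :: "nat \<Rightarrow> (nat \<Rightarrow> nat) \<Rightarrow> nat set" where
  "fixed_points n \<pi> = {i \<in> {1..n}. \<pi> i = i}"

definition min_fixed :: "nat \<Rightarrow> (nat \<Rightarrow> nat) \<Rightarrow> nat" where
  "min_fixed n \<pi> = (if fixed_points n \<pi> = {} then n + 1 else Min (fixed_points n \<pi>))"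

definition max_fixed :: "nat \<Rightarrow> (nat \<Rightarrow> nat) \<Rightarrow> nat" where
  "max_fixed n \<pi> = (if fixed_points n \<pi> = {} then 0 else Max (fixed_points n \<pi>))"

definition spacings :: "nat \<Rightarrow> (nat \<Rightarrow> nat) \<Rightarrow> nat list" where
  "spacings n \<pi> =
     (let ps = 0 # sorted_list_of_set (fixed_points n \<pi>) @ [n + 1]
      in map (\<lambda>(a, b). b - a) (zip ps (tl ps)))"

definition min_spacing :: "nat \<Rightarrow> (nat \<Rightarrow> nat) \<Rightarrow> nat" where
  "min_spacing n \<pi> = Min (set (spacings n \<pi>))"

definition max_spacing :: "nat \<Rightarrow> (nat \<Rightarrow> nat) \<Rightarrow> nat" where
  "max_spacing n \<pi> = Max (set (spacings n \<pi>))"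

(* HOL-Probability's weak_conv_m is restricted to measures on the real line. *)
definition converges_in_distribution ::
  "(nat \<Rightarrow> 'a measure) \<Rightarrow> (nat \<Rightarrow> 'a \<Rightarrow> 'c::topological_space) \<Rightarrow> 'b measure \<Rightarrow> ('b \<Rightarrow> 'c) \<Rightarrow> bool"
where
  "converges_in_distribution P Y Q Z \<longleftrightarrow>
     (\<forall>f :: 'c \<Rightarrow> real. continuous_on UNIV f \<and> bounded (range f) \<longrightarrow>
        (\<lambda>n. \<integral>\<omega>. f (Y n \<omega>) \<partial>P n) \<longlonglongrightarrow> (\<integral>\<omega>. f (Z \<omega>) \<partial>Q))"

(* poisson_pmf is only specified for a positive rate.  Since 0 ^ 0 = 1, rate 0 here means
   that the variable is 0 almost surely. *)
definition poisson_distributed :: "'b measure \<Rightarrow> ('b \<Rightarrow> nat) \<Rightarrow> real \<Rightarrow> bool" where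
  "poisson_distributed N \<nu> r \<longleftrightarrow>
     \<nu> \<in> measurable N (count_space UNIV) \<and>
     (\<forall>k. measure N {\<omega> \<in> space N. \<nu> \<omega> = k} = r ^ k / fact k * exp (- r))"

lemma cycle_count_eq_0:
  assumes "\<pi> permutes {1..n}" "k > n"
  shows "cycle_count n k \<pi> = 0"
proof -
  have "card C \<noteq> k" if "C \<in> orbit \<pi> ` {1..n}" for C
  proof -
    from that obtain x where x: "x \<in> {1..n}" "C = orbit \<pi> x" by blast
    then have "C \<subseteq> {1..n}"
      using permutes_orbit_subset[OF assms(1)] by simp
    then have "card C \<le> n"
      using card_mono[of "{1..n}" C] by simp
    then show ?thesis using assms(2) by simp
  qed
  then have "{C \<in> orbit \<pi> ` {1..n}. card C = k} = {}" by blast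
  then show ?thesis by (simp add: cycle_count_def)
qed

lemma perm_weight_eq_prodinf:
  assumes "\<pi> permutes {1..n}"
  shows "perm_weight \<theta> n \<pi> = (\<Prod>k. \<theta> (Suc k) ^ cycle_count n (Suc k) \<pi>)"
proof -
  have "(\<Prod>k. \<theta> (Suc k) ^ cycle_count n (Suc k) \<pi>)
      = (\<Prod>k<n. \<theta> (Suc k) ^ cycle_count n (Suc k) \<pi>)"
    by (rule prodinf_finite) (auto simp: cycle_count_eq_0[OF assms])
  also have "\<dots> = perm_weight \<theta> n \<pi>"
    unfolding perm_weight_def
    by (rule prod.reindex_bij_witness[of _ "\<lambda>k. k - 1" Suc]) auto
  finally show ?thesis ..
qed

lemma prob_space_weighted_perm:
  assumes "\<And>k. k \<ge> 1 \<Longrightarrow> \<theta> k \<ge> 0" "perm_norm \<theta> n > 0"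
  shows "prob_space (weighted_perm \<theta> n)"
proof (rule prob_spaceI)
  let ?S = "{\<pi>. \<pi> permutes {1..n}}"
  have fin: "finite ?S" by (rule finite_permutations) simp
  have nonneg: "perm_weight \<theta> n \<pi> \<ge> 0" for \<pi>
    unfolding perm_weight_def using assms(1) by (intro prod_nonneg) auto
  have "emeasure (weighted_perm \<theta> n) (space (weighted_perm \<theta> n))
      = (\<Sum>\<pi>\<in>?S. ennreal (perm_weight \<theta> n \<pi> / (perm_norm \<theta> n * fact n)))"
    unfolding weighted_perm_def
    by (subst emeasure_point_measure_finite) (use fin in \<open>simp_all add: space_point_measure\<close>)
  also have "\<dots> = ennreal (\<Sum>\<pi>\<in>?S. perm_weight \<theta> n \<pi> / (perm_norm \<theta> n * fact n))"
    using nonneg assms(2) by (intro sum_ennreal) auto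
  also have "(\<Sum>\<pi>\<in>?S. perm_weight \<theta> n \<pi> / (perm_norm \<theta> n * fact n))
      = (perm_norm \<theta> n * fact n) / (perm_norm \<theta> n * fact n)"
    by (simp add: perm_norm_def flip: sum_divide_distrib)
  also have "\<dots> = 1" using assms(2) by simp
  finally show "emeasure (weighted_perm \<theta> n) (space (weighted_perm \<theta> n)) = 1" by simp
qed

end

theory Submission
  imports Defs
begin

text \<open>
  Given their number \<open>q\<close>, the fixed points of the random permutation form a uniformly distributed
  \<open>q\<close>-subset of \<open>{1..n}\<close>. Their number tends to a Poisson variable: writing \<open>h\<close> and \<open>d\<close> for the
  normalizations of all permutations and of derangements, \<open>h = exp (\<theta>\<^sub>1 x) d\<close> as generating functions,
  so \<open>d\<^sub>n / h\<^sub>n\<close> tends to \<open>exp (- \<theta>\<^sub>1)\<close> by Tannery's theorem.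

  Uniform \<open>q\<close>-subsets are obtained by rounding up \<open>n (X\<^sub>1 + \<dots> + X\<^sub>j) / (X\<^sub>1 + \<dots> + X\<^sub>q\<^sub>+\<^sub>1)\<close>,
  \<open>j \<le> q\<close>, for independent exponential variables, conditionally on the results being distinct, an
  event of probability tending to one. By dominated convergence the spacings divided by \<open>n\<close> tend to
  \<open>X\<^sub>j / (X\<^sub>1 + \<dots> + X\<^sub>q\<^sub>+\<^sub>1)\<close>. Renyi's representation, obtained by repeatedly peeling off the minimum,
  rewrites the smallest and the largest of these.
\<close>

section \<open>The set of fixed points of a weighted permutation\<close>

text \<open>Cycles of length at least two enter only through \<open>derangement_norm\<close>, and
  the hypothesis controls that only via ratios of \<open>perm_norm\<close>. For each fixed shift
  \<open>j\<close> these ratios tend to one, but they need not do so uniformly in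
  \<open>j \<le> n\<close>. The crude bound \<open>C * 2 ^ j\<close>, paid for by the factorial in
  the series, supplies the domination in both uses of Tannery's theorem.

  Rounding is convenient because every \<open>q\<close>-subset then corresponds to a cell of exactly
  the same probability \<open>fact q / n ^ q\<close>. The discrepancy with the uniform law on
  \<open>q\<close>-subsets is a single factor, and it is found by taking the test function 1.

  The joint limit is obtained before Renyi's representation is applied. That representation
  rearranges the sample, so it is stated only for the law of one extreme together with the total,
  which is enough since the assertions on \<delta> and \<Delta> concern marginals. The total has to
  be carried along because the normalized spacing is a quotient by it; hence test functions of
  pairs.\<close>

definition orbit_weight :: "(nat \<Rightarrow> real) \<Rightarrow> 'a set \<Rightarrow> ('a \<Rightarrow> 'a) \<Rightarrow> real" where
  "orbit_weight \<theta> S \<pi> = (\<Prod>C\<in>orbit \<pi> ` S. \<theta> (card C))"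

definition derangements :: "'a set \<Rightarrow> ('a \<Rightarrow> 'a) set" where
  "derangements S = {\<pi>. \<pi> permutes S \<and> (\<forall>x\<in>S. \<pi> x \<noteq> x)}"

text \<open>Collecting cycles of equal length turns a product over cycles into a product of powers.
  The form over cycles makes sense on any ground set, as is needed for the complement of the fixed
  points, which in general is not an initial segment.\<close>

lemma perm_weight_eq_orbit_weight:
  assumes "\<pi> permutes {1..n}"
  shows "perm_weight \<theta> n \<pi> = orbit_weight \<theta> {1..n} \<pi>"
proof -
  let ?O = "orbit \<pi> ` {1..n}"
  have card: "card C \<in> {1..n}" if "C \<in> ?O" for C
  proof -
    from that obtain x where x: "x \<in> {1..n}" "C = orbit \<pi> x" by blast
    have sub: "C \<subseteq> {1..n}" unfolding x(2) using permutes_orbit_subset[OF assms x(1)] .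
    moreover have "C \<noteq> {}" using x(2) orbit_nonempty[of \<pi> x] by simp
    moreover have "finite C" using sub finite_subset by blast
    ultimately show ?thesis using card_mono[of "{1..n}" C] by (auto simp: Suc_le_eq card_gt_0_iff)
  qed
  have "orbit_weight \<theta> {1..n} \<pi> = (\<Prod>k\<in>{1..n}. \<Prod>C | C \<in> ?O \<and> card C = k. \<theta> (card C))"
    unfolding orbit_weight_def by (rule prod.group[symmetric]) (use card in auto)
  also have "\<dots> = (\<Prod>k\<in>{1..n}. \<theta> k ^ cycle_count n k \<pi>)"
    by (rule prod.cong) (simp_all add: cycle_count_def)
  finally show ?thesis by (simp add: perm_weight_def)
qed

section \<open>Relabelling the points of a permutation\<close>

lemma map_permutation_orbit:
  assumes f: "bij_betw f S T" and \<pi>: "\<pi> permutes S" and x: "x \<in> S"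
  shows "orbit (map_permutation S f \<pi>) (f x) = f ` orbit \<pi> x"
proof
  have inj: "inj_on f S" using f by (simp add: bij_betw_def)
  have sub: "orbit \<pi> x \<subseteq> S" by (rule permutes_orbit_subset[OF \<pi> x])
  show "orbit (map_permutation S f \<pi>) (f x) \<subseteq> f ` orbit \<pi> x"
  proof
    fix y assume "y \<in> orbit (map_permutation S f \<pi>) (f x)"
    then show "y \<in> f ` orbit \<pi> x"
    proof induct
      case base
      then show ?case using map_permutation_apply[OF inj x] by (auto intro: orbit.intros)
    next
      case (step y)
      then obtain z where z: "z \<in> orbit \<pi> x" "y = f z" by blast
      then have "z \<in> S" using sub by blast
      then show ?case using z map_permutation_apply[OF inj, of z] by (auto intro: orbit.intros)
    qed
  qed
  have "f y \<in> orbit (map_permutation S f \<pi>) (f x)" if "y \<in> orbit \<pi> x" for y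
    using that
  proof induct
    case base
    then show ?case using map_permutation_apply[OF inj x, of \<pi>] orbit.base by metis
  next
    case (step y)
    then have "y \<in> S" using sub by blast
    then show ?case using step map_permutation_apply[OF inj, of y \<pi>] orbit.step by metis
  qed
  then show "f ` orbit \<pi> x \<subseteq> orbit (map_permutation S f \<pi>) (f x)" by blast
qed

lemma orbit_weight_map_permutation:
  assumes f: "bij_betw f S T" and \<pi>: "\<pi> permutes S"
  shows "orbit_weight \<theta> T (map_permutation S f \<pi>) = orbit_weight \<theta> S \<pi>"
proof -
  have inj: "inj_on f S" and T: "T = f ` S" using f by (auto simp: bij_betw_def)
  have eq: "orbit (map_permutation S f \<pi>) ` T = (\<lambda>C. f ` C) ` (orbit \<pi> ` S)"
    unfolding T image_image by (rule image_cong) (auto simp: map_permutation_orbit[OF f \<pi>])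
  have sub: "C \<subseteq> S" if "C \<in> orbit \<pi> ` S" for C
    using that by (elim imageE) (simp add: permutes_orbit_subset[OF \<pi>])
  have inj': "inj_on (\<lambda>C. f ` C) (orbit \<pi> ` S)"
    using sub inj by (intro inj_onI) (meson inj_on_image_eq_iff)
  show ?thesis
    unfolding orbit_weight_def eq
    by (subst prod.reindex[OF inj'], unfold o_def, rule prod.cong[OF refl])
       (simp add: card_image[OF inj_on_subset[OF inj sub]])
qed

text \<open>Conjugation by \<open>f\<close> is a weight-preserving bijection and creates no fixed
  points. The total weight of derangements therefore depends only on the number of points.\<close>

lemma sum_derangements_bij:
  assumes "bij_betw f S T"
  shows "(\<Sum>\<pi>\<in>derangements S. orbit_weight \<theta> S \<pi>) = (\<Sum>\<pi>\<in>derangements T. orbit_weight \<theta> T \<pi>)"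
proof -
  define g where "g = inv_into S f"
  have g: "bij_betw g T S" unfolding g_def by (rule bij_betw_inv_into[OF assms])
  have inj: "inj_on f S" "inj_on g T" and T: "f ` S = T" and S: "g ` T = S"
    using assms g by (auto simp: bij_betw_def)
  have gf: "g (f x) = x" if "x \<in> S" for x using that inj by (simp add: g_def)
  have fg: "f (g x) = x" if "x \<in> T" for x using that T by (simp add: g_def f_inv_into_f)
  show ?thesis
  proof (rule sum.reindex_bij_witness[of _ "map_permutation T g" "map_permutation S f"])
    fix \<pi> assume "\<pi> \<in> derangements S"
    then have \<pi>: "\<pi> permutes S" "\<And>x. x \<in> S \<Longrightarrow> \<pi> x \<noteq> x" by (auto simp: derangements_def)
    show "map_permutation T g (map_permutation S f \<pi>) = \<pi>"
      by (rule map_permutation_compose_inv[OF assms \<pi>(1) gf])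
    have "map_permutation S f \<pi> y \<noteq> y" if y: "y \<in> T" for y
    proof -
      obtain x where x: "x \<in> S" "y = f x" using y T by (metis imageE)
      then show ?thesis using \<pi>(2)[OF x(1)] permutes_in_image[OF \<pi>(1)]
        by (simp add: map_permutation_apply[OF inj(1)] inj_on_eq_iff[OF inj(1)])
    qed
    then show "map_permutation S f \<pi> \<in> derangements T"
      using map_permutation_permutes[OF assms \<pi>(1)] by (auto simp: derangements_def)
    show "orbit_weight \<theta> T (map_permutation S f \<pi>) = orbit_weight \<theta> S \<pi>"
      by (rule orbit_weight_map_permutation[OF assms \<pi>(1)])
  next
    fix \<pi> assume "\<pi> \<in> derangements T"
    then have \<pi>: "\<pi> permutes T" "\<And>x. x \<in> T \<Longrightarrow> \<pi> x \<noteq> x" by (auto simp: derangements_def)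
    show "map_permutation S f (map_permutation T g \<pi>) = \<pi>"
      by (rule map_permutation_compose_inv[OF g \<pi>(1) fg])
    have "map_permutation T g \<pi> y \<noteq> y" if y: "y \<in> S" for y
    proof -
      obtain x where x: "x \<in> T" "y = g x" using y S by (metis imageE)
      then show ?thesis using \<pi>(2)[OF x(1)] permutes_in_image[OF \<pi>(1)]
        by (simp add: map_permutation_apply[OF inj(2)] inj_on_eq_iff[OF inj(2)])
    qed
    then show "map_permutation T g \<pi> \<in> derangements S"
      using map_permutation_permutes[OF g \<pi>(1)] by (auto simp: derangements_def)
  qed
qed

text \<open>Normalized like \<open>perm_norm\<close>, so that both sequences are coefficients of
  exponential generating functions with the factorial included. The value at 0 is 1, from the empty
  derangement.\<close>

definition derangement_norm :: "(nat \<Rightarrow> real) \<Rightarrow> nat \<Rightarrow> real" where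
  "derangement_norm \<theta> n = (\<Sum>\<pi>\<in>derangements {1..n}. orbit_weight \<theta> {1..n} \<pi>) / fact n"

text \<open>A permutation whose fixed points are exactly \<open>A\<close> is a derangement of the
  complement, and each point of \<open>A\<close> is a cycle contributing one factor
  \<open>\<theta> 1\<close>. The result depends on \<open>A\<close> only through its cardinality:
  this is the conditional uniformity of the fixed-point set.\<close>

lemma sum_perm_weight_fixed_points_eq:
  assumes A: "A \<subseteq> {1..n}"
  shows "(\<Sum>\<pi> | \<pi> permutes {1..n} \<and> fixed_points n \<pi> = A. perm_weight \<theta> n \<pi>)
       = \<theta> 1 ^ card A * (fact (n - card A) * derangement_norm \<theta> (n - card A))"
proof -
  define B where "B = {1..n} - A"
  have fin: "finite A" "finite B" using A finite_subset by (auto simp: B_def)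
  have AB: "A \<union> B = {1..n}" "A \<inter> B = {}" using A by (auto simp: B_def)
  have "card B = n - card A" using A card_Diff_subset[OF fin(1) A] by (simp add: B_def)
  then obtain f where f: "bij_betw f B {1..n - card A}"
    using fin(2) finite_same_card_bij[of B "{1..n - card A}"] by auto
  have eq: "{\<pi>. \<pi> permutes {1..n} \<and> fixed_points n \<pi> = A} = derangements B"
  proof (intro equalityI subsetI)
    fix \<pi> assume "\<pi> \<in> {\<pi>. \<pi> permutes {1..n} \<and> fixed_points n \<pi> = A}"
    then have \<pi>: "\<pi> permutes {1..n}" "fixed_points n \<pi> = A" by auto
    have "\<pi> permutes B"
      by (rule permutes_superset[OF \<pi>(1)]) (use \<pi>(2) in \<open>auto simp: B_def fixed_points_def\<close>)
    then show "\<pi> \<in> derangements B"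
      using \<pi>(2) by (auto simp: derangements_def B_def fixed_points_def)
  next
    fix \<pi> assume "\<pi> \<in> derangements B"
    then have \<pi>: "\<pi> permutes B" "\<And>x. x \<in> B \<Longrightarrow> \<pi> x \<noteq> x" by (auto simp: derangements_def)
    have "\<pi> permutes {1..n}" using permutes_subset[OF \<pi>(1)] by (simp add: B_def)
    moreover have "\<pi> x = x" if "x \<in> A" for x
      using that permutes_not_in[OF \<pi>(1)] by (auto simp: B_def)
    ultimately show "\<pi> \<in> {\<pi>. \<pi> permutes {1..n} \<and> fixed_points n \<pi> = A}"
      using \<pi>(2) A by (auto simp: fixed_points_def B_def)
  qed
  have weight: "perm_weight \<theta> n \<pi> = \<theta> 1 ^ card A * orbit_weight \<theta> B \<pi>" if "\<pi> \<in> derangements B" for \<pi>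
  proof -
    have \<pi>: "\<pi> permutes B" using that by (simp add: derangements_def)
    have \<pi>n: "\<pi> permutes {1..n}" using that eq by blast
    have sing: "orbit \<pi> x = {x}" if "x \<in> A" for x
      using that permutes_not_in[OF \<pi>] by (auto simp: orbit_eq_singleton_iff B_def)
    have orbB: "C \<subseteq> B" if "C \<in> orbit \<pi> ` B" for C
      using that by (auto dest: permutes_orbit_subset[OF \<pi>, THEN subsetD])
    \<comment> \<open>Cycles through \<open>A\<close> are singletons inside \<open>A\<close> and the
      others stay inside \<open>B\<close>, so the product over all cycles splits.\<close>
    have disj: "orbit \<pi> ` A \<inter> orbit \<pi> ` B = {}"
      using orbB sing AB(2) by fastforce
    have "(\<Prod>C\<in>orbit \<pi> ` A. \<theta> (card C)) = (\<Prod>x\<in>A. \<theta> 1)"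
    proof -
      have "orbit \<pi> ` A = (\<lambda>x. {x}) ` A" using sing by simp
      then show ?thesis by (simp add: prod.reindex)
    qed
    then show ?thesis
      using disj fin
      unfolding perm_weight_eq_orbit_weight[OF \<pi>n] orbit_weight_def AB(1)[symmetric] image_Un
      by (subst prod.union_disjoint) auto
  qed
  show ?thesis
    unfolding eq using sum_derangements_bij[OF f, of \<theta>]
    by (simp add: weight sum_distrib_left[symmetric] derangement_norm_def)
qed

section \<open>Averages over fixed-point sets and the convolution identity\<close>

lemma sum_over_fixed_points:
  fixes F :: "nat set \<Rightarrow> real"
  shows "(\<Sum>\<pi> | \<pi> permutes {1..n}. perm_weight \<theta> n \<pi> * F (fixed_points n \<pi>))
       = fact n * (\<Sum>q\<le>n. \<theta> 1 ^ q / fact q * derangement_norm \<theta> (n - q) *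
            ((\<Sum>A | A \<subseteq> {1..n} \<and> card A = q. F A) / (n choose q)))"
proof -
  have "(\<Sum>\<pi> | \<pi> permutes {1..n}. perm_weight \<theta> n \<pi> * F (fixed_points n \<pi>))
      = (\<Sum>A\<in>Pow {1..n}. \<Sum>\<pi> | \<pi> \<in> {\<pi>. \<pi> permutes {1..n}} \<and> fixed_points n \<pi> = A.
           perm_weight \<theta> n \<pi> * F (fixed_points n \<pi>))"
    by (rule sum.group[symmetric]) (auto simp: fixed_points_def finite_permutations)
  also have "\<dots> = (\<Sum>A\<in>Pow {1..n}. (\<Sum>\<pi> | \<pi> permutes {1..n} \<and> fixed_points n \<pi> = A.
           perm_weight \<theta> n \<pi>) * F A)"
    unfolding sum_distrib_right by (intro sum.cong) auto
  also have "\<dots> = (\<Sum>A\<in>Pow {1..n}. \<theta> 1 ^ card A * (fact (n - card A) * derangement_norm \<theta> (n - card A)) * F A)"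
    by (intro sum.cong refl) (simp only: sum_perm_weight_fixed_points_eq Pow_iff)
  also have "\<dots> = (\<Sum>q\<le>n. \<Sum>A | A \<in> Pow {1..n} \<and> card A = q.
       \<theta> 1 ^ card A * (fact (n - card A) * derangement_norm \<theta> (n - card A)) * F A)"
    by (rule sum.group[symmetric]) (auto dest: card_mono[rotated])
  also have "\<dots> = (\<Sum>q\<le>n. fact n * (\<theta> 1 ^ q / fact q * derangement_norm \<theta> (n - q) *
            ((\<Sum>A | A \<subseteq> {1..n} \<and> card A = q. F A) / (n choose q))))"
  proof (rule sum.cong[OF refl])
    fix q assume "q \<in> {..n}"
    \<comment> \<open>Dividing by the binomial coefficient turns the sum over
      \<open>q\<close>-subsets into an average; \<open>fact n / fact q\<close> is what then remains
      of \<open>fact (n - q)\<close>.\<close>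
    then have "fact (n - q) = fact n / (fact q * real (n choose q))"
      by (simp add: binomial_fact)
    moreover have "(\<Sum>A | A \<in> Pow {1..n} \<and> card A = q.
       \<theta> 1 ^ card A * (fact (n - card A) * derangement_norm \<theta> (n - card A)) * F A)
       = \<theta> 1 ^ q * (fact (n - q) * derangement_norm \<theta> (n - q)) * (\<Sum>A | A \<subseteq> {1..n} \<and> card A = q. F A)"
      unfolding sum_distrib_left by (intro sum.cong) auto
    ultimately show "(\<Sum>A | A \<in> Pow {1..n} \<and> card A = q.
       \<theta> 1 ^ card A * (fact (n - card A) * derangement_norm \<theta> (n - card A)) * F A)
      = fact n * (\<theta> 1 ^ q / fact q * derangement_norm \<theta> (n - q) *
            ((\<Sum>A | A \<subseteq> {1..n} \<and> card A = q. F A) / (n choose q)))"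
      by simp
  qed
  finally show ?thesis by (simp add: sum_distrib_left)
qed

lemma perm_norm_convolution:
  "perm_norm \<theta> n = (\<Sum>q\<le>n. \<theta> 1 ^ q / fact q * derangement_norm \<theta> (n - q))"
proof -
  have "(\<Sum>q\<le>n. \<theta> 1 ^ q / fact q * derangement_norm \<theta> (n - q) *
            ((\<Sum>A | A \<subseteq> {1..n} \<and> card A = q. 1) / (n choose q)))
      = (\<Sum>q\<le>n. \<theta> 1 ^ q / fact q * derangement_norm \<theta> (n - q))"
    by (intro sum.cong refl) (simp add: n_subsets)
  then show ?thesis
    using sum_over_fixed_points[of \<theta> n "\<lambda>_. 1"] by (simp add: perm_norm_def)
qed

text \<open>The convolution for \<open>perm_norm\<close> multiplies the series of derangements by
  the exponential series at \<open>\<theta> 1\<close>, and the series at \<open>- \<theta> 1\<close>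
  inverts it. In this direction the unknown asymptotics of derangements are expressed through
  \<open>perm_norm\<close>, on which there is a hypothesis.\<close>

lemma derangement_norm_convolution:
  "derangement_norm \<theta> n = (\<Sum>j\<le>n. (- \<theta> 1) ^ j / fact j * perm_norm \<theta> (n - j))"
proof -
  have "Abs_fps (perm_norm \<theta>) = fps_exp (\<theta> 1) * Abs_fps (derangement_norm \<theta>)"
    by (rule fps_ext) (simp add: fps_mult_nth perm_norm_convolution atLeast0AtMost)
  then have "fps_exp (- \<theta> 1) * Abs_fps (perm_norm \<theta>) = Abs_fps (derangement_norm \<theta>)"
    by (simp add: mult.assoc[symmetric] fps_exp_add_mult[symmetric])
  then have "fps_nth (fps_exp (- \<theta> 1) * Abs_fps (perm_norm \<theta>)) n = derangement_norm \<theta> n"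
    by simp
  then show ?thesis by (simp add: fps_mult_nth atLeast0AtMost)
qed

lemma perm_weight_nonneg: "(\<And>k. k \<ge> 1 \<Longrightarrow> \<theta> k \<ge> 0) \<Longrightarrow> perm_weight \<theta> n \<pi> \<ge> 0"
  unfolding perm_weight_def by (intro prod_nonneg) auto

lemma perm_norm_nonneg: "(\<And>k. k \<ge> 1 \<Longrightarrow> \<theta> k \<ge> 0) \<Longrightarrow> perm_norm \<theta> n \<ge> 0"
  unfolding perm_norm_def by (intro divide_nonneg_pos sum_nonneg perm_weight_nonneg) auto

lemma derangement_norm_nonneg:
  assumes "\<And>k. k \<ge> 1 \<Longrightarrow> \<theta> k \<ge> 0"
  shows "derangement_norm \<theta> n \<ge> 0"
proof -
  have "orbit_weight \<theta> {1..n} \<pi> \<ge> 0" if "\<pi> \<in> derangements {1..n}" for \<pi>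
    using that perm_weight_nonneg[of \<theta> n \<pi>, OF assms]
    by (simp add: derangements_def perm_weight_eq_orbit_weight)
  then show ?thesis unfolding derangement_norm_def by (intro divide_nonneg_pos sum_nonneg) auto
qed

text \<open>The derangements are the term \<open>q = 0\<close> of a sum with nonnegative
  terms.\<close>

lemma derangement_norm_le_perm_norm:
  assumes "\<And>k. k \<ge> 1 \<Longrightarrow> \<theta> k \<ge> 0"
  shows "derangement_norm \<theta> n \<le> perm_norm \<theta> n"
proof -
  have "(\<Sum>q\<in>{0}. \<theta> 1 ^ q / fact q * derangement_norm \<theta> (n - q)) \<le> perm_norm \<theta> n"
    unfolding perm_norm_convolution using assms derangement_norm_nonneg[of \<theta>, OF assms]
    by (intro sum_mono2) auto
  then show ?thesis by simp
qed

text \<open>Expectations become mixtures over the number \<open>q\<close> of fixed points: a weight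
  for \<open>q\<close> times a mean over uniform \<open>q\<close>-subsets. If
  \<open>perm_norm \<theta> n = 0\<close>, both sides vanish because
  \<open>x / 0 = 0\<close>.\<close>

lemma integral_weighted_perm:
  fixes F :: "nat set \<Rightarrow> real"
  assumes \<theta>: "\<And>k. k \<ge> 1 \<Longrightarrow> \<theta> k \<ge> 0"
  shows "(\<integral>\<pi>. F (fixed_points n \<pi>) \<partial>weighted_perm \<theta> n)
       = (\<Sum>q\<le>n. \<theta> 1 ^ q / fact q * (derangement_norm \<theta> (n - q) / perm_norm \<theta> n) *
            ((\<Sum>A | A \<subseteq> {1..n} \<and> card A = q. F A) / (n choose q)))"
proof -
  have "(\<integral>\<pi>. F (fixed_points n \<pi>) \<partial>weighted_perm \<theta> n)
      = (\<Sum>\<pi> | \<pi> permutes {1..n}. (perm_weight \<theta> n \<pi> / (perm_norm \<theta> n * fact n)) *\<^sub>R F (fixed_points n \<pi>))"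
    unfolding weighted_perm_def
    by (rule lebesgue_integral_point_measure_finite)
       (auto simp: finite_permutations intro!: divide_nonneg_nonneg mult_nonneg_nonneg
          perm_weight_nonneg[OF \<theta>] perm_norm_nonneg[OF \<theta>])
  also have "\<dots> = (\<Sum>\<pi> | \<pi> permutes {1..n}. perm_weight \<theta> n \<pi> * F (fixed_points n \<pi>)) / (perm_norm \<theta> n * fact n)"
    by (simp add: sum_divide_distrib)
  also have "\<dots> = (\<Sum>q\<le>n. \<theta> 1 ^ q / fact q * (derangement_norm \<theta> (n - q) / perm_norm \<theta> n) *
            ((\<Sum>A | A \<subseteq> {1..n} \<and> card A = q. F A) / (n choose q)))"
    unfolding sum_over_fixed_points by (simp add: sum_divide_distrib)
  finally show ?thesis .
qed

section \<open>Ratios of normalizations and Tannery's theorem\<close>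

lemma ratio_tendsto:
  fixes h :: "nat \<Rightarrow> real"
  assumes nonneg: "\<And>n. h n \<ge> 0" and ratio: "(\<lambda>n. h (n - 1) / h n) \<longlonglongrightarrow> 1"
  shows "(\<lambda>n. h (n - j) / h n) \<longlonglongrightarrow> 1"
    and "\<exists>C \<ge> 0. eventually (\<lambda>n. h n > 0 \<and> (\<forall>j\<le>n. h (n - j) / h n \<le> C * 2 ^ j)) sequentially"
proof -
  have "eventually (\<lambda>n. h (n - 1) / h n > 0) sequentially"
    by (rule order_tendstoD(1)[OF ratio]) simp
  moreover have "eventually (\<lambda>n. h (n - 1) / h n < 2) sequentially"
    by (rule order_tendstoD(2)[OF ratio]) simp
  ultimately have "eventually (\<lambda>n. 0 < h n \<and> h (n - 1) \<le> 2 * h n) sequentially"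
  proof eventually_elim
    case (elim n)
    \<comment> \<open>Since \<open>x / 0 = 0\<close>, a positive ratio excludes
      \<open>h n = 0\<close>.\<close>
    have "h n \<noteq> 0" using elim by auto
    then show ?case using elim nonneg[of n] by (auto simp: field_simps)
  qed
  then obtain N where N: "\<And>n. n \<ge> N \<Longrightarrow> 0 < h n \<and> h (n - 1) \<le> 2 * h n"
    by (auto simp: eventually_sequentially)
  \<comment> \<open>While the index stays at or above \<open>N\<close>, each step back costs at most
    a factor two; any number larger than the limit 1 would serve.\<close>
  have backwards: "h (n - j) \<le> 2 ^ j * h n" if "n - j \<ge> N" for n j
    using that
  proof (induction j)
    case (Suc j)
    then have "h (n - Suc j) \<le> 2 * h (n - j)" using N[of "n - j"] by simp
    also have "\<dots> \<le> 2 * (2 ^ j * h n)" using Suc by (intro mult_left_mono) auto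
    finally show ?case by simp
  qed simp
  show "(\<lambda>n. h (n - j) / h n) \<longlonglongrightarrow> 1"
  proof (induction j)
    case 0
    have "eventually (\<lambda>n. h (n - 0) / h n = 1) sequentially"
      using eventually_ge_at_top[of N] by eventually_elim (use N in fastforce)
    then show ?case by (rule tendsto_eventually)
  next
    case (Suc j)
    \<comment> \<open>One more step back telescopes: the new factor is the given ratio evaluated at
      \<open>n - j\<close>.\<close>
    have "(\<lambda>n. h ((n - j) - 1) / h (n - j)) \<longlonglongrightarrow> 1"
      using filterlim_compose[OF ratio filterlim_minus_const_nat_at_top] by simp
    from tendsto_mult[OF this Suc.IH]
    have "(\<lambda>n. h ((n - j) - 1) / h (n - j) * (h (n - j) / h n)) \<longlonglongrightarrow> 1" by simp
    moreover have "eventually (\<lambda>n. h ((n - j) - 1) / h (n - j) * (h (n - j) / h n) = h (n - Suc j) / h n) sequentially"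
      using eventually_ge_at_top[of "N + j"]
    proof eventually_elim
      case (elim n)
      then have "h (n - j) > 0" using N[of "n - j"] by simp
      then show ?case by simp
    qed
    ultimately show ?case by (rule Lim_transform_eventually)
  qed
  define K where "K = (\<Sum>i<N. h i / h N)"
  have K: "K \<ge> 0" unfolding K_def using nonneg by (intro sum_nonneg) auto
  have upper: "h (n - j) / h n \<le> (1 + K) * 2 ^ j" if "n \<ge> N" "j \<le> n" for n j
  proof (cases "n - j \<ge> N")
    case True
    have "h (n - j) \<le> 2 ^ j * h n" by (rule backwards[OF True])
    also have "\<dots> \<le> (1 + K) * 2 ^ j * h n" using K nonneg[of n] by (simp add: mult_right_mono)
    finally show ?thesis using N[OF that(1)] by (simp add: field_simps)
  next
    case False
    have "h (n - j) / h N \<le> K" unfolding K_def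
      using False nonneg by (intro member_le_sum) simp_all
    moreover have "h N \<le> 2 ^ (n - N) * h n" using backwards[of n "n - N"] that by simp
    \<comment> \<open>Here \<open>n - j < N\<close>, so going back from \<open>n\<close> to
      \<open>N\<close> takes fewer than \<open>j\<close> steps.\<close>
    moreover have "(2::real) ^ (n - N) \<le> 2 ^ j" using False by (intro power_increasing) auto
    ultimately have "h (n - j) \<le> K * h N" "h N \<le> 2 ^ j * h n"
      using N[of N] nonneg[of n] mult_right_mono[of "2 ^ (n - N)" "2 ^ j" "h n"]
      by (simp_all add: pos_divide_le_eq)
    then have "h (n - j) \<le> K * (2 ^ j * h n)" using K by (meson mult_left_mono order_trans)
    also have "\<dots> \<le> (1 + K) * (2 ^ j * h n)" using nonneg[of n] by (intro mult_right_mono) auto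
    finally show ?thesis using N[OF that(1)] by (simp add: field_simps)
  qed
  then have "eventually (\<lambda>n. h n > 0 \<and> (\<forall>j\<le>n. h (n - j) / h n \<le> (1 + K) * 2 ^ j)) sequentially"
    using N unfolding eventually_sequentially by (intro exI[of _ N]) simp
  then show "\<exists>C \<ge> 0. eventually (\<lambda>n. h n > 0 \<and> (\<forall>j\<le>n. h (n - j) / h n \<le> C * 2 ^ j)) sequentially"
    using K by (intro exI[of _ "1 + K"]) simp
qed

text \<open>The growth \<open>C * 2 ^ j\<close> is harmless: multiplied by
  \<open>t ^ j / fact j\<close> it is dominated by the exponential series at
  \<open>2 * \<bar>t\<bar>\<close>. Terms beyond \<open>n\<close> are set to zero, so that the
  finite sums become series over one index set.\<close>

lemma tannery_ratio:
  fixes r :: "nat \<Rightarrow> nat \<Rightarrow> real" and t :: real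
  assumes C: "C \<ge> 0"
    and bound: "eventually (\<lambda>n. \<forall>j\<le>n. \<bar>r n j\<bar> \<le> C * 2 ^ j) sequentially"
    and lim: "\<And>j. (\<lambda>n. r n j) \<longlonglongrightarrow> L j"
  shows "(\<lambda>n. \<Sum>j\<le>n. t ^ j / fact j * r n j) \<longlonglongrightarrow> (\<Sum>j. t ^ j / fact j * L j)"
proof -
  define a where "a j n = (if j \<le> n then t ^ j / fact j * r n j else 0)" for j n
  have lim': "(\<lambda>n. a j n) \<longlonglongrightarrow> t ^ j / fact j * L j" for j
  proof -
    have "eventually (\<lambda>n. t ^ j / fact j * r n j = a j n) sequentially"
      using eventually_ge_at_top[of j] by eventually_elim (simp add: a_def)
    moreover have "(\<lambda>n. t ^ j / fact j * r n j) \<longlonglongrightarrow> t ^ j / fact j * L j"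
      by (intro tendsto_mult_left lim)
    ultimately show ?thesis by (rule Lim_transform_eventually[rotated])
  qed
  have bound': "eventually (\<lambda>(j, n). norm (a j n) \<le> C * ((2 * \<bar>t\<bar>) ^ j / fact j)) (at_top \<times>\<^sub>F sequentially)"
  proof -
    have "eventually (\<lambda>n. \<forall>j. norm (a j n) \<le> C * ((2 * \<bar>t\<bar>) ^ j / fact j)) sequentially"
      using bound
    proof (eventually_elim, intro allI)
      fix n j assume *: "\<forall>j\<le>n. \<bar>r n j\<bar> \<le> C * 2 ^ j"
      show "norm (a j n) \<le> C * ((2 * \<bar>t\<bar>) ^ j / fact j)"
      proof (cases "j \<le> n")
        case True
        have "norm (a j n) = \<bar>t\<bar> ^ j / fact j * \<bar>r n j\<bar>" using True by (simp add: a_def abs_mult power_abs)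
        also have "\<dots> \<le> \<bar>t\<bar> ^ j / fact j * (C * 2 ^ j)" using * True by (intro mult_left_mono) auto
        finally show ?thesis by (simp add: power_mult_distrib field_simps)
      qed (use C in \<open>simp add: a_def\<close>)
    qed
    then show ?thesis
      unfolding eventually_prod_filter
      by (intro exI[of _ "\<lambda>_. True"] exI[of _ "\<lambda>n. \<forall>j. norm (a j n) \<le> C * ((2 * \<bar>t\<bar>) ^ j / fact j)"]) auto
  qed
  have "summable (\<lambda>j. C * ((2 * \<bar>t\<bar>) ^ j / fact j))"
      using summable_exp[of "2 * \<bar>t\<bar>"] by (intro summable_mult) (simp add: divide_inverse mult.commute)
  note tannerys_theorem[OF lim' bound' this trivial_limit_sequentially, THEN conjunct2, THEN conjunct2]
  moreover have "suminf (\<lambda>j. a j n) = (\<Sum>j\<le>n. t ^ j / fact j * r n j)" for n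
    by (subst suminf_finite[of "{..n}"]) (auto simp: a_def)
  ultimately show ?thesis by simp
qed

lemma exp_real_suminf: "(\<Sum>j. t ^ j / fact j) = exp (t :: real)"
  by (simp add: exp_def divide_inverse mult.commute)

text \<open>Dividing the inverse convolution by \<open>perm_norm \<theta> n\<close> leaves a sum of
  \<open>(- \<theta> 1) ^ j / fact j\<close> times ratios tending to 1. The shift by
  \<open>q\<close> costs one more factor
  \<open>perm_norm \<theta> (n - q) / perm_norm \<theta> n\<close>, which also tends to 1.\<close>

lemma derangement_norm_ratio:
  assumes \<theta>: "\<And>k. k \<ge> 1 \<Longrightarrow> \<theta> k \<ge> 0"
    and ratio: "(\<lambda>n. perm_norm \<theta> (n - 1) / perm_norm \<theta> n) \<longlonglongrightarrow> 1"
  shows "(\<lambda>n. derangement_norm \<theta> (n - q) / perm_norm \<theta> n) \<longlonglongrightarrow> exp (- \<theta> 1)"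
proof -
  note h = ratio_tendsto[of "perm_norm \<theta>", OF perm_norm_nonneg[OF \<theta>] ratio]
  obtain C where C: "C \<ge> 0" "eventually (\<lambda>n. perm_norm \<theta> n > 0 \<and>
      (\<forall>j\<le>n. perm_norm \<theta> (n - j) / perm_norm \<theta> n \<le> C * 2 ^ j)) sequentially"
    using h(2) by blast
  have "(\<lambda>n. \<Sum>j\<le>n. (- \<theta> 1) ^ j / fact j * (perm_norm \<theta> (n - j) / perm_norm \<theta> n))
      \<longlonglongrightarrow> (\<Sum>j. (- \<theta> 1) ^ j / fact j * 1)"
  proof (rule tannery_ratio[OF C(1) _ h(1)])
    show "eventually (\<lambda>n. \<forall>j\<le>n. \<bar>perm_norm \<theta> (n - j) / perm_norm \<theta> n\<bar> \<le> C * 2 ^ j) sequentially"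
      using C(2) by eventually_elim (simp add: perm_norm_nonneg[OF \<theta>])
  qed
  then have lim0: "(\<lambda>n. derangement_norm \<theta> n / perm_norm \<theta> n) \<longlonglongrightarrow> exp (- \<theta> 1)"
    unfolding derangement_norm_convolution by (simp add: sum_divide_distrib exp_real_suminf)
  have "(\<lambda>n. derangement_norm \<theta> (n - q) / perm_norm \<theta> (n - q)) \<longlonglongrightarrow> exp (- \<theta> 1)"
    by (rule filterlim_compose[OF lim0 filterlim_minus_const_nat_at_top])
  from tendsto_mult[OF this h(1)[of q]]
  have "(\<lambda>n. derangement_norm \<theta> (n - q) / perm_norm \<theta> (n - q) * (perm_norm \<theta> (n - q) / perm_norm \<theta> n))
     \<longlonglongrightarrow> exp (- \<theta> 1)" by simp
  moreover have "eventually (\<lambda>n. derangement_norm \<theta> (n - q) / perm_norm \<theta> (n - q) * (perm_norm \<theta> (n - q) / perm_norm \<theta> n)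
      = derangement_norm \<theta> (n - q) / perm_norm \<theta> n) sequentially"
  proof -
    have "eventually (\<lambda>n. perm_norm \<theta> n > 0) sequentially" using C(2) by eventually_elim simp
    then have "eventually (\<lambda>n. perm_norm \<theta> (n - q) > 0) sequentially"
      by (rule eventually_compose_filterlim[OF _ filterlim_minus_const_nat_at_top])
    then show ?thesis by eventually_elim simp
  qed
  ultimately show ?thesis by (rule Lim_transform_eventually)
qed

text \<open>Reduces the problem to uniform \<open>q\<close>-subsets with \<open>q\<close> fixed: the
  weight of \<open>q\<close> tends to the Poisson probability, and only the limits
  \<open>L q\<close> of the means remain to be found. The domination combines
  \<open>derangement_norm_le_perm_norm\<close> with the bound \<open>K\<close>.\<close>

lemma integral_weighted_perm_tendsto:
  fixes F :: "nat \<Rightarrow> nat set \<Rightarrow> real"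
  assumes \<theta>: "\<And>k. k \<ge> 1 \<Longrightarrow> \<theta> k \<ge> 0"
    and ratio: "(\<lambda>n. perm_norm \<theta> (n - 1) / perm_norm \<theta> n) \<longlonglongrightarrow> 1"
    and bound: "\<And>n A. \<bar>F n A\<bar> \<le> K"
    and lim: "\<And>q. (\<lambda>n. (\<Sum>A | A \<subseteq> {1..n} \<and> card A = q. F n A) / (n choose q)) \<longlonglongrightarrow> L q"
  shows "(\<lambda>n. \<integral>\<pi>. F n (fixed_points n \<pi>) \<partial>weighted_perm \<theta> n)
       \<longlonglongrightarrow> (\<Sum>q. \<theta> 1 ^ q / fact q * exp (- \<theta> 1) * L q)"
proof -
  define avg where "avg n q = (\<Sum>A | A \<subseteq> {1..n} \<and> card A = q. F n A) / (n choose q)" for n q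
  obtain C where C: "C \<ge> 0" "eventually (\<lambda>n. perm_norm \<theta> n > 0 \<and>
      (\<forall>j\<le>n. perm_norm \<theta> (n - j) / perm_norm \<theta> n \<le> C * 2 ^ j)) sequentially"
    using ratio_tendsto(2)[of "perm_norm \<theta>", OF perm_norm_nonneg[OF \<theta>] ratio] by blast
  have K: "K \<ge> 0" using bound[of 0 "{}"] by linarith
  have avg: "\<bar>avg n q\<bar> \<le> K" for n q
  proof -
    have "\<bar>\<Sum>A | A \<subseteq> {1..n} \<and> card A = q. F n A\<bar> \<le> (\<Sum>A | A \<subseteq> {1..n} \<and> card A = q. K)"
      by (rule order_trans[OF sum_abs sum_mono]) (rule bound)
    also have "\<dots> = (n choose q) * K" by (simp add: n_subsets)
    \<comment> \<open>For \<open>q > n\<close> the binomial coefficient vanishes, and then so does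
      the quotient.\<close>
    finally show ?thesis using K by (cases "n choose q = 0") (auto simp: avg_def field_simps abs_divide)
  qed
  have "(\<lambda>n. \<Sum>q\<le>n. \<theta> 1 ^ q / fact q * (derangement_norm \<theta> (n - q) / perm_norm \<theta> n * avg n q))
       \<longlonglongrightarrow> (\<Sum>q. \<theta> 1 ^ q / fact q * (exp (- \<theta> 1) * L q))"
  proof (rule tannery_ratio[of "C * K"])
    show "C * K \<ge> 0" using C(1) K by simp
    show "(\<lambda>n. derangement_norm \<theta> (n - q) / perm_norm \<theta> n * avg n q) \<longlonglongrightarrow> exp (- \<theta> 1) * L q" for q
      by (intro tendsto_mult derangement_norm_ratio[OF \<theta> ratio] lim[of q, folded avg_def])
    show "eventually (\<lambda>n. \<forall>j\<le>n. \<bar>derangement_norm \<theta> (n - j) / perm_norm \<theta> n * avg n j\<bar> \<le> C * K * 2 ^ j) sequentially"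
      using C(2)
    proof (eventually_elim, intro allI impI)
      fix n j assume *: "perm_norm \<theta> n > 0 \<and> (\<forall>j\<le>n. perm_norm \<theta> (n - j) / perm_norm \<theta> n \<le> C * 2 ^ j)" "j \<le> n"
      have "\<bar>derangement_norm \<theta> (n - j) / perm_norm \<theta> n\<bar> \<le> perm_norm \<theta> (n - j) / perm_norm \<theta> n"
        using derangement_norm_le_perm_norm[of \<theta> "n - j", OF \<theta>] derangement_norm_nonneg[of \<theta> "n - j", OF \<theta>] *
        by (simp add: divide_right_mono)
      also have "\<dots> \<le> C * 2 ^ j" using * by blast
      finally have "\<bar>derangement_norm \<theta> (n - j) / perm_norm \<theta> n\<bar> * \<bar>avg n j\<bar> \<le> (C * 2 ^ j) * K"
        using avg C(1) by (intro mult_mono) auto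
      then show "\<bar>derangement_norm \<theta> (n - j) / perm_norm \<theta> n * avg n j\<bar> \<le> C * K * 2 ^ j"
        by (simp add: abs_mult mult_ac)
    qed
  qed
  moreover have "(\<integral>\<pi>. F n (fixed_points n \<pi>) \<partial>weighted_perm \<theta> n)
      = (\<Sum>q\<le>n. \<theta> 1 ^ q / fact q * (derangement_norm \<theta> (n - q) / perm_norm \<theta> n * avg n q))" for n
    using integral_weighted_perm[of \<theta> n "F n", OF \<theta>] by (simp only: avg_def mult.assoc)
  ultimately show ?thesis by (simp only: mult.assoc)
qed

section \<open>Products of exponential distributions\<close>

definition expo :: "real measure" where
  "expo = density lborel (exponential_density 1)"

abbreviation expos :: "nat set \<Rightarrow> (nat \<Rightarrow> real) measure" where
  "expos I \<equiv> PiM I (\<lambda>_. expo)"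

lemma sets_expo [simp, measurable_cong]: "sets expo = sets borel"
  by (simp add: expo_def)

lemma space_expo [simp]: "space expo = UNIV"
  by (simp add: expo_def)

interpretation expo: prob_space expo
  unfolding expo_def by (rule prob_space_exponential_density) simp

interpretation expos: product_prob_space "\<lambda>_::nat. expo" I for I
  by unfold_locales

lemma prob_space_expos: "prob_space (expos I)"
  by (rule prob_space_PiM) unfold_locales

lemma nn_integral_expo:
  assumes [measurable]: "f \<in> borel_measurable borel"
  shows "(\<integral>\<^sup>+x. f x \<partial>expo) = (\<integral>\<^sup>+x. ennreal (exp (- x)) * indicator {0..} x * f x \<partial>lborel)"
  unfolding expo_def
  by (subst nn_integral_density)
     (auto intro!: nn_integral_cong simp: exponential_density_def indicator_def)

section \<open>Null sets of products of exponential laws\<close>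

lemma AE_expo_pos: "AE x in expo. x > 0"
  unfolding expo_def
  by (subst AE_density) (use AE_lborel_singleton[of "0::real"] in
     \<open>auto simp: exponential_density_def elim!: eventually_mono\<close>)

lemma AE_expo_neq: "AE x in expo. x \<noteq> c"
  unfolding expo_def
  by (subst AE_density) (use AE_lborel_singleton[of c] in \<open>auto elim!: eventually_mono\<close>)

lemma measurable_coordinate: "i \<in> I \<Longrightarrow> (\<lambda>x. x i) \<in> borel_measurable (expos I)"
  using measurable_component_singleton[of i I "\<lambda>_. expo"] by (simp cong: measurable_cong_sets)

lemma AE_expos_pos:
  assumes "finite I"
  shows "AE x in expos I. \<forall>i\<in>I. x i > 0"
proof (rule AE_finite_allI[OF assms])
  fix i assume i: "i \<in> I"
  have "AE x in distr (expos I) expo (\<lambda>x. x i). x > 0"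
    unfolding expos.PiM_component[OF i] by (rule AE_expo_pos)
  then show "AE x in expos I. x i > 0"
    by (rule AE_distrD[rotated]) (use i in measurable)
qed

text \<open>The assumption \<open>upd\<close> says that \<open>f\<close> ignores coordinate
  \<open>i\<close>. With that coordinate integrated innermost, \<open>f x\<close> is a constant,
  which a variable with a density hits with probability zero.\<close>

lemma AE_expos_neq:
  assumes I: "finite I" "i \<in> I" and f [measurable]: "f \<in> borel_measurable (expos I)"
    and upd: "\<And>x y. f (x(i := y)) = f x"
  shows "AE x in expos I. x i \<noteq> f x"
proof -
  define J where "J = I - {i}"
  have J: "I = insert i J" "i \<notin> J" "finite J" using I by (auto simp: J_def)
  define g :: "(nat \<Rightarrow> real) \<Rightarrow> ennreal" where "g x = indicator {0} (x i - f x)" for x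
  have "g \<in> borel_measurable (expos I)"
    unfolding g_def
    by (rule measurable_compose[OF _ borel_measurable_indicator])
       (use I f in \<open>auto intro!: borel_measurable_diff measurable_component_singleton\<close>)
  then have g: "g \<in> borel_measurable (expos (insert i J))" by (simp only: J(1)[symmetric])
  have "(\<integral>\<^sup>+x. g x \<partial>expos I) = (\<integral>\<^sup>+x. (\<integral>\<^sup>+y. g (x(i := y)) \<partial>expo) \<partial>expos J)"
    unfolding J(1) by (rule expos.product_nn_integral_insert[OF J(3,2) g])
  also have "\<dots> = (\<integral>\<^sup>+x. 0 \<partial>expos J)"
  proof (rule nn_integral_cong)
    fix x
    have "(\<integral>\<^sup>+y. g (x(i := y)) \<partial>expo) = (\<integral>\<^sup>+y. 0 \<partial>expo)"
      by (rule nn_integral_cong_AE) (use AE_expo_neq[of "f x"] in \<open>auto simp: g_def upd elim!: eventually_mono\<close>)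
    then show "(\<integral>\<^sup>+y. g (x(i := y)) \<partial>expo) = 0" by simp
  qed
  finally have "(\<integral>\<^sup>+x. g x \<partial>expos I) = 0" by simp
  then have "AE x in expos I. g x = 0"
    unfolding J(1) by (simp only: nn_integral_0_iff_AE[OF g])
  then show ?thesis by eventually_elim (auto simp: g_def indicator_def)
qed

lemma AE_expos_inj:
  assumes "finite I"
  shows "AE x in expos I. inj_on x I"
proof -
  have "AE x in expos I. \<forall>i\<in>I. \<forall>j\<in>I. i \<noteq> j \<longrightarrow> x i \<noteq> x j"
    by (intro AE_finite_allI assms AE_impI AE_expos_neq) auto
  then show ?thesis by eventually_elim (auto simp: inj_on_def)
qed

text \<open>The substitution \<open>y = a + z\<close> splits the density into
  \<open>exp (- a) * exp (- z)\<close>, and \<open>a \<ge> 0\<close> makes the condition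
  \<open>y \<ge> a\<close> coincide with the support condition \<open>z \<ge> 0\<close>.\<close>

lemma expo_memoryless:
  assumes a: "a \<ge> 0" and [measurable]: "h \<in> borel_measurable borel"
  shows "(\<integral>\<^sup>+y. indicator {a..} y * h y \<partial>expo) = ennreal (exp (- a)) * (\<integral>\<^sup>+y. h (a + y) \<partial>expo)"
proof -
  have "(\<integral>\<^sup>+y. indicator {a..} y * h y \<partial>expo)
      = (\<integral>\<^sup>+y. ennreal (exp (- y)) * indicator {0..} y * (indicator {a..} y * h y) \<partial>lborel)"
    by (rule nn_integral_expo) measurable
  also have "\<dots> = (\<integral>\<^sup>+y. ennreal (exp (- (a + y))) * indicator {0..} (a + y) * (indicator {a..} (a + y) * h (a + y)) \<partial>lborel)"
    by (subst nn_integral_real_affine[of _ 1 a]) simp_all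
  also have "\<dots> = (\<integral>\<^sup>+y. ennreal (exp (- a)) * (ennreal (exp (- y)) * indicator {0..} y * h (a + y)) \<partial>lborel)"
  proof (rule nn_integral_cong)
    fix y :: real
    have "ennreal (exp (- (a + y))) = ennreal (exp (- a)) * ennreal (exp (- y))"
      by (simp add: mult_exp_exp flip: ennreal_mult)
    then show "ennreal (exp (- (a + y))) * indicator {0..} (a + y) * (indicator {a..} (a + y) * h (a + y))
      = ennreal (exp (- a)) * (ennreal (exp (- y)) * indicator {0..} y * h (a + y))"
      using a by (simp add: indicator_def mult.assoc)
  qed
  also have "\<dots> = ennreal (exp (- a)) * (\<integral>\<^sup>+y. ennreal (exp (- y)) * indicator {0..} y * h (a + y) \<partial>lborel)"
    by (rule nn_integral_cmult) measurable
  also have "(\<integral>\<^sup>+y. ennreal (exp (- y)) * indicator {0..} y * h (a + y) \<partial>lborel) = (\<integral>\<^sup>+y. h (a + y) \<partial>expo)"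
    by (rule nn_integral_expo[symmetric]) measurable
  finally show ?thesis .
qed

lemma measurable_fun_upd_pair:
  "(\<lambda>(x, y). x(i := y)) \<in> measurable (expos J \<Otimes>\<^sub>M expo) (expos (insert i J))"
  by (rule measurable_add_dim)

lemma measurable_shift:
  "(\<lambda>y. \<lambda>j\<in>J. a + y j) \<in> measurable (expos J) (expos J)"
  by (rule measurable_restrict) measurable

text \<open>Each variable in turn is shifted by the common threshold \<open>a\<close> at the price
  of a factor \<open>exp (- a)\<close>. In the induction, \<open>H\<close> is what is left of the
  integrand once coordinate \<open>i\<close> has been shifted and integrated out.\<close>

lemma expos_memoryless:
  assumes J: "finite J" and a: "a \<ge> 0" and G: "G \<in> borel_measurable (expos J)"
  shows "(\<integral>\<^sup>+y. (\<Prod>j\<in>J. indicator {a..} (y j)) * G y \<partial>expos J)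
       = ennreal (exp (- a)) ^ card J * (\<integral>\<^sup>+y. G (\<lambda>j\<in>J. a + y j) \<partial>expos J)"
  using J G
proof (induction J arbitrary: G rule: finite_induct)
  case empty
  then show ?case by (simp add: PiM_empty nn_integral_count_space_finite restrict_def)
next
  case (insert i J)
  note [measurable] = insert.prems measurable_shift
  have Gupd [measurable]: "(\<lambda>(y, x). G (y(i := x))) \<in> borel_measurable (expos J \<Otimes>\<^sub>M expo)"
    using measurable_compose[OF measurable_fun_upd_pair insert.prems] by (simp add: case_prod_beta)
  have Gx [measurable]: "(\<lambda>x. G (y(i := x))) \<in> borel_measurable borel" if "y \<in> space (expos J)" for y
    using measurable_compose[OF measurable_Pair1'[OF that] Gupd] by simp
  define H where "H y = ennreal (exp (- a)) * (\<integral>\<^sup>+x. G (y(i := a + x)) \<partial>expo)" for y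
  have [measurable]: "(\<lambda>(y, x). G (y(i := a + x))) \<in> borel_measurable (expos J \<Otimes>\<^sub>M expo)"
  proof -
    have "(\<lambda>(y, x). (y, a + x)) \<in> measurable (expos J \<Otimes>\<^sub>M expo) (expos J \<Otimes>\<^sub>M expo)" by measurable
    from measurable_compose[OF this Gupd] show ?thesis by (simp add: case_prod_beta)
  qed
  have H [measurable]: "H \<in> borel_measurable (expos J)"
    unfolding H_def by measurable
  have "(\<integral>\<^sup>+y. (\<Prod>j\<in>insert i J. indicator {a..} (y j)) * G y \<partial>expos (insert i J))
     = (\<integral>\<^sup>+y. (\<integral>\<^sup>+x. (\<Prod>j\<in>insert i J. indicator {a..} ((y(i := x)) j)) * G (y(i := x)) \<partial>expo) \<partial>expos J)"
    by (rule expos.product_nn_integral_insert[OF insert.hyps]) measurable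
  also have "\<dots> = (\<integral>\<^sup>+y. (\<Prod>j\<in>J. indicator {a..} (y j)) * H y \<partial>expos J)"
  proof (rule nn_integral_cong)
    fix y assume y: "y \<in> space (expos J)"
    note [measurable] = Gx[OF y]
    have *: "(\<Prod>j\<in>J. indicator {a..} ((y(i := x)) j)) = (\<Prod>j\<in>J. indicator {a..} (y j) :: ennreal)" for x
      by (rule prod.cong) (use insert.hyps in auto)
    have "(\<integral>\<^sup>+x. (\<Prod>j\<in>insert i J. indicator {a..} ((y(i := x)) j)) * G (y(i := x)) \<partial>expo)
       = (\<integral>\<^sup>+x. (\<Prod>j\<in>J. indicator {a..} (y j)) * (indicator {a..} x * G (y(i := x))) \<partial>expo)"
      by (rule nn_integral_cong) (simp add: prod.insert[OF insert.hyps] * mult_ac del: fun_upd_apply prod.insert, simp add: mult_ac)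
    also have "\<dots> = (\<Prod>j\<in>J. indicator {a..} (y j)) * (\<integral>\<^sup>+x. indicator {a..} x * G (y(i := x)) \<partial>expo)"
      by (rule nn_integral_cmult) measurable
    also have "(\<integral>\<^sup>+x. indicator {a..} x * G (y(i := x)) \<partial>expo) = H y"
      unfolding H_def by (rule expo_memoryless[OF a]) measurable
    finally show "(\<integral>\<^sup>+x. (\<Prod>j\<in>insert i J. indicator {a..} ((y(i := x)) j)) * G (y(i := x)) \<partial>expo)
       = (\<Prod>j\<in>J. indicator {a..} (y j)) * H y" .
  qed
  also have "\<dots> = ennreal (exp (- a)) ^ card J * (\<integral>\<^sup>+y. H (\<lambda>j\<in>J. a + y j) \<partial>expos J)"
    by (rule insert.IH[OF H])
  also have "(\<integral>\<^sup>+y. H (\<lambda>j\<in>J. a + y j) \<partial>expos J)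
     = ennreal (exp (- a)) * (\<integral>\<^sup>+y. (\<integral>\<^sup>+x. G ((\<lambda>j\<in>J. a + y j)(i := a + x)) \<partial>expo) \<partial>expos J)"
    unfolding H_def by (rule nn_integral_cmult) measurable
  also have "(\<integral>\<^sup>+y. (\<integral>\<^sup>+x. G ((\<lambda>j\<in>J. a + y j)(i := a + x)) \<partial>expo) \<partial>expos J)
     = (\<integral>\<^sup>+y. (\<integral>\<^sup>+x. G (\<lambda>j\<in>insert i J. a + (y(i := x)) j) \<partial>expo) \<partial>expos J)"
  proof (intro nn_integral_cong arg_cong[where f = G] ext)
    fix y x j
    show "((\<lambda>j\<in>J. a + y j)(i := a + x)) j = (\<lambda>j\<in>insert i J. a + (y(i := x)) j) j"
      using insert.hyps by (auto simp: restrict_def)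
  qed
  also have "\<dots> = (\<integral>\<^sup>+y. G (\<lambda>j\<in>insert i J. a + y j) \<partial>expos (insert i J))"
    by (rule expos.product_nn_integral_insert[OF insert.hyps, symmetric]) measurable
  also have "ennreal (exp (- a)) ^ card J * (ennreal (exp (- a)) * (\<integral>\<^sup>+y. G (\<lambda>j\<in>insert i J. a + y j) \<partial>expos (insert i J)))
     = ennreal (exp (- a)) ^ card (insert i J) * (\<integral>\<^sup>+y. G (\<lambda>j\<in>insert i J. a + y j) \<partial>expos (insert i J))"
    unfolding card_insert_disjoint[OF insert.hyps] power_Suc2 mult.assoc ..
  finally show ?case .
qed

text \<open>
  Almost surely exactly one variable is minimal; by lack of memory the others exceed it by
  independent exponential amounts.
\<close>

lemma expos_peel_min:
  assumes I: "finite I" "I \<noteq> {}" and G: "G \<in> borel_measurable (expos I)"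
  shows "(\<integral>\<^sup>+x. G x \<partial>expos I)
       = (\<Sum>i\<in>I. \<integral>\<^sup>+a. ennreal (exp (- a)) ^ (card I - 1) *
            (\<integral>\<^sup>+x. G ((\<lambda>j\<in>I - {i}. a + x j)(i := a)) \<partial>expos (I - {i})) \<partial>expo)"
proof -
  note [measurable] = G
  \<comment> \<open>A partition of unity: when the values are distinct, the product for
    \<open>i\<close> is one exactly if \<open>i\<close> is the minimizer.\<close>
  have one: "(\<Sum>i\<in>I. \<Prod>j\<in>I - {i}. indicator {x i..} (x j) :: ennreal) = 1" if inj: "inj_on x I" for x :: "nat \<Rightarrow> real"
  proof -
    obtain m where m: "m \<in> I" "\<And>j. j \<in> I \<Longrightarrow> x m \<le> x j"
      using I by (metis arg_min_if_finite(1) arg_min_least)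
    have "(\<Prod>j\<in>I - {i}. indicator {x i..} (x j) :: ennreal) = (if i = m then 1 else 0)" if i: "i \<in> I" for i
    proof (cases "i = m")
      case True
      then show ?thesis using m(2) by (simp add: indicator_def)
    next
      case False
      then have "x i \<noteq> x m" using inj_onD[OF inj _ i m(1)] by blast
      then have "indicator {x i..} (x m) = (0 :: ennreal)" using m(2)[OF i] by (simp add: indicator_def)
      moreover have "m \<in> I - {i}" using False m(1) by simp
      ultimately have "(\<Prod>j\<in>I - {i}. indicator {x i..} (x j)) = (0 :: ennreal)"
        using I(1) by (intro prod_zero) blast+
      then show ?thesis using False by simp
    qed
    then have "(\<Sum>i\<in>I. \<Prod>j\<in>I - {i}. indicator {x i..} (x j) :: ennreal) = (\<Sum>i\<in>I. if i = m then 1 else 0)"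
      by (rule sum.cong[OF refl])
    also have "\<dots> = 1" using I(1) m(1) by simp
    finally show ?thesis .
  qed
  have ind: "(\<lambda>x. \<Prod>j\<in>I - {i}. indicator {x i..} (x j) :: ennreal) \<in> borel_measurable (expos I)" if i: "i \<in> I" for i
  proof -
    \<comment> \<open>The endpoint \<open>x i\<close> is itself random; a fixed half-line applied to
      the difference makes measurability visible.\<close>
    have "(\<lambda>x. indicator {0..} (x j - x i) :: ennreal) \<in> borel_measurable (expos I)" if "j \<in> I - {i}" for j
      using that i
      by (intro measurable_compose[OF _ borel_measurable_indicator])
         (auto intro!: borel_measurable_diff measurable_component_singleton)
    then have "(\<lambda>x. \<Prod>j\<in>I - {i}. indicator {0..} (x j - x i) :: ennreal) \<in> borel_measurable (expos I)"
      by (rule borel_measurable_prod_ennreal)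
    moreover have "indicator {0..} (x j - x i) = (indicator {x i..} (x j) :: ennreal)" for x :: "nat \<Rightarrow> real" and j
      by (simp add: indicator_def)
    ultimately show ?thesis by (simp only:)
  qed
  have "(\<integral>\<^sup>+x. G x \<partial>expos I) = (\<integral>\<^sup>+x. (\<Sum>i\<in>I. (\<Prod>j\<in>I - {i}. indicator {x i..} (x j)) * G x) \<partial>expos I)"
  proof (rule nn_integral_cong_AE)
    have "G x = (\<Sum>i\<in>I. (\<Prod>j\<in>I - {i}. indicator {x i..} (x j)) * G x)" if "inj_on x I" for x
      using one[OF that] sum_distrib_right[of "\<lambda>i. \<Prod>j\<in>I - {i}. indicator {x i..} (x j)" I "G x"] by (metis mult_1)
    then show "AE x in expos I. G x = (\<Sum>i\<in>I. (\<Prod>j\<in>I - {i}. indicator {x i..} (x j)) * G x)"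
      using AE_expos_inj[OF I(1)] by (auto elim!: eventually_mono)
  qed
  also have "\<dots> = (\<Sum>i\<in>I. \<integral>\<^sup>+x. (\<Prod>j\<in>I - {i}. indicator {x i..} (x j)) * G x \<partial>expos I)"
    by (rule nn_integral_sum) (rule borel_measurable_times_ennreal[OF ind G])
  also have "\<dots> = (\<Sum>i\<in>I. \<integral>\<^sup>+a. ennreal (exp (- a)) ^ (card I - 1) *
            (\<integral>\<^sup>+x. G ((\<lambda>j\<in>I - {i}. a + x j)(i := a)) \<partial>expos (I - {i})) \<partial>expo)"
  proof (rule sum.cong[OF refl])
    fix i assume i: "i \<in> I"
    define J where "J = I - {i}"
    have J: "I = insert i J" "i \<notin> J" "finite J" "card J = card I - 1" using I i by (auto simp: J_def)
    have Gupd: "(\<lambda>x. G (x(i := a))) \<in> borel_measurable (expos J)" for a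
    proof -
      have "(\<lambda>x. (x, a)) \<in> measurable (expos J) (expos J \<Otimes>\<^sub>M expo)" by measurable
      from measurable_compose[OF measurable_compose[OF this measurable_fun_upd_pair] G[unfolded J(1)]]
      show ?thesis by simp
    qed
    have ind': "(\<lambda>x. (\<Prod>j\<in>J. indicator {x i..} (x j)) * G x) \<in> borel_measurable (expos (insert i J))"
      using borel_measurable_times_ennreal[OF ind[OF i] G] unfolding J_def[symmetric] J(1)[symmetric] .
    \<comment> \<open>Coordinate \<open>i\<close> becomes the outer variable \<open>a\<close>, so
      that inside it is a constant threshold for all the others.\<close>
    have "(\<integral>\<^sup>+x. (\<Prod>j\<in>J. indicator {x i..} (x j)) * G x \<partial>expos (insert i J))
       = (\<integral>\<^sup>+a. (\<integral>\<^sup>+x. (\<Prod>j\<in>J. indicator {(x(i := a)) i..} ((x(i := a)) j)) * G (x(i := a)) \<partial>expos J) \<partial>expo)"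
      by (rule expos.product_nn_integral_insert_rev[OF J(3,2) ind'])
    also have "\<dots> = (\<integral>\<^sup>+a. (\<integral>\<^sup>+x. (\<Prod>j\<in>J. indicator {a..} (x j)) * G (x(i := a)) \<partial>expos J) \<partial>expo)"
    proof (intro nn_integral_cong arg_cong2[where f = "(*)"] refl prod.cong)
      fix a x j assume "j \<in> J"
      then have "j \<noteq> i" using J(2) by blast
      then show "indicator {(x(i := a)) i..} ((x(i := a)) j) = (indicator {a..} (x j) :: ennreal)" by simp
    qed
    also have "\<dots> = (\<integral>\<^sup>+a. ennreal (exp (- a)) ^ card J * (\<integral>\<^sup>+x. G ((\<lambda>j\<in>J. a + x j)(i := a)) \<partial>expos J) \<partial>expo)"
    proof (rule nn_integral_cong_AE, use AE_expo_pos in eventually_elim)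
      case (elim a)
      then show ?case by (intro expos_memoryless[OF J(3) _ Gupd]) simp
    qed
    finally show "(\<integral>\<^sup>+x. (\<Prod>j\<in>I - {i}. indicator {x i..} (x j)) * G x \<partial>expos I)
      = (\<integral>\<^sup>+a. ennreal (exp (- a)) ^ (card I - 1) *
            (\<integral>\<^sup>+x. G ((\<lambda>j\<in>I - {i}. a + x j)(i := a)) \<partial>expos (I - {i})) \<partial>expo)"
      unfolding J_def[symmetric] J(4)[symmetric] by (simp only: J(1)[symmetric])
  qed
  finally show ?thesis .
qed

text \<open>The minimum of \<open>k + 1\<close> exponential variables has rate \<open>k + 1\<close>.
  The factor \<open>Suc k\<close> counts the candidates for the minimizer and cancels the Jacobian
  of \<open>a = b / (k + 1)\<close>.\<close>

lemma expo_scale: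
  assumes [measurable]: "\<phi> \<in> borel_measurable borel"
  shows "of_nat (Suc k) * (\<integral>\<^sup>+a. ennreal (exp (- a)) ^ k * \<phi> a \<partial>expo) = (\<integral>\<^sup>+b. \<phi> (b / real (Suc k)) \<partial>expo)"
proof -
  define c where "c = 1 / real (Suc k)"
  have c: "c > 0" "real (Suc k) * c = 1" by (simp_all add: c_def)
  have "(\<integral>\<^sup>+a. ennreal (exp (- a)) ^ k * \<phi> a \<partial>expo)
      = (\<integral>\<^sup>+a. ennreal (exp (- a)) * indicator {0..} a * (ennreal (exp (- a)) ^ k * \<phi> a) \<partial>lborel)"
    by (rule nn_integral_expo) measurable
  also have "\<dots> = ennreal \<bar>c\<bar> * (\<integral>\<^sup>+b. ennreal (exp (- (0 + c * b))) * indicator {0..} (0 + c * b) *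
      (ennreal (exp (- (0 + c * b))) ^ k * \<phi> (0 + c * b)) \<partial>lborel)"
    by (rule nn_integral_real_affine) (use c in auto)
  also have "(\<integral>\<^sup>+b. ennreal (exp (- (0 + c * b))) * indicator {0..} (0 + c * b) *
      (ennreal (exp (- (0 + c * b))) ^ k * \<phi> (0 + c * b)) \<partial>lborel)
    = (\<integral>\<^sup>+b. ennreal (exp (- b)) * indicator {0..} b * \<phi> (b / real (Suc k)) \<partial>lborel)"
  proof (rule nn_integral_cong)
    fix b :: real
    have "exp (- (c * b)) * exp (- (c * b)) ^ k = exp (- b)"
    proof -
      have "exp (- (c * b)) * exp (- (c * b)) ^ k = exp (real (Suc k) * (- (c * b)))"
        unfolding exp_of_nat_mult by simp
      also have "real (Suc k) * (- (c * b)) = - b" by (simp add: c_def)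
      finally show ?thesis .
    qed
    then have E: "ennreal (exp (- (c * b))) * ennreal (exp (- (c * b))) ^ k = ennreal (exp (- b))"
      by (simp only: ennreal_power[OF exp_ge_zero] ennreal_mult'[OF exp_ge_zero, symmetric])
    have "indicator {0..} (0 + c * b) = (indicator {0..} b :: ennreal)"
      using c(1) by (simp add: indicator_def zero_le_mult_iff)
    moreover have "0 + c * b = b / real (Suc k)" by (simp add: c_def)
    moreover have "x * i * (y * z) = (x * y) * i * z" for x y i z :: ennreal by (simp only: mult_ac)
    ultimately show "ennreal (exp (- (0 + c * b))) * indicator {0..} (0 + c * b) *
      (ennreal (exp (- (0 + c * b))) ^ k * \<phi> (0 + c * b))
      = ennreal (exp (- b)) * indicator {0..} b * \<phi> (b / real (Suc k))"
      using E by (metis add_0)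
  qed
  also have "\<dots> = (\<integral>\<^sup>+b. \<phi> (b / real (Suc k)) \<partial>expo)"
    by (rule nn_integral_expo[symmetric]) measurable
  finally have "of_nat (Suc k) * (\<integral>\<^sup>+a. ennreal (exp (- a)) ^ k * \<phi> a \<partial>expo)
      = (of_nat (Suc k) * ennreal c) * (\<integral>\<^sup>+b. \<phi> (b / real (Suc k)) \<partial>expo)"
    using c(1) by (simp add: mult.assoc)
  also have "of_nat (Suc k) * ennreal c = 1"
  proof -
    have "of_nat (Suc k) * ennreal c = ennreal (real (Suc k)) * ennreal c"
      by (simp only: ennreal_of_nat_eq_real_of_nat)
    also have "\<dots> = ennreal (real (Suc k) * c)" using c(1) by (subst ennreal_mult) auto
    finally show ?thesis using c(2) by simp
  qed
  finally show ?thesis by simp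
qed

section \<open>Extreme spacings and Renyi's representation\<close>

lemma measure_Collect_cong_AE:
  assumes "AE x in M. P x = Q x" "{x \<in> space M. P x} \<in> sets M" "{x \<in> space M. Q x} \<in> sets M"
  shows "measure M {x \<in> space M. P x} = measure M {x \<in> space M. Q x}"
  by (rule measure_eq_AE) (use assms in \<open>auto elim!: eventually_mono\<close>)

text \<open>The expectation of \<open>g\<close> at Renyi's form of the pair (maximum, sum) of
  \<open>k\<close> variables.\<close>

definition renyi :: "nat \<Rightarrow> (real \<times> real \<Rightarrow> ennreal) \<Rightarrow> ennreal" where
  "renyi k g = (\<integral>\<^sup>+x. g (\<Sum>i=1..k. x i / real i, \<Sum>i=1..k. x i) \<partial>expos {1..k})"

lemma measurable_sum_expos:
  fixes f :: "nat \<Rightarrow> real \<Rightarrow> real"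
  assumes "J \<subseteq> I" and "\<And>i. f i \<in> borel_measurable borel"
  shows "(\<lambda>x. \<Sum>i\<in>J. f i (x i)) \<in> borel_measurable (expos I)"
proof (rule borel_measurable_sum)
  fix i assume "i \<in> J"
  then have "(\<lambda>x. x i) \<in> measurable (expos I) expo"
    using assms(1) by (intro measurable_component_singleton) auto
  then show "(\<lambda>x. f i (x i)) \<in> borel_measurable (expos I)"
    by (rule measurable_compose) (use assms(2) in simp)
qed

lemma measurable_Max_expos:
  "finite J \<Longrightarrow> J \<subseteq> I \<Longrightarrow> (\<lambda>x. Max (insert 0 (x ` J))) \<in> borel_measurable (expos I)"
proof (induction J rule: finite_induct)
  case (insert i J)
  have "(\<lambda>x. max (x i) (Max (insert 0 (x ` J)))) \<in> borel_measurable (expos I)"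
    using insert by (intro borel_measurable_max) (auto intro!: measurable_component_singleton)
  then show ?case using insert.hyps(1) by (simp add: insert_commute[of 0])
qed simp

lemma measurable_Min_expos:
  assumes "finite J" "J \<subseteq> I"
  shows "(\<lambda>x. Min (x ` J)) \<in> borel_measurable (expos I)"
  by (rule borel_measurable_Min[OF assms(1), of "\<lambda>i x. x i"]) (use assms(2) in \<open>auto intro: measurable_coordinate\<close>)

text \<open>Splitting off the last coordinate \<open>b\<close> adds \<open>b / (k + 1)\<close> to
  the first component and \<open>b\<close> to the second. This is the same recursion as peeling off
  a minimum \<open>a = b / (k + 1)\<close>.\<close>

lemma renyi_Suc:
  assumes [measurable]: "g \<in> borel_measurable borel"
  shows "renyi (Suc k) g = (\<integral>\<^sup>+b. renyi k (\<lambda>(s, t). g (b / real (Suc k) + s, b + t)) \<partial>expo)"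
proof -
  have I: "{1..Suc k} = insert (Suc k) {1..k}" by auto
  have [measurable]: "(\<lambda>x. \<Sum>i\<in>{1..Suc k}. x i / real i) \<in> borel_measurable (expos {1..Suc k})"
    "(\<lambda>x. \<Sum>i\<in>{1..Suc k}. x i) \<in> borel_measurable (expos {1..Suc k})"
    by (rule measurable_sum_expos, simp_all)+
  have meas: "(\<lambda>x. g (\<Sum>i=1..Suc k. x i / real i, \<Sum>i=1..Suc k. x i)) \<in> borel_measurable (expos (insert (Suc k) {1..k}))"
    unfolding I[symmetric] by measurable
  have upd: "(\<Sum>i=1..Suc k. (x(Suc k := b)) i / real i) = b / real (Suc k) + (\<Sum>i=1..k. x i / real i)"
      "(\<Sum>i=1..Suc k. (x(Suc k := b)) i) = b + (\<Sum>i=1..k. x i)" for x and b :: real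
    by simp_all
  have "renyi (Suc k) g = (\<integral>\<^sup>+b. (\<integral>\<^sup>+x. g (\<Sum>i=1..Suc k. (x(Suc k := b)) i / real i, \<Sum>i=1..Suc k. (x(Suc k := b)) i) \<partial>expos {1..k}) \<partial>expo)"
    unfolding renyi_def I
    by (subst expos.product_nn_integral_insert_rev) (use meas in \<open>simp_all add: I[symmetric]\<close>)
  then show ?thesis unfolding upd renyi_def by simp
qed

lemma measurable_renyi:
  assumes [measurable]: "(\<lambda>(a, p). G a p) \<in> borel_measurable (borel \<Otimes>\<^sub>M borel)"
  shows "(\<lambda>a. renyi k (G a)) \<in> borel_measurable borel"
proof -
  have [measurable]: "(\<lambda>x. \<Sum>i=1..k. x i / real i) \<in> borel_measurable (expos {1..k})"
    "(\<lambda>x. \<Sum>i=1..k. x i) \<in> borel_measurable (expos {1..k})"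
    by (rule measurable_sum_expos, simp_all)+
  show ?thesis unfolding renyi_def by measurable
qed

text \<open>The inserted 0 allows \<open>Y\<close> to be empty, as happens when the last variable is
  peeled off, and it accounts for \<open>a\<close> itself as the shifted image of 0.\<close>

lemma Max_shift:
  fixes Y :: "real set"
  assumes "finite Y" "a \<ge> 0"
  shows "Max (insert 0 (insert a ((+) a ` Y))) = a + Max (insert 0 Y)"
proof -
  have "insert a ((+) a ` Y) = (+) a ` insert 0 Y" by simp
  moreover have "Max ((+) a ` insert 0 Y) = a + Max (insert 0 Y)"
    by (rule mono_Max_commute[symmetric]) (use assms in \<open>auto simp: mono_def\<close>)
  moreover have "Max (insert 0 Y) \<ge> 0" using assms by simp
  ultimately show ?thesis using assms by (subst Max_insert) auto
qed

text \<open>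
  Peeling off the minimum \<open>a\<close> turns the maximum and the sum of \<open>k + 1\<close> variables into
  \<open>a + max\<close> and \<open>(k + 1) a + sum\<close> of \<open>k\<close> fresh ones, where \<open>b = (k + 1) a\<close> is
  again exponential.
\<close>

lemma expos_Max_sum:
  assumes "finite I" and "g \<in> borel_measurable borel"
  shows "(\<integral>\<^sup>+x. g (Max (insert 0 (x ` I)), \<Sum>i\<in>I. x i) \<partial>expos I) = renyi (card I) g"
  using assms
proof (induction "card I" arbitrary: I g)
  case 0
  then show ?case by (simp add: renyi_def PiM_empty nn_integral_count_space_finite)
next
  case (Suc k)
  note [measurable] = Suc.prems(2)
  have I: "finite I" "I \<noteq> {}" "card I - 1 = k" using Suc.hyps(2) Suc.prems(1) by auto
  \<comment> \<open>The value after one peel: with minimum \<open>a\<close>, the other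
    \<open>k\<close> variables enter through their Renyi form, shifted by \<open>a\<close> in the
    maximum and by \<open>(k + 1) a\<close> in the sum.\<close>
  define \<Phi> where "\<Phi> a = renyi k (\<lambda>(s, t). g (a + s, real (Suc k) * a + t))" for a
  have [measurable]: "\<Phi> \<in> borel_measurable borel"
    unfolding \<Phi>_def by (rule measurable_renyi, unfold borel_prod[symmetric], measurable)
  have [measurable]: "(\<lambda>x. \<Sum>i\<in>I. x i) \<in> borel_measurable (expos I)"
      "(\<lambda>x. Max (insert 0 (x ` I))) \<in> borel_measurable (expos I)"
    by (rule measurable_sum_expos measurable_Max_expos, simp_all add: I)+
  have "(\<integral>\<^sup>+x. g (Max (insert 0 (x ` I)), \<Sum>i\<in>I. x i) \<partial>expos I)
     = (\<Sum>i\<in>I. \<integral>\<^sup>+a. ennreal (exp (- a)) ^ k * (\<integral>\<^sup>+x. g (Max (insert 0 (((\<lambda>j\<in>I - {i}. a + x j)(i := a)) ` I)),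
          \<Sum>j\<in>I. ((\<lambda>j\<in>I - {i}. a + x j)(i := a)) j) \<partial>expos (I - {i})) \<partial>expo)"
    unfolding I(3)[symmetric] by (rule expos_peel_min[OF I(1,2)]) measurable
  also have "\<dots> = (\<Sum>i\<in>I. \<integral>\<^sup>+a. ennreal (exp (- a)) ^ k * \<Phi> a \<partial>expo)"
  proof (rule sum.cong[OF refl])
    fix i assume i: "i \<in> I"
    define J where "J = I - {i}"
    have J: "I = insert i J" "i \<notin> J" "finite J" "card J = k" using I i by (auto simp: J_def)
    show "(\<integral>\<^sup>+a. ennreal (exp (- a)) ^ k * (\<integral>\<^sup>+x. g (Max (insert 0 (((\<lambda>j\<in>I - {i}. a + x j)(i := a)) ` I)),
          \<Sum>j\<in>I. ((\<lambda>j\<in>I - {i}. a + x j)(i := a)) j) \<partial>expos (I - {i})) \<partial>expo)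
       = (\<integral>\<^sup>+a. ennreal (exp (- a)) ^ k * \<Phi> a \<partial>expo)"
      unfolding J_def[symmetric]
    proof (rule nn_integral_cong_AE, use AE_expo_pos in eventually_elim)
      case (elim a)
      have upd: "((\<lambda>j\<in>J. a + x j)(i := a)) ` I = insert a ((+) a ` (x ` J))" for x :: "nat \<Rightarrow> real"
        using J(2) unfolding J(1) by (auto simp: image_image)
      have upd': "(\<Sum>j\<in>I. ((\<lambda>j\<in>J. a + x j)(i := a)) j) = real (Suc k) * a + (\<Sum>j\<in>J. x j)" for x :: "nat \<Rightarrow> real"
      proof -
        have "(\<Sum>j\<in>J. ((\<lambda>j\<in>J. a + x j)(i := a)) j) = (\<Sum>j\<in>J. a + x j)"
          by (rule sum.cong) (use J(2) in auto)
        then show ?thesis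
          unfolding J(1) using J(2-4) by (simp add: sum.distrib algebra_simps)
      qed
      have "(\<integral>\<^sup>+x. g (Max (insert 0 (((\<lambda>j\<in>J. a + x j)(i := a)) ` I)), \<Sum>j\<in>I. ((\<lambda>j\<in>J. a + x j)(i := a)) j) \<partial>expos J)
          = (\<integral>\<^sup>+x. g (a + Max (insert 0 (x ` J)), real (Suc k) * a + (\<Sum>j\<in>J. x j)) \<partial>expos J)"
      proof -
        have "Max (insert 0 (insert a ((+) a ` (x ` J)))) = a + Max (insert 0 (x ` J))" for x :: "nat \<Rightarrow> real"
          by (rule Max_shift) (use J(3) elim in auto)
        then show ?thesis unfolding upd upd' by (simp only:)
      qed
      also have "\<dots> = (\<integral>\<^sup>+x. (\<lambda>(s, t). g (a + s, real (Suc k) * a + t)) (Max (insert 0 (x ` J)), \<Sum>j\<in>J. x j) \<partial>expos J)"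
        by simp
      also have "\<dots> = renyi (card J) (\<lambda>(s, t). g (a + s, real (Suc k) * a + t))"
        by (rule Suc.hyps(1)) (use J in \<open>simp_all add: borel_prod[symmetric]\<close>)
      finally show ?case unfolding \<Phi>_def J(4) by simp
    qed
  qed
  \<comment> \<open>The contribution does not depend on which variable is minimal, and there are
    \<open>k + 1\<close> candidates.\<close>
  also have "\<dots> = of_nat (Suc k) * (\<integral>\<^sup>+a. ennreal (exp (- a)) ^ k * \<Phi> a \<partial>expo)"
    using Suc.hyps(2) by simp
  also have "\<dots> = (\<integral>\<^sup>+b. \<Phi> (b / real (Suc k)) \<partial>expo)"
    by (rule expo_scale) measurable
  also have "\<dots> = renyi (Suc k) g"
    unfolding \<Phi>_def by (subst renyi_Suc) simp_all
  finally show ?case unfolding Suc.hyps(2)[symmetric] .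
qed

text \<open>For the minimum a single peel suffices: it is \<open>b / (k + 1)\<close> with
  \<open>b\<close> exponential, and the total is \<open>b\<close> plus the sum of \<open>k\<close>
  fresh variables. Renaming \<open>b\<close> as the last coordinate gives the right-hand
  side.\<close>

lemma expos_Min_sum:
  assumes I: "finite I" "card I = Suc k" and [measurable]: "g \<in> borel_measurable borel"
  shows "(\<integral>\<^sup>+x. g (Min (x ` I), \<Sum>i\<in>I. x i) \<partial>expos I)
       = (\<integral>\<^sup>+x. g (x (Suc k) / real (Suc k), \<Sum>i=1..Suc k. x i) \<partial>expos {1..Suc k})"
proof -
  have I': "I \<noteq> {}" "card I - 1 = k" using I by auto
  define \<Phi> where "\<Phi> a = renyi k (\<lambda>(s, t). g (a, real (Suc k) * a + t))" for a
  have [measurable]: "\<Phi> \<in> borel_measurable borel"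
    unfolding \<Phi>_def by (rule measurable_renyi, unfold borel_prod[symmetric], measurable)
  have [measurable]: "(\<lambda>x. \<Sum>i\<in>I. x i) \<in> borel_measurable (expos I)"
      "(\<lambda>x. Min (x ` I)) \<in> borel_measurable (expos I)"
    by (rule measurable_sum_expos measurable_Min_expos, simp_all add: I)+
  have "(\<integral>\<^sup>+x. g (Min (x ` I), \<Sum>i\<in>I. x i) \<partial>expos I)
     = (\<Sum>i\<in>I. \<integral>\<^sup>+a. ennreal (exp (- a)) ^ k * (\<integral>\<^sup>+x. g (Min (((\<lambda>j\<in>I - {i}. a + x j)(i := a)) ` I),
          \<Sum>j\<in>I. ((\<lambda>j\<in>I - {i}. a + x j)(i := a)) j) \<partial>expos (I - {i})) \<partial>expo)"
    unfolding I'(2)[symmetric] by (rule expos_peel_min[OF I(1) I'(1)]) measurable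
  also have "\<dots> = (\<Sum>i\<in>I. \<integral>\<^sup>+a. ennreal (exp (- a)) ^ k * \<Phi> a \<partial>expo)"
  proof (rule sum.cong[OF refl])
    fix i assume i: "i \<in> I"
    define J where "J = I - {i}"
    have J: "I = insert i J" "i \<notin> J" "finite J" "card J = k" using I i by (auto simp: J_def)
    show "(\<integral>\<^sup>+a. ennreal (exp (- a)) ^ k * (\<integral>\<^sup>+x. g (Min (((\<lambda>j\<in>I - {i}. a + x j)(i := a)) ` I),
          \<Sum>j\<in>I. ((\<lambda>j\<in>I - {i}. a + x j)(i := a)) j) \<partial>expos (I - {i})) \<partial>expo)
       = (\<integral>\<^sup>+a. ennreal (exp (- a)) ^ k * \<Phi> a \<partial>expo)"
      unfolding J_def[symmetric]
    proof (rule nn_integral_cong_AE, use AE_expo_pos in eventually_elim)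
      case (elim a)
      have upd: "Min (((\<lambda>j\<in>J. a + x j)(i := a)) ` I) = a" if "\<forall>j\<in>J. 0 < x j" for x :: "nat \<Rightarrow> real"
        by (rule Min_eqI) (use J that in \<open>force+\<close>)
      have upd': "(\<Sum>j\<in>I. ((\<lambda>j\<in>J. a + x j)(i := a)) j) = real (Suc k) * a + (\<Sum>j\<in>J. x j)" for x :: "nat \<Rightarrow> real"
      proof -
        have "(\<Sum>j\<in>J. ((\<lambda>j\<in>J. a + x j)(i := a)) j) = (\<Sum>j\<in>J. a + x j)"
          by (rule sum.cong) (use J(2) in auto)
        then show ?thesis
          unfolding J(1) using J(2-4) by (simp add: sum.distrib algebra_simps)
      qed
      have "(\<integral>\<^sup>+x. g (Min (((\<lambda>j\<in>J. a + x j)(i := a)) ` I), \<Sum>j\<in>I. ((\<lambda>j\<in>J. a + x j)(i := a)) j) \<partial>expos J)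
          = (\<integral>\<^sup>+x. g (a, real (Suc k) * a + (\<Sum>j\<in>J. x j)) \<partial>expos J)"
        unfolding upd'
        by (rule nn_integral_cong_AE, use AE_expos_pos[OF J(3)] in eventually_elim) (simp only: upd)
      \<comment> \<open>The test function ignores the maximum; the result for (maximum, sum) serves
        only to move the sum from \<open>J\<close> to the index set \<open>{1..k}\<close>.\<close>
      also have "\<dots> = (\<integral>\<^sup>+x. (\<lambda>(s, t). g (a, real (Suc k) * a + t)) (Max (insert 0 (x ` J)), \<Sum>j\<in>J. x j) \<partial>expos J)"
        by simp
      also have "\<dots> = renyi (card J) (\<lambda>(s, t). g (a, real (Suc k) * a + t))"
        by (rule expos_Max_sum) (use J in \<open>simp_all add: borel_prod[symmetric]\<close>)
      finally show ?case unfolding \<Phi>_def J(4) by simp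
    qed
  qed
  also have "\<dots> = of_nat (Suc k) * (\<integral>\<^sup>+a. ennreal (exp (- a)) ^ k * \<Phi> a \<partial>expo)"
    using I(2) by simp
  also have "\<dots> = (\<integral>\<^sup>+b. \<Phi> (b / real (Suc k)) \<partial>expo)"
    by (rule expo_scale) measurable
  also have "\<dots> = (\<integral>\<^sup>+x. g (x (Suc k) / real (Suc k), \<Sum>i=1..Suc k. x i) \<partial>expos {1..Suc k})"
  proof -
    have K: "{1..Suc k} = insert (Suc k) {1..k}" by auto
    have [measurable]: "(\<lambda>x. \<Sum>i\<in>{1..Suc k}. x i) \<in> borel_measurable (expos {1..Suc k})"
      "(\<lambda>x. x (Suc k)) \<in> borel_measurable (expos {1..Suc k})"
      by (rule measurable_sum_expos, simp, simp) (rule measurable_coordinate, simp)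
    have meas: "(\<lambda>x. g (x (Suc k) / real (Suc k), \<Sum>i=1..Suc k. x i)) \<in> borel_measurable (expos (insert (Suc k) {1..k}))"
      unfolding K[symmetric] by measurable
    have upd: "(\<Sum>i=1..Suc k. (x(Suc k := b)) i) = b + (\<Sum>i=1..k. x i)" for x and b :: real
      by simp
    have "(\<integral>\<^sup>+x. g (x (Suc k) / real (Suc k), \<Sum>i=1..Suc k. x i) \<partial>expos {1..Suc k})
      = (\<integral>\<^sup>+b. (\<integral>\<^sup>+x. g ((x(Suc k := b)) (Suc k) / real (Suc k), \<Sum>i=1..Suc k. (x(Suc k := b)) i) \<partial>expos {1..k}) \<partial>expo)"
      unfolding K by (rule expos.product_nn_integral_insert_rev[OF _ _ meas[unfolded K]]) simp_all
    then show ?thesis unfolding upd \<Phi>_def renyi_def by simp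
  qed
  finally show ?thesis .
qed

section \<open>Laws of the first and the last normalized partial sum\<close>

lemma expo_laplace:
  assumes "c \<ge> 0"
  shows "(\<integral>\<^sup>+x. ennreal (exp (- (c * x))) \<partial>expo) = ennreal (1 / (1 + c))"
proof -
  have "(\<integral>\<^sup>+x. ennreal (exp (- (c * x))) \<partial>expo)
     = (\<integral>\<^sup>+x. ennreal (exp (- x)) * indicator {0..} x * ennreal (exp (- (c * x))) \<partial>lborel)"
    by (rule nn_integral_expo) measurable
  also have "\<dots> = (\<integral>\<^sup>+x. ennreal (1 / (1 + c)) * ennreal (exponential_density (1 + c) x) \<partial>lborel)"
  proof (rule nn_integral_cong)
    fix x :: real
    have "exp (- x) * exp (- (c * x)) = 1 / (1 + c) * ((1 + c) * exp (- x * (1 + c)))"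
      using assms by (simp add: mult_exp_exp) (simp add: algebra_simps)
    then show "ennreal (exp (- x)) * indicator {0..} x * ennreal (exp (- (c * x)))
      = ennreal (1 / (1 + c)) * ennreal (exponential_density (1 + c) x)"
      using assms by (simp add: exponential_density_def indicator_def flip: ennreal_mult)
  qed
  also have "\<dots> = ennreal (1 / (1 + c)) * (\<integral>\<^sup>+x. ennreal (exponential_density (1 + c) x) \<partial>lborel)"
    by (rule nn_integral_cmult) measurable
  also have "(\<integral>\<^sup>+x. ennreal (exponential_density (1 + c) x) \<partial>lborel) = 1"
    using nn_integral_erlang_ith_moment[of "1 + c" 0 0] assms by simp
  finally show ?thesis by simp
qed

lemma expos_laplace:
  assumes "finite J" "c \<ge> 0"
  shows "(\<integral>\<^sup>+x. ennreal (exp (- (c * (\<Sum>j\<in>J. x j)))) \<partial>expos J) = ennreal ((1 / (1 + c)) ^ card J)"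
proof -
  have "(\<integral>\<^sup>+x. ennreal (exp (- (c * (\<Sum>j\<in>J. x j)))) \<partial>expos J)
      = (\<integral>\<^sup>+x. (\<Prod>j\<in>J. ennreal (exp (- (c * x j)))) \<partial>expos J)"
    using assms(1)
    by (intro nn_integral_cong) (simp add: prod_ennreal sum_distrib_left exp_sum[symmetric] sum_negf)
  also have "\<dots> = (\<Prod>j\<in>J. \<integral>\<^sup>+x. ennreal (exp (- (c * x))) \<partial>expo)"
    by (rule expos.product_nn_integral_prod[OF assms(1)]) simp
  finally show ?thesis using assms by (simp add: expo_laplace ennreal_power)
qed

text \<open>Given the other variables with sum \<open>s\<close>, the tail probability of
  \<open>x i\<close> at \<open>c * s\<close> is \<open>exp (- (c * s))\<close>; averaging over them
  gives the Laplace transform of \<open>s\<close> at \<open>c\<close>.\<close>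

lemma expos_ge_multiple:
  assumes I: "finite I" "i \<in> I" and c: "c \<ge> 0"
  shows "measure (expos I) {x \<in> space (expos I). c * (\<Sum>j\<in>I - {i}. x j) \<le> x i} = (1 / (1 + c)) ^ (card I - 1)"
proof -
  define J where "J = I - {i}"
  have J: "I = insert i J" "i \<notin> J" "finite J" "card J = card I - 1" using I by (auto simp: J_def)
  have [measurable]: "(\<lambda>x. \<Sum>j\<in>J. x j) \<in> borel_measurable (expos I)"
    "(\<lambda>x. x i) \<in> borel_measurable (expos I)"
    by (rule measurable_sum_expos, simp_all add: J_def) (rule measurable_coordinate, rule I(2))
  let ?A = "{x \<in> space (expos I). c * (\<Sum>j\<in>J. x j) \<le> x i}"
  define f :: "(nat \<Rightarrow> real) \<Rightarrow> ennreal" where "f x = indicator {c * (\<Sum>j\<in>J. x j)..} (x i)" for x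
  have "f = (\<lambda>x. indicator {0..} (x i - c * (\<Sum>j\<in>J. x j)))"
    by (auto simp: f_def indicator_def)
  then have f: "f \<in> borel_measurable (expos I)" by simp
  have "emeasure (expos I) ?A = (\<integral>\<^sup>+x. indicator ?A x \<partial>expos I)"
    by (rule nn_integral_indicator[symmetric]) measurable
  also have "\<dots> = (\<integral>\<^sup>+x. f x \<partial>expos I)"
    by (rule nn_integral_cong) (simp add: indicator_def f_def)
  also have "\<dots> = (\<integral>\<^sup>+x. (\<integral>\<^sup>+y. f (x(i := y)) \<partial>expo) \<partial>expos J)"
    using f unfolding J(1) by (rule expos.product_nn_integral_insert[OF J(3,2)])
  also have "\<dots> = (\<integral>\<^sup>+x. ennreal (exp (- (c * (\<Sum>j\<in>J. x j)))) \<partial>expos J)"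
  proof (rule nn_integral_cong_AE, use AE_expos_pos[OF J(3)] in eventually_elim)
    case (elim x)
    then have "0 \<le> c * (\<Sum>j\<in>J. x j)" using c by (intro mult_nonneg_nonneg sum_nonneg) (auto intro: less_imp_le)
    from expo_memoryless[OF this, of "\<lambda>_. 1"]
    have "(\<integral>\<^sup>+y. indicator {c * (\<Sum>j\<in>J. x j)..} y \<partial>expo) = ennreal (exp (- (c * (\<Sum>j\<in>J. x j))))"
      using expo.emeasure_space_1 by simp
    moreover have "(\<Sum>j\<in>J. (x(i := y)) j) = (\<Sum>j\<in>J. x j)" for y
      by (rule sum.cong) (use J(2) in auto)
    ultimately show ?case by (simp add: f_def)
  qed
  also have "\<dots> = ennreal ((1 / (1 + c)) ^ (card I - 1))"
    using expos_laplace[OF J(3) c] by (simp only: J(4))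
  finally have "emeasure (expos I) ?A = ennreal ((1 / (1 + c)) ^ (card I - 1))" .
  then show ?thesis unfolding J_def using c by (simp add: measure_def)
qed

lemma expos_first_le:
  assumes y: "0 \<le> y" "y < 1"
  shows "measure (expos {1..Suc q}) {x \<in> space (expos {1..Suc q}). x 1 / (\<Sum>i=1..Suc q. x i) \<le> y} = 1 - (1 - y) ^ q"
proof -
  let ?I = "{1..Suc q}"
  define T :: "(nat \<Rightarrow> real) \<Rightarrow> real" where "T x = (\<Sum>i=1..Suc q. x i)" for x
  \<comment> \<open>Solving \<open>x 1 \<le> y * (x 1 + R x)\<close> for \<open>x 1\<close> gives
    the threshold \<open>c * R x\<close>, and then \<open>1 / (1 + c) = 1 - y\<close>.\<close>
  define c where "c = y / (1 - y)"
  have c: "c \<ge> 0" "1 / (1 + c) = 1 - y" using y by (auto simp: c_def field_simps)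
  note prob = prob_space_expos[of ?I]
  define R :: "(nat \<Rightarrow> real) \<Rightarrow> real" where "R x = (\<Sum>j\<in>?I - {1}. x j)" for x
  have split: "T x = x 1 + R x" for x :: "nat \<Rightarrow> real"
    unfolding R_def T_def by (rule sum.remove) auto
  have [measurable]: "R \<in> borel_measurable (expos ?I)"
      "T \<in> borel_measurable (expos ?I)" "(\<lambda>x. x 1) \<in> borel_measurable (expos ?I)"
    unfolding R_def T_def by (rule measurable_sum_expos, simp, simp)+ (rule measurable_coordinate, simp)
  have le: "{x \<in> space (expos ?I). c * R x \<le> x 1} \<in> sets (expos ?I)"
    by (rule borel_measurable_le) measurable
  \<comment> \<open>A tie has probability zero, so the event may be replaced by the complement of
    the closed event whose probability is known.\<close>
  have neq: "AE x in expos ?I. x 1 \<noteq> c * R x"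
  proof (rule AE_expos_neq)
    fix x :: "nat \<Rightarrow> real" and y
    have "(\<Sum>j\<in>?I - {1}. (x(1 := y)) j) = (\<Sum>j\<in>?I - {1}. x j)" by (rule sum.cong) auto
    then show "c * R (x(1 := y)) = c * R x" unfolding R_def by (simp only:)
  qed (simp, simp, measurable)
  have "AE x in expos ?I. (x 1 / T x \<le> y) = (\<not> c * R x \<le> x 1)"
    using neq AE_expos_pos[of ?I, OF finite_atLeastAtMost]
  proof eventually_elim
    case (elim x)
    have "T x > 0" unfolding T_def by (rule sum_pos) (use elim in auto)
    then have "x 1 / T x \<le> y \<longleftrightarrow> x 1 \<le> y * (x 1 + R x)"
      unfolding split by (simp add: pos_divide_le_eq)
    also have "\<dots> \<longleftrightarrow> x 1 \<le> c * R x"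
      using y by (simp add: c_def field_simps)
    finally show ?case using elim(1) by auto
  qed
  then have "measure (expos ?I) {x \<in> space (expos ?I). x 1 / T x \<le> y}
     = measure (expos ?I) {x \<in> space (expos ?I). \<not> c * R x \<le> x 1}"
    by (rule measure_Collect_cong_AE[OF _ _ sets.sets_Collect_neg[OF le]]) measurable
  also have "\<dots> = 1 - measure (expos ?I) {x \<in> space (expos ?I). c * R x \<le> x 1}"
    by (rule prob_space.prob_neg[OF prob le])
  also have "\<dots> = 1 - (1 - y) ^ q"
    using expos_ge_multiple[of ?I 1 c] c unfolding R_def by simp
  finally show ?thesis unfolding T_def .
qed

lemma expos_last_ge:
  assumes y: "0 \<le> y" "y < 1"
  shows "measure (expos {1..Suc q}) {x \<in> space (expos {1..Suc q}). (\<Sum>i=1..q. x i) / (\<Sum>i=1..Suc q. x i) \<le> y} = y ^ q"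
proof -
  let ?I = "{1..Suc q}" let ?T = "\<lambda>x. \<Sum>i=1..Suc q. x i"
  note prob = prob_space_expos[of ?I]
  have rem: "?I - {Suc q} = {1..q}" by auto
  have [measurable]: "(\<lambda>x. \<Sum>j=1..q. x j) \<in> borel_measurable (expos ?I)"
      "?T \<in> borel_measurable (expos ?I)" "(\<lambda>x. x (Suc q)) \<in> borel_measurable (expos ?I)"
    by (rule measurable_sum_expos, simp, simp)+ (rule measurable_coordinate, simp)
  have pos: "AE x in expos ?I. \<forall>i\<in>?I. x i > 0" by (rule AE_expos_pos) simp
  consider "q = 0" | "q > 0" "y = 0" | "y > 0" using y by fastforce
  then show ?thesis
  proof cases
    case 1
    \<comment> \<open>With \<open>q = 0\<close> the quotient is 0 and the value is
      \<open>y ^ 0 = 1\<close>, also for \<open>y = 0\<close>.\<close>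
    then show ?thesis using y prob_space.prob_space[OF prob] by simp
  next
    case 2
    have "AE x in expos ?I. \<not> (\<Sum>i=1..q. x i) / ?T x \<le> y"
      using pos
    proof eventually_elim
      case (elim x)
      have "?T x > 0" "(\<Sum>i=1..q. x i) > 0" by (rule sum_pos; use elim 2 in auto)+
      then have "(\<Sum>i=1..q. x i) / ?T x > 0" by (rule divide_pos_pos[rotated])
      then show ?case using 2(2) by linarith
    qed
    then have "AE x in expos ?I. ((\<Sum>i=1..q. x i) / ?T x \<le> y) = False" by simp
    then have "measure (expos ?I) {x \<in> space (expos ?I). (\<Sum>i=1..q. x i) / ?T x \<le> y}
        = measure (expos ?I) {x \<in> space (expos ?I). False}"
      by (rule measure_Collect_cong_AE) measurable
    then show ?thesis using 2 by simp
  next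
    case 3
    \<comment> \<open>Now the inequality is solved for the last variable, which needs division by
      \<open>y\<close>; hence the separate treatment of \<open>y = 0\<close>.\<close>
    define c where "c = (1 - y) / y"
    have c: "c \<ge> 0" "1 / (1 + c) = y" using y 3 by (auto simp: c_def field_simps)
    have "AE x in expos ?I. ((\<Sum>i=1..q. x i) / ?T x \<le> y) = (c * (\<Sum>i=1..q. x i) \<le> x (Suc q))"
      using pos
    proof eventually_elim
      case (elim x)
      have "?T x > 0" by (rule sum_pos) (use elim in auto)
      then have "(\<Sum>i=1..q. x i) / ?T x \<le> y \<longleftrightarrow> (\<Sum>i=1..q. x i) \<le> y * ((\<Sum>i=1..q. x i) + x (Suc q))"
        by (simp add: pos_divide_le_eq)
      also have "\<dots> \<longleftrightarrow> c * (\<Sum>i=1..q. x i) \<le> x (Suc q)"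
        using 3 by (simp add: c_def field_simps)
      finally show ?case .
    qed
    then have "measure (expos ?I) {x \<in> space (expos ?I). (\<Sum>i=1..q. x i) / ?T x \<le> y}
       = measure (expos ?I) {x \<in> space (expos ?I). c * (\<Sum>i=1..q. x i) \<le> x (Suc q)}"
      by (rule measure_Collect_cong_AE) measurable
    also have "\<dots> = y ^ q"
      using expos_ge_multiple[of ?I "Suc q" c] c unfolding rem by simp
    finally show ?thesis .
  qed
qed

section \<open>Normalized partial sums hit ordered cells uniformly\<close>

abbreviation (input) psum :: "(nat \<Rightarrow> real) \<Rightarrow> nat \<Rightarrow> real" where
  "psum x j \<equiv> (\<Sum>i=1..j. x i)"

abbreviation lborels :: "nat set \<Rightarrow> (nat \<Rightarrow> real) measure" where
  "lborels I \<equiv> PiM I (\<lambda>_. lborel)"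

interpretation lborels: product_sigma_finite "\<lambda>_::nat. lborel :: real measure"
  by unfold_locales

lemma sets_expos_lborels: "sets (expos I) = sets (lborels I)"
  by (rule sets_PiM_cong) simp_all

lemma measurable_expos_iff_lborels: "borel_measurable (expos I) = borel_measurable (lborels I)"
  by (rule measurable_cong_sets[OF sets_expos_lborels refl])

lemma sigma_finite_lborels: "finite I \<Longrightarrow> sigma_finite_measure (lborels I)"
  by (rule lborels.sigma_finite)

definition expo_weight :: "real \<Rightarrow> ennreal" where
  "expo_weight x = ennreal (exp (- x)) * indicator {0..} x"

lemma measurable_expo_weight [measurable]: "expo_weight \<in> borel_measurable borel"
  unfolding expo_weight_def by measurable

lemma measurable_coordinate_lborels:
  "i \<in> I \<Longrightarrow> (\<lambda>x. x i) \<in> borel_measurable (lborels I)"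
  using measurable_coordinate[of i I] by (simp only: measurable_expos_iff_lborels)

text \<open>Lebesgue measure is invariant under translations, which the passage from the last
  coordinate to the total requires.\<close>

lemma nn_integral_expos:
  assumes "finite I" and "G \<in> borel_measurable (expos I)"
  shows "(\<integral>\<^sup>+x. G x \<partial>expos I) = (\<integral>\<^sup>+x. (\<Prod>i\<in>I. expo_weight (x i)) * G x \<partial>lborels I)"
  using assms
proof (induction I arbitrary: G rule: finite_induct)
  case empty
  then show ?case by (simp add: PiM_empty)
next
  case (insert i J)
  note G = insert.prems
  have Gl: "G \<in> borel_measurable (lborels (insert i J))"
    using G by (simp only: measurable_expos_iff_lborels)
  have Gupd: "(\<lambda>(y, x). G (y(i := x))) \<in> borel_measurable (expos J \<Otimes>\<^sub>M expo)"
    using measurable_compose[OF measurable_fun_upd_pair G] by (simp only: split_beta')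
  have Gx: "(\<lambda>x. G (y(i := x))) \<in> borel_measurable borel" if "y \<in> space (expos J)" for y
    using measurable_compose[OF measurable_Pair1'[OF that] Gupd] by (simp cong: measurable_cong_sets)
  have W: "(\<lambda>x. \<Prod>j\<in>insert i J. expo_weight (x j)) \<in> borel_measurable (lborels (insert i J))"
    by (intro borel_measurable_prod_ennreal measurable_compose[OF measurable_coordinate_lborels]) simp_all
  have H: "(\<lambda>y. \<integral>\<^sup>+x. G (y(i := x)) \<partial>expo) \<in> borel_measurable (expos J)"
    using Gupd by (rule expo.borel_measurable_nn_integral)
  have "(\<integral>\<^sup>+x. G x \<partial>expos (insert i J)) = (\<integral>\<^sup>+y. (\<integral>\<^sup>+x. G (y(i := x)) \<partial>expo) \<partial>expos J)"
    by (rule expos.product_nn_integral_insert[OF insert.hyps G])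
  also have "\<dots> = (\<integral>\<^sup>+y. (\<Prod>j\<in>J. expo_weight (y j)) * (\<integral>\<^sup>+x. G (y(i := x)) \<partial>expo) \<partial>lborels J)"
    by (rule insert.IH[OF H])
  also have "\<dots> = (\<integral>\<^sup>+y. (\<integral>\<^sup>+x. (\<Prod>j\<in>insert i J. expo_weight ((y(i := x)) j)) * G (y(i := x)) \<partial>lborel) \<partial>lborels J)"
  proof (rule nn_integral_cong)
    fix y assume "y \<in> space (lborels J)"
    then have y: "y \<in> space (expos J)" by (simp add: space_PiM)
    note [measurable] = Gx[OF y]
    have prod: "(\<Prod>j\<in>insert i J. expo_weight ((y(i := x)) j)) = (\<Prod>j\<in>J. expo_weight (y j)) * expo_weight x" for x
    proof -
      have "(\<Prod>j\<in>J. expo_weight ((y(i := x)) j)) = (\<Prod>j\<in>J. expo_weight (y j))"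
        by (rule prod.cong) (use insert.hyps in auto)
      then show ?thesis using insert.hyps by (simp add: mult.commute)
    qed
    have "(\<integral>\<^sup>+x. G (y(i := x)) \<partial>expo) = (\<integral>\<^sup>+x. expo_weight x * G (y(i := x)) \<partial>lborel)"
      unfolding expo_weight_def by (rule nn_integral_expo) measurable
    also have "(\<Prod>j\<in>J. expo_weight (y j)) * (\<integral>\<^sup>+x. expo_weight x * G (y(i := x)) \<partial>lborel)
       = (\<integral>\<^sup>+x. (\<Prod>j\<in>J. expo_weight (y j)) * (expo_weight x * G (y(i := x))) \<partial>lborel)"
      by (rule nn_integral_cmult[symmetric]) measurable
    finally show "(\<Prod>j\<in>J. expo_weight (y j)) * (\<integral>\<^sup>+x. G (y(i := x)) \<partial>expo)
       = (\<integral>\<^sup>+x. (\<Prod>j\<in>insert i J. expo_weight ((y(i := x)) j)) * G (y(i := x)) \<partial>lborel)"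
      unfolding prod by (simp only: mult.assoc)
  qed
  also have "\<dots> = (\<integral>\<^sup>+x. (\<Prod>j\<in>insert i J. expo_weight (x j)) * G x \<partial>lborels (insert i J))"
    by (rule lborels.product_nn_integral_insert[OF insert.hyps borel_measurable_times_ennreal[OF W Gl], symmetric])
  finally show ?case .
qed

lemma measurable_psum: "j \<le> k \<Longrightarrow> (\<lambda>x. psum x j) \<in> borel_measurable (lborels {1..k})"
  by (intro borel_measurable_sum measurable_coordinate_lborels) auto

lemma measurable_indicator_psum:
  assumes "j \<le> k"
  shows "(\<lambda>x. indicator {a<..b} (psum x j) :: ennreal) \<in> borel_measurable (lborels {1..k})"
  by (rule measurable_compose[OF measurable_psum[OF assms]]) simp

lemma nn_integral_interval_shift:
  fixes a b s :: real
  assumes "a \<le> b"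
  shows "(\<integral>\<^sup>+z. indicator {a<..b} (s + z) \<partial>lborel) = ennreal (b - a)"
proof -
  have "(\<integral>\<^sup>+z. indicator {a<..b} z \<partial>lborel) = (\<integral>\<^sup>+z. indicator {a<..b} (s + z) \<partial>lborel)"
    using nn_integral_real_affine[of "indicator {a<..b}" 1 s] by simp
  then show ?thesis using assms by simp
qed

text \<open>The map from coordinates to partial sums is triangular with unit diagonal, hence volume
  preserving. Concretely, the innermost integral over the last coordinate is the length of a
  translated interval.\<close>

lemma nn_integral_psum_box:
  assumes "\<And>j. j \<in> {1..q} \<Longrightarrow> a j \<le> b j"
  shows "(\<integral>\<^sup>+y. (\<Prod>j=1..q. indicator {a j<..b j} (psum y j)) \<partial>lborels {1..q}) = (\<Prod>j=1..q. ennreal (b j - a j))"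
  using assms
proof (induction q)
  case 0
  then show ?case by (simp add: PiM_empty nn_integral_count_space_finite)
next
  case (Suc q)
  have I: "{1..Suc q} = insert (Suc q) {1..q}" by auto
  have meas: "(\<lambda>y. \<Prod>j=1..Suc q. indicator {a j<..b j} (psum y j) :: ennreal) \<in> borel_measurable (lborels (insert (Suc q) {1..q}))"
    unfolding I[symmetric] by (intro borel_measurable_prod_ennreal measurable_indicator_psum) auto
  have prod: "(\<Prod>j=1..Suc q. indicator {a j<..b j} (psum (y(Suc q := z)) j))
      = (\<Prod>j=1..q. indicator {a j<..b j} (psum y j)) * (indicator {a (Suc q)<..b (Suc q)} (psum y q + z) :: ennreal)"
    for y and z :: real
  proof -
    have "(\<Prod>j=1..q. indicator {a j<..b j} (psum (y(Suc q := z)) j)) = (\<Prod>j=1..q. indicator {a j<..b j} (psum y j) :: ennreal)"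
      by (intro prod.cong refl arg_cong[where f = "indicator _"] sum.cong) auto
    then show ?thesis by simp
  qed
  have "(\<integral>\<^sup>+y. (\<Prod>j=1..Suc q. indicator {a j<..b j} (psum y j)) \<partial>lborels {1..Suc q})
     = (\<integral>\<^sup>+y. (\<integral>\<^sup>+z. (\<Prod>j=1..Suc q. indicator {a j<..b j} (psum (y(Suc q := z)) j)) \<partial>lborel) \<partial>lborels {1..q})"
    unfolding I by (rule lborels.product_nn_integral_insert[OF _ _ meas[unfolded I]]) simp_all
  also have "\<dots> = (\<integral>\<^sup>+y. (\<Prod>j=1..q. indicator {a j<..b j} (psum y j)) * ennreal (b (Suc q) - a (Suc q)) \<partial>lborels {1..q})"
    unfolding prod using Suc.prems
    by (intro nn_integral_cong) (simp add: nn_integral_cmult nn_integral_interval_shift)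
  also have "\<dots> = (\<integral>\<^sup>+y. (\<Prod>j=1..q. indicator {a j<..b j} (psum y j)) \<partial>lborels {1..q}) * ennreal (b (Suc q) - a (Suc q))"
    by (intro nn_integral_multc borel_measurable_prod_ennreal measurable_indicator_psum) auto
  finally show ?case using Suc.IH Suc.prems by simp
qed

text \<open>
  Conditionally on the total \<open>t\<close>, which has density \<open>exp (- t) * t ^ q / q!\<close>, the cells are
  boxes of side \<open>t / n\<close> in the coordinates \<open>psum x j\<close>.
\<close>

lemma expos_cell_prob:
  fixes c :: "nat \<Rightarrow> nat"
  assumes n: "n > 0" and c: "strict_mono_on {1..q} c" "\<And>j. j \<in> {1..q} \<Longrightarrow> c j \<in> {1..n}"
  shows "measure (expos {1..Suc q}) {x \<in> space (expos {1..Suc q}).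
      \<forall>j\<in>{1..q}. real (c j) - 1 < real n * (psum x j / psum x (Suc q)) \<and> real n * (psum x j / psum x (Suc q)) \<le> real (c j)}
    = fact q / real n ^ q"
proof -
  let ?I = "{1..Suc q}"
  have I: "?I = insert (Suc q) {1..q}" by auto
  define cell :: "nat \<Rightarrow> real \<Rightarrow> ennreal" where "cell j = indicator {real (c j) - 1<..real (c j)}" for j
  have cell: "cell j \<in> borel_measurable borel" for j unfolding cell_def by measurable
  define G where "G x = (\<Prod>j=1..q. cell j (real n * (psum x j / psum x (Suc q))))" for x
  \<comment> \<open>The integrand with the last coordinate replaced by the total \<open>t\<close>:
    nonnegativity of that coordinate becomes \<open>psum y q \<le> t\<close>, and the product of the
    densities collapses to \<open>exp (- t)\<close>.\<close>
  define K where "K y t = ennreal (exp (- t)) * (\<Prod>i=1..q. indicator {0..} (y i)) * indicator {..t} (psum y q)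
      * (\<Prod>j=1..q. cell j (real n * (psum y j / t)))" for y t
  have G: "G \<in> borel_measurable (lborels ?I)"
    unfolding G_def
  proof (rule borel_measurable_prod_ennreal)
    fix j assume "j \<in> {1..q}"
    then have "(\<lambda>x. real n * (psum x j / psum x (Suc q))) \<in> borel_measurable (lborels ?I)"
      by (intro borel_measurable_times borel_measurable_divide borel_measurable_const measurable_psum) auto
    then show "(\<lambda>x. cell j (real n * (psum x j / psum x (Suc q)))) \<in> borel_measurable (lborels ?I)"
      by (rule measurable_compose[OF _ cell])
  qed
  then have Ge: "G \<in> borel_measurable (expos ?I)" by (simp only: measurable_expos_iff_lborels)
  have W: "(\<lambda>x. \<Prod>j\<in>?I. expo_weight (x j)) \<in> borel_measurable (lborels ?I)"
    by (intro borel_measurable_prod_ennreal measurable_compose[OF measurable_coordinate_lborels]) simp_all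
  have K [measurable]: "(\<lambda>(y, t). K y t) \<in> borel_measurable (lborels {1..q} \<Otimes>\<^sub>M lborel)"
  proof -
    have coord: "(\<lambda>p. fst p i) \<in> borel_measurable (lborels {1..q} \<Otimes>\<^sub>M lborel)" if "i \<in> {1..q}" for i
      by (rule measurable_compose[OF measurable_fst measurable_coordinate_lborels[OF that]])
    have ps: "(\<lambda>p. psum (fst p) j) \<in> borel_measurable (lborels {1..q} \<Otimes>\<^sub>M (lborel :: real measure))" if "j \<le> q" for j
      by (rule measurable_compose[OF measurable_fst measurable_psum[OF that]])
    have t: "snd \<in> borel_measurable (lborels {1..q} \<Otimes>\<^sub>M (lborel :: real measure))"
      by (rule measurable_compose[OF measurable_snd]) simp
    have ind: "indicator {..snd p} (psum (fst p) q) = (indicator {0..} (snd p - psum (fst p) q) :: ennreal)" for p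
      by (simp only: indicator_def atMost_iff atLeast_iff diff_ge_0_iff_ge)
    have ind0: "(indicator {0..} :: real \<Rightarrow> ennreal) \<in> borel_measurable borel" by measurable
    have e: "(\<lambda>t. ennreal (exp (- t))) \<in> borel_measurable borel" by measurable
    have "(\<lambda>p. cell j (real n * (psum (fst p) j / snd p))) \<in> borel_measurable (lborels {1..q} \<Otimes>\<^sub>M lborel)"
      if "j \<in> {1..q}" for j
    proof (rule measurable_compose[OF _ cell])
      show "(\<lambda>p. real n * (psum (fst p) j / snd p)) \<in> borel_measurable (lborels {1..q} \<Otimes>\<^sub>M (lborel :: real measure))"
        using that by (intro borel_measurable_times borel_measurable_divide borel_measurable_const ps t) auto
    qed
    moreover have "(\<lambda>p. indicator {0..} (fst p i) :: ennreal) \<in> borel_measurable (lborels {1..q} \<Otimes>\<^sub>M lborel)"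
      if "i \<in> {1..q}" for i
      by (rule measurable_compose[OF coord[OF that] ind0])
    moreover have "(\<lambda>p. indicator {0..} (snd p - psum (fst p) q) :: ennreal) \<in> borel_measurable (lborels {1..q} \<Otimes>\<^sub>M lborel)"
      by (rule measurable_compose[OF borel_measurable_diff[OF t ps] ind0]) simp
    moreover have "(\<lambda>p. ennreal (exp (- snd p))) \<in> borel_measurable (lborels {1..q} \<Otimes>\<^sub>M lborel)"
      by (rule measurable_compose[OF t e])
    ultimately show ?thesis
      unfolding K_def split_beta' ind by (intro borel_measurable_times_ennreal borel_measurable_prod_ennreal)
  qed
  have split: "(\<Prod>i\<in>?I. expo_weight ((y(Suc q := z)) i)) * G (y(Suc q := z)) = K y (psum y q + z)" for y z
  proof -
    have ps: "psum (y(Suc q := z)) j = psum y j" if "j \<le> q" for j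
      by (rule sum.cong) (use that in auto)
    have "(\<Prod>i=1..q. expo_weight ((y(Suc q := z)) i)) = (\<Prod>i=1..q. expo_weight (y i))"
      by (rule prod.cong) auto
    then have "(\<Prod>i\<in>?I. expo_weight ((y(Suc q := z)) i)) = (\<Prod>i=1..q. expo_weight (y i)) * expo_weight z"
      by simp
    also have "(\<Prod>i=1..q. expo_weight (y i)) = ennreal (exp (- psum y q)) * (\<Prod>i=1..q. indicator {0..} (y i))"
      unfolding expo_weight_def prod.distrib by (simp add: prod_ennreal exp_sum[symmetric] sum_negf)
    also have "\<dots> * expo_weight z = ennreal (exp (- (psum y q + z))) * (\<Prod>i=1..q. indicator {0..} (y i)) * indicator {..psum y q + z} (psum y q)"
    proof -
      have "ennreal (exp (- psum y q)) * ennreal (exp (- z)) = ennreal (exp (- (psum y q + z)))"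
        by (simp add: mult_exp_exp flip: ennreal_mult)
      moreover have "indicator {0..} z = (indicator {..psum y q + z} (psum y q) :: ennreal)"
        by (simp add: indicator_def)
      moreover have "a * b * (c * d) = (a * c) * b * d" for a b c d :: ennreal by (simp only: mult_ac)
      ultimately show ?thesis unfolding expo_weight_def by (simp only:)
    qed
    finally have *: "(\<Prod>i\<in>?I. expo_weight ((y(Suc q := z)) i)) = \<dots>" .
    have "G (y(Suc q := z)) = (\<Prod>j=1..q. cell j (real n * (psum y j / (psum y q + z))))"
      unfolding G_def using ps by (intro prod.cong) auto
    then show ?thesis unfolding * K_def by (simp only:)
  qed
  \<comment> \<open>For positive \<open>t\<close> the sign conditions follow from the cell
    conditions: the cells of a strictly increasing \<open>c\<close> are ordered, so the partial sums
    increase, and \<open>c q \<le> n\<close> keeps the last one at most \<open>t\<close>.\<close>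
  have K_pos: "K y t = ennreal (exp (- t)) * (\<Prod>j=1..q. indicator {(real (c j) - 1) * t / real n<..real (c j) * t / real n} (psum y j))"
    if t: "t > 0" for y t
  proof -
    have cell_eq: "cell j (real n * (psum y j / t)) = indicator {(real (c j) - 1) * t / real n<..real (c j) * t / real n} (psum y j)" for j
      using t n by (simp add: cell_def indicator_def field_simps)
    show ?thesis
    proof (cases "\<forall>j\<in>{1..q}. psum y j \<in> {(real (c j) - 1) * t / real n<..real (c j) * t / real n}")
      case False
      then have "(\<Prod>j=1..q. indicator {(real (c j) - 1) * t / real n<..real (c j) * t / real n} (psum y j)) = (0 :: ennreal)"
        by (intro prod_zero) (auto simp: indicator_def)
      then show ?thesis unfolding K_def cell_eq by (simp only: mult_zero_right)
    next
      case True
      note all = True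
      have nonneg: "y j \<ge> 0" if j: "j \<in> {1..q}" for j
      proof (cases "j = 1")
        case True
        have "0 \<le> (real (c 1) - 1) * t / real n"
          using c(2)[OF j] t True by simp
        also have "\<dots> < psum y 1" using bspec[OF all j] unfolding True greaterThanAtMost_iff by (rule conjunct1)
        finally show ?thesis using True by simp
      next
        case False
        then obtain i where i: "j = Suc i" "i \<in> {1..q}" using j by (cases j) auto
        have "c i < c j" using c(1) i j by (auto simp: strict_mono_on_def)
        then have "real (c i) * t / real n \<le> (real (c j) - 1) * t / real n"
          using t by (intro divide_right_mono mult_right_mono) auto
        moreover have "psum y i \<le> real (c i) * t / real n" "(real (c j) - 1) * t / real n < psum y j"
          using bspec[OF all i(2)] bspec[OF all j] unfolding greaterThanAtMost_iff by blast+
        ultimately have "psum y i < psum y j" by linarith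
        then show ?thesis using i by simp
      qed
      have "psum y q \<le> t"
      proof (cases "q = 0")
        case False
        then have "psum y q \<le> real (c q) * t / real n"
          using bspec[OF all, of q] by (simp only: greaterThanAtMost_iff atLeastAtMost_iff) simp
        also have "\<dots> \<le> real n * t / real n"
          using c(2)[of q] False t by (intro divide_right_mono mult_right_mono) auto
        finally show ?thesis using n by simp
      qed (use t in simp)
      moreover have "(\<Prod>i=1..q. indicator {0..} (y i)) = (1 :: ennreal)"
        by (rule prod.neutral) (use nonneg in auto)
      moreover have "indicator {..t} (psum y q) = (1 :: ennreal)" using calculation(1) by (simp only: indicator_simps atMost_iff)
      ultimately show ?thesis unfolding K_def cell_eq by (simp only: mult_1_right)
    qed
  qed
  have K_neg: "K y t = 0" if t: "t < 0" for y t
  proof (cases "(\<Prod>i=1..q. indicator {0..} (y i)) = (0 :: ennreal)")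
    case False
    then have "psum y q \<ge> 0"
      by (intro sum_nonneg) (auto simp: indicator_def split: if_splits)
    then show ?thesis using t by (simp add: K_def)
  qed (simp add: K_def)
  let ?A = "{x \<in> space (expos ?I). \<forall>j\<in>{1..q}. real (c j) - 1 < real n * (psum x j / psum x (Suc q)) \<and> real n * (psum x j / psum x (Suc q)) \<le> real (c j)}"
  have GA: "G x = indicator ?A x" if "x \<in> space (expos ?I)" for x
  proof (cases "x \<in> ?A")
    case True
    then have "G x = 1" unfolding G_def by (intro prod.neutral) (auto simp: cell_def)
    then show ?thesis using True by simp
  next
    case False
    then have "G x = 0" unfolding G_def using that by (intro prod_zero) (auto simp: cell_def indicator_def not_le)
    then show ?thesis using False by simp
  qed
  have A: "?A \<in> sets (expos ?I)"
  proof -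
    have "?A = G -` {1} \<inter> space (expos ?I)" using GA by (auto simp: indicator_def split: if_splits)
    then show ?thesis using measurable_sets[OF Ge, of "{1}"] by simp
  qed
  have "emeasure (expos ?I) ?A = (\<integral>\<^sup>+x. indicator ?A x \<partial>expos ?I)"
    by (rule nn_integral_indicator[OF A, symmetric])
  also have "\<dots> = (\<integral>\<^sup>+x. G x \<partial>expos ?I)"
    by (rule nn_integral_cong) (rule GA[symmetric])
  also have "\<dots> = (\<integral>\<^sup>+x. (\<Prod>i\<in>?I. expo_weight (x i)) * G x \<partial>lborels ?I)"
    by (rule nn_integral_expos[OF _ Ge]) simp
  also have "\<dots> = (\<integral>\<^sup>+y. (\<integral>\<^sup>+z. (\<Prod>i\<in>?I. expo_weight ((y(Suc q := z)) i)) * G (y(Suc q := z)) \<partial>lborel) \<partial>lborels {1..q})"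
    unfolding I
    by (rule lborels.product_nn_integral_insert) (use borel_measurable_times_ennreal[OF W G] in \<open>simp_all only: I[symmetric]\<close>, simp_all)
  also have "\<dots> = (\<integral>\<^sup>+y. (\<integral>\<^sup>+z. K y (psum y q + z) \<partial>lborel) \<partial>lborels {1..q})"
    unfolding split ..
  also have "\<dots> = (\<integral>\<^sup>+y. (\<integral>\<^sup>+t. K y t \<partial>lborel) \<partial>lborels {1..q})"
  proof (rule nn_integral_cong)
    fix y assume y: "y \<in> space (lborels {1..q})"
    have "(\<lambda>t. K y t) \<in> borel_measurable borel"
      using measurable_compose[OF measurable_Pair1'[OF y] K] by simp
    from nn_integral_real_affine[OF this, of 1 "psum y q"]
    show "(\<integral>\<^sup>+z. K y (psum y q + z) \<partial>lborel) = (\<integral>\<^sup>+t. K y t \<partial>lborel)" by simp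
  qed
  \<comment> \<open>With the total as the outer variable, the inner integral for
    \<open>t > 0\<close> is \<open>exp (- t)\<close> times the measure of a region whose side
    conditions all have length \<open>t / n\<close>.\<close>
  also have "\<dots> = (\<integral>\<^sup>+t. (\<integral>\<^sup>+y. K y t \<partial>lborels {1..q}) \<partial>lborel)"
    by (rule pair_sigma_finite.Fubini'[OF pair_sigma_finite.intro[OF sigma_finite_lborels lborel.sigma_finite_measure_axioms] K, symmetric]) simp
  also have "\<dots> = (\<integral>\<^sup>+t. ennreal (1 / real n ^ q) * (ennreal (t ^ q * exp (- t)) * indicator {0..} t) \<partial>lborel)"
  proof (rule nn_integral_cong_AE, use AE_lborel_singleton[of "0::real"] in eventually_elim)
    case (elim t)
    show ?case
    proof (cases "t > 0")
      case False
      then have "t < 0" using elim by simp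
      then show ?thesis by (simp add: K_neg)
    next
      case True
      have "(\<integral>\<^sup>+y. K y t \<partial>lborels {1..q}) = ennreal (exp (- t)) * (\<integral>\<^sup>+y. (\<Prod>j=1..q. indicator {(real (c j) - 1) * t / real n<..real (c j) * t / real n} (psum y j)) \<partial>lborels {1..q})"
        unfolding K_pos[OF True]
        by (intro nn_integral_cmult borel_measurable_prod_ennreal measurable_indicator_psum) auto
      also have "\<dots> = ennreal (exp (- t)) * (\<Prod>j=1..q. ennreal (real (c j) * t / real n - (real (c j) - 1) * t / real n))"
        by (subst nn_integral_psum_box) (use True in \<open>auto intro!: divide_right_mono mult_right_mono\<close>)
      also have "(\<Prod>j=1..q. ennreal (real (c j) * t / real n - (real (c j) - 1) * t / real n)) = (\<Prod>j=1..q. ennreal (t / real n))"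
        by (intro prod.cong refl arg_cong[where f = ennreal]) (simp add: left_diff_distrib diff_divide_distrib)
      also have "\<dots> = ennreal ((t / real n) ^ q)" using True by (simp add: ennreal_power)
      also have "ennreal (exp (- t)) * ennreal ((t / real n) ^ q) = ennreal (1 / real n ^ q) * (ennreal (t ^ q * exp (- t)) * indicator {0..} t)"
        using True by (simp add: power_divide mult.commute flip: ennreal_mult)
      finally show ?thesis .
    qed
  qed
  also have "\<dots> = ennreal (1 / real n ^ q) * (\<integral>\<^sup>+t. ennreal (t ^ q * exp (- t)) * indicator {0..} t \<partial>lborel)"
    by (rule nn_integral_cmult) measurable
  also have "\<dots> = ennreal (1 / real n ^ q) * ennreal (fact q)"
    by (simp only: nn_intergal_power_times_exp_Ici of_nat_fact)
  also have "\<dots> = ennreal (fact q / real n ^ q)" by (simp flip: ennreal_mult)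
  finally show ?thesis by (simp add: measure_def)
qed

section \<open>Extreme spacings of a uniformly distributed set of fixed size\<close>

text \<open>The list \<open>spacings\<close> as a function of the fixed-point set alone, so that it
  can be averaged over arbitrary subsets.\<close>

definition point_spacings :: "nat \<Rightarrow> nat set \<Rightarrow> nat list" where
  "point_spacings n A =
     (let ps = 0 # sorted_list_of_set A @ [n + 1] in map (\<lambda>(a, b). b - a) (zip ps (tl ps)))"

definition point_stats :: "nat \<Rightarrow> nat set \<Rightarrow> real \<times> real \<times> real \<times> real" where
  "point_stats n A =
     (real (if A = {} then n + 1 else Min A) / real n, real (if A = {} then 0 else Max A) / real n,
      real (Min (set (point_spacings n A))) / real n, real (Max (set (point_spacings n A))) / real n)"

text \<open>For \<open>q = 0\<close> and \<open>x 1 > 0\<close> this is \<open>(1, 0, 1, 1)\<close>,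
  in accordance with the conventions for permutations without fixed points.\<close>

definition limit_stats :: "nat \<Rightarrow> (nat \<Rightarrow> real) \<Rightarrow> real \<times> real \<times> real \<times> real" where
  "limit_stats q x =
     (x 1 / psum x (Suc q), psum x q / psum x (Suc q),
      Min (x ` {1..Suc q}) / psum x (Suc q), Max (x ` {1..Suc q}) / psum x (Suc q))"

lemma sorted_list_of_set_image_strict_mono:
  fixes V :: "nat \<Rightarrow> nat"
  assumes "strict_mono_on {1..q} V"
  shows "sorted_list_of_set (V ` {1..q}) = map V [1..<Suc q]"
proof -
  have "V ` {1..q} = set (map V [1..<Suc q])"
    by (simp add: atLeastLessThanSuc_atLeastAtMost del: upt_Suc)
  moreover have "sorted (map V [1..<Suc q])"
    unfolding sorted_map
    by (rule sorted_wrt_mono_rel[OF _ sorted_upt[unfolded sorted_wrt_upt]])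
       (use assms in \<open>auto simp: strict_mono_on_def le_less\<close>)
  moreover have "distinct (map V [1..<Suc q])"
    using strict_mono_on_imp_inj_on[OF assms] by (simp add: distinct_map atLeastLessThanSuc_atLeastAtMost del: upt_Suc)
  ultimately show ?thesis by (simp only: sorted_list_of_set.idem_if_sorted_distinct)
qed

text \<open>\<open>W\<close> extends the increasing sequence by the sentinels 0 and
  \<open>n + 1\<close>, which makes the two boundary spacings ordinary differences.\<close>

lemma set_point_spacings:
  fixes n q :: nat
  assumes V: "strict_mono_on {1..q} V"
  defines "W \<equiv> \<lambda>j. if j = 0 then 0 else if j = Suc q then n + 1 else V j"
  shows "set (point_spacings n (V ` {1..q})) = (\<lambda>j. W j - W (j - 1)) ` {1..Suc q}"
proof -
  define ps where "ps = 0 # sorted_list_of_set (V ` {1..q}) @ [n + 1]"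
  have ps: "ps = map W [0..<Suc (Suc q)]"
  proof -
    have "map V [1..<Suc q] = map W [1..<Suc q]" by (rule map_cong) (auto simp: W_def)
    moreover have "[0..<Suc (Suc q)] = 0 # [1..<Suc q] @ [Suc q]" by (simp add: upt_conv_Cons)
    ultimately show ?thesis
      unfolding ps_def sorted_list_of_set_image_strict_mono[OF V] by (simp add: W_def)
  qed
  have "set (point_spacings n (V ` {1..q})) = (\<lambda>(a, b). b - a) ` set (zip ps (tl ps))"
    by (simp add: point_spacings_def ps_def Let_def)
  also have "set (zip ps (tl ps)) = {(ps ! i, tl ps ! i) |i. i < Suc q}"
    by (simp add: set_zip ps)
  also have "\<dots> = (\<lambda>i. (W i, W (Suc i))) ` {..<Suc q}"
  proof -
    have "ps ! i = W i" "tl ps ! i = W (Suc i)" if "i < Suc q" for i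
      using that unfolding ps by (simp_all add: nth_tl del: upt_Suc)
    then show ?thesis by (auto simp: image_iff) (metis lessThan_iff)
  qed
  also have "(\<lambda>(a, b). b - a) ` \<dots> = (\<lambda>i. W (Suc i) - W i) ` {..<Suc q}"
    by (simp add: image_image)
  also have "\<dots> = (\<lambda>j. W j - W (j - 1)) ` Suc ` {..<Suc q}"
    by (simp add: image_image)
  also have "Suc ` {..<Suc q} = {1..Suc q}" by (simp add: lessThan_atLeast0 image_Suc_atLeastLessThan atLeastLessThanSuc_atLeastAtMost)
  finally show ?thesis .
qed

lemma tendsto_Min_Max:
  fixes f :: "'i \<Rightarrow> 'a \<Rightarrow> real"
  assumes "finite J" "J \<noteq> {}" "\<And>j. j \<in> J \<Longrightarrow> (f j \<longlongrightarrow> g j) F"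
  shows "((\<lambda>n. Min ((\<lambda>j. f j n) ` J)) \<longlongrightarrow> Min (g ` J)) F"
    and "((\<lambda>n. Max ((\<lambda>j. f j n) ` J)) \<longlongrightarrow> Max (g ` J)) F"
  using assms
proof (induction J rule: finite_ne_induct)
  case (insert i J)
  {
    case 1
    then show ?case using insert by (simp add: tendsto_min)
  next
    case 2
    then show ?case using insert by (simp add: tendsto_max)
  }
qed simp_all

lemma ceiling_mult_over_tendsto: "(\<lambda>n. real (nat \<lceil>real n * r\<rceil>) / real n) \<longlonglongrightarrow> r" if "r \<ge> 0" for r :: real
proof (rule tendsto_sandwich)
  show "eventually (\<lambda>n. r \<le> real (nat \<lceil>real n * r\<rceil>) / real n) sequentially"
    using eventually_gt_at_top[of 0]
  proof eventually_elim
    case (elim n)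
    have "real n * r \<le> real (nat \<lceil>real n * r\<rceil>)" by (rule real_nat_ceiling_ge)
    then show ?case using elim by (simp add: pos_le_divide_eq mult.commute)
  qed
  show "eventually (\<lambda>n. real (nat \<lceil>real n * r\<rceil>) / real n \<le> r + 1 / real n) sequentially"
    using eventually_gt_at_top[of 0]
  proof eventually_elim
    case (elim n)
    have "real n * r \<ge> 0" using that by simp
    then have "real (nat \<lceil>real n * r\<rceil>) \<le> real n * r + 1" by linarith
    then show ?case using elim by (simp add: field_simps)
  qed
  have "(\<lambda>n. r + 1 / real n) \<longlonglongrightarrow> r + 0" by (intro tendsto_intros lim_1_over_n)
  then show "(\<lambda>n. r + 1 / real n) \<longlonglongrightarrow> r" by simp
qed simp

section \<open>Pointwise convergence along one positive sample\<close>

locale positive_point =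
  fixes q :: nat and x :: "nat \<Rightarrow> real"
  assumes pos: "\<And>i. i \<in> {1..Suc q} \<Longrightarrow> x i > 0"
begin

definition "r j = psum x j / psum x (Suc q)"
definition "V n j = nat \<lceil>real n * r j\<rceil>"

lemma V_lim: "r j \<ge> 0 \<Longrightarrow> (\<lambda>n. real (V n j) / real n) \<longlonglongrightarrow> r j"
  unfolding V_def by (rule ceiling_mult_over_tendsto)

lemma total_pos: "psum x (Suc q) > 0"
  by (rule sum_pos) (use pos in auto)

lemma r_nonneg: "j \<le> Suc q \<Longrightarrow> r j \<ge> 0"
  unfolding r_def using total_pos pos by (intro divide_nonneg_pos sum_nonneg) (auto intro: less_imp_le)

lemma r_diff: "j \<in> {1..Suc q} \<Longrightarrow> r j - r (j - 1) = x j / psum x (Suc q)"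
  by (cases j) (simp_all add: r_def diff_divide_distrib[symmetric])

text \<open>The limits \<open>r j\<close> are strictly increasing, so consecutive rounded points
  divided by \<open>n\<close> are eventually separated. For almost every sample, rounding thus
  yields \<open>q\<close> distinct points once \<open>n\<close> is large.\<close>

lemma eventually_strict: "eventually (\<lambda>n. strict_mono_on {1..q} (V n) \<and> (\<forall>j\<in>{1..q}. V n j \<in> {1..n})) sequentially"
proof -
  have "eventually (\<lambda>n. \<forall>j\<in>{1..q}. V n (j - 1) < V n j) sequentially"
  proof (rule eventually_ball_finite[OF finite_atLeastAtMost], rule ballI)
    fix j assume j: "j \<in> {1..q}"
    \<comment> \<open>For \<open>j = 1\<close> the comparison is with \<open>V n 0 = 0\<close>,
      which later yields that all points are at least 1.\<close>
    have "(\<lambda>n. real (V n j) / real n - real (V n (j - 1)) / real n) \<longlonglongrightarrow> r j - r (j - 1)"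
      using j by (intro tendsto_diff V_lim r_nonneg) auto
    moreover have "r j - r (j - 1) > 0" using j pos total_pos by (subst r_diff) auto
    ultimately have "eventually (\<lambda>n. real (V n j) / real n - real (V n (j - 1)) / real n > 0) sequentially"
      by (rule order_tendstoD(1))
    then show "eventually (\<lambda>n. V n (j - 1) < V n j) sequentially"
    proof eventually_elim
      case (elim n)
      then show ?case by (cases "n = 0") (simp_all add: divide_less_cancel)
    qed
  qed
  then show ?thesis
  proof eventually_elim
    case (elim n)
    have mono: "V n i < V n j" if "i < j" "j \<le> q" for i j
      using that
    proof (induction j)
      case (Suc j)
      have "V n j < V n (Suc j)" using elim Suc.prems by force
      then show ?case using Suc by (cases "i = j") auto
    qed simp
    have "V n j \<in> {1..n}" if j: "j \<in> {1..q}" for j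
    proof -
      have "V n j \<ge> 1" using mono[of 0 j] j by simp
      moreover have "r j \<le> 1"
      proof -
        have "psum x j \<le> psum x (Suc q)" by (rule sum_mono2) (use j pos in \<open>auto intro: less_imp_le\<close>)
        then show ?thesis using total_pos unfolding r_def by (simp add: divide_le_eq_1)
      qed
      then have "real n * r j \<le> real n" by (simp add: mult_left_le)
      then have "V n j \<le> n" unfolding V_def by linarith
      ultimately show ?thesis by simp
    qed
    then show ?case using mono by (auto simp: strict_mono_on_def)
  qed
qed

lemma point_stats_tendsto: "(\<lambda>n. point_stats n (V n ` {1..q})) \<longlonglongrightarrow> limit_stats q x"
proof -
  define W where "W n j = (if j = 0 then 0 else if j = Suc q then n + 1 else V n j)" for n j
  define d where "d n j = W n j - W n (j - 1)" for n j
  have W_lim: "(\<lambda>n. real (W n j) / real n) \<longlonglongrightarrow> r j" if "j \<le> Suc q" for j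
  proof -
    consider "j = 0" | "j = Suc q" | "j \<noteq> 0" "j \<noteq> Suc q" by blast
    then show ?thesis
    proof cases
      case 2
      \<comment> \<open>The sentinel is \<open>n + 1\<close> and not \<open>n\<close>; divided by
        \<open>n\<close> it still tends to \<open>r (Suc q) = 1\<close>.\<close>
      have "(\<lambda>n. 1 + 1 / real n) \<longlonglongrightarrow> 1 + 0" by (intro tendsto_intros lim_1_over_n)
      moreover have "eventually (\<lambda>n. 1 + 1 / real n = real (W n j) / real n) sequentially"
        using eventually_gt_at_top[of 0] by eventually_elim (simp add: W_def 2 field_simps)
      ultimately have "(\<lambda>n. real (W n j) / real n) \<longlonglongrightarrow> 1 + 0" by (rule Lim_transform_eventually)
      moreover have "r j = 1" using total_pos 2 by (simp add: r_def)
      ultimately show ?thesis by simp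
    next
      case 3
      then show ?thesis using V_lim[OF r_nonneg[OF that]] by (simp add: W_def)
    qed (simp add: W_def r_def)
  qed
  have W_mono: "eventually (\<lambda>n. \<forall>j\<in>{1..Suc q}. W n (j - 1) \<le> W n j) sequentially"
    using eventually_strict
  proof eventually_elim
    case (elim n)
    show ?case
    proof
      fix j assume j: "j \<in> {1..Suc q}"
      consider "j = 1" | "j = Suc q" "j \<noteq> 1" | "j - 1 \<in> {1..q}" "j \<in> {1..q}" using j by force
      then show "W n (j - 1) \<le> W n j"
      proof cases
        case 2
        then have "q \<in> {1..q}" by auto
        then have "V n q \<le> n" using elim by simp
        then show ?thesis using 2 by (simp add: W_def)
      next
        case 3
        then have "V n (j - 1) < V n j" using elim by (auto simp: strict_mono_on_def)
        then show ?thesis using 3 by (simp add: W_def)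
      qed (simp add: W_def)
    qed
  qed
  have d_lim: "(\<lambda>n. real (d n j) / real n) \<longlonglongrightarrow> x j / psum x (Suc q)" if j: "j \<in> {1..Suc q}" for j
  proof -
    have "(\<lambda>n. real (W n j) / real n - real (W n (j - 1)) / real n) \<longlonglongrightarrow> r j - r (j - 1)"
      using j by (intro tendsto_diff W_lim) auto
    \<comment> \<open>Monotonicity of \<open>W n\<close> makes the truncated subtraction of natural
      numbers agree with subtraction of reals.\<close>
    moreover have "eventually (\<lambda>n. real (W n j) / real n - real (W n (j - 1)) / real n = real (d n j) / real n) sequentially"
      using W_mono by eventually_elim (use j in \<open>simp add: d_def of_nat_diff diff_divide_distrib\<close>)
    ultimately show ?thesis unfolding r_diff[OF j] by (rule Lim_transform_eventually)
  qed
  define c where "c = 1 / psum x (Suc q)"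
  have c: "c > 0" using total_pos by (simp add: c_def)
  have lims: "(\<lambda>n. Min ((\<lambda>j. real (d n j) / real n) ` {1..Suc q})) \<longlonglongrightarrow> Min ((\<lambda>j. x j / psum x (Suc q)) ` {1..Suc q})"
    "(\<lambda>n. Max ((\<lambda>j. real (d n j) / real n) ` {1..Suc q})) \<longlonglongrightarrow> Max ((\<lambda>j. x j / psum x (Suc q)) ` {1..Suc q})"
    by (rule tendsto_Min_Max; use d_lim in simp)+
  have mono_div: "mono (\<lambda>t::real. t / real n)" for n by (auto simp: mono_def divide_right_mono)
  have mono_div': "mono (\<lambda>t::real. t / psum x (Suc q))" using total_pos by (auto simp: mono_def divide_right_mono)
  have mono_real: "mono real" by (simp add: mono_def)
  have minmax: "Min ((\<lambda>j. real (d n j) / real n) ` {1..Suc q}) = real (Min (d n ` {1..Suc q})) / real n"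
    "Max ((\<lambda>j. real (d n j) / real n) ` {1..Suc q}) = real (Max (d n ` {1..Suc q})) / real n" for n
    by (simp_all add: mono_Min_commute[OF mono_real] mono_Max_commute[OF mono_real]
          mono_Min_commute[OF mono_div] mono_Max_commute[OF mono_div] image_image del: image_insert)
  have minmax': "Min ((\<lambda>j. x j / psum x (Suc q)) ` {1..Suc q}) = Min (x ` {1..Suc q}) / psum x (Suc q)"
    "Max ((\<lambda>j. x j / psum x (Suc q)) ` {1..Suc q}) = Max (x ` {1..Suc q}) / psum x (Suc q)"
    by (subst mono_Min_commute[OF mono_div'] mono_Max_commute[OF mono_div']; simp add: image_image)+
  have stats: "eventually (\<lambda>n. (real (W n 1) / real n, real (W n q) / real n,
       Min ((\<lambda>j. real (d n j) / real n) ` {1..Suc q}), Max ((\<lambda>j. real (d n j) / real n) ` {1..Suc q}))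
     = point_stats n (V n ` {1..q})) sequentially"
    using eventually_strict
  proof eventually_elim
    case (elim n)
    then have V: "strict_mono_on {1..q} (V n)" and range: "\<forall>j\<in>{1..q}. V n j \<in> {1..n}" by auto
    have spacings: "set (point_spacings n (V n ` {1..q})) = d n ` {1..Suc q}"
      unfolding set_point_spacings[OF V] d_def W_def ..
    have le: "V n i \<le> V n j" if "i \<in> {1..q}" "j \<in> {1..q}" "i \<le> j" for i j
      using strict_mono_on_leD[OF V that] .
    have first: "(if V n ` {1..q} = {} then n + 1 else Min (V n ` {1..q})) = W n 1"
    proof (cases "q = 0")
      case False
      then have "Min (V n ` {1..q}) = V n 1" by (intro Min_eqI) (auto intro!: le)
      then show ?thesis using False by (simp add: W_def)
    qed (simp add: W_def)
    have last: "(if V n ` {1..q} = {} then 0 else Max (V n ` {1..q})) = W n q"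
    proof (cases "q = 0")
      case False
      then have "Max (V n ` {1..q}) = V n q" by (intro Max_eqI) (auto intro!: le)
      then show ?thesis using False by (simp add: W_def)
    qed (simp add: W_def)
    show ?case unfolding point_stats_def first last spacings minmax ..
  qed
  have "(\<lambda>n. (real (W n 1) / real n, real (W n q) / real n,
       Min ((\<lambda>j. real (d n j) / real n) ` {1..Suc q}), Max ((\<lambda>j. real (d n j) / real n) ` {1..Suc q})))
    \<longlonglongrightarrow> (r 1, r q, Min ((\<lambda>j. x j / psum x (Suc q)) ` {1..Suc q}), Max ((\<lambda>j. x j / psum x (Suc q)) ` {1..Suc q}))"
    by (intro tendsto_Pair W_lim lims) simp_all
  then have "(\<lambda>n. point_stats n (V n ` {1..q})) \<longlonglongrightarrow> (r 1, r q, Min ((\<lambda>j. x j / psum x (Suc q)) ` {1..Suc q}), Max ((\<lambda>j. x j / psum x (Suc q)) ` {1..Suc q}))"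
    using stats by (rule Lim_transform_eventually)
  then show ?thesis unfolding minmax' limit_stats_def r_def by simp
qed

end

section \<open>Cells of samples that round to a given set\<close>

lemma measurable_expos_psum: "j \<le> k \<Longrightarrow> (\<lambda>x. psum x j) \<in> borel_measurable (expos {1..k})"
  by (intro borel_measurable_sum measurable_coordinate) auto

lemma measurable_expos_Min_Max:
  "(\<lambda>x. Min (x ` {1..Suc q})) \<in> borel_measurable (expos {1..Suc q})"
  "(\<lambda>x. Max (x ` {1..Suc q})) \<in> borel_measurable (expos {1..Suc q})"
  by (rule borel_measurable_Min[of _ "\<lambda>i x. x i"] borel_measurable_Max[of _ "\<lambda>i x. x i"];
      simp add: measurable_coordinate)+

lemma measurable_limit_stats: "limit_stats q \<in> borel_measurable (expos {1..Suc q})"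
  unfolding limit_stats_def[abs_def]
  by (intro borel_measurable_Pair borel_measurable_divide measurable_expos_psum
        measurable_expos_Min_Max measurable_coordinate) simp_all

text \<open>The \<open>j\<close>-th normalized partial sum has to round up to the
  \<open>j\<close>-th smallest element of \<open>A\<close>; list indices start at 0, hence
  \<open>j - 1\<close>.\<close>

definition point_cell :: "nat \<Rightarrow> nat \<Rightarrow> nat set \<Rightarrow> (nat \<Rightarrow> real) set" where
  "point_cell q n A = {x \<in> space (expos {1..Suc q}).
      \<forall>j\<in>{1..q}. real (sorted_list_of_set A ! (j - 1)) - 1 < real n * (psum x j / psum x (Suc q)) \<and>
        real n * (psum x j / psum x (Suc q)) \<le> real (sorted_list_of_set A ! (j - 1))}"

lemma sets_point_cell: "point_cell q n A \<in> sets (expos {1..Suc q})"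
proof -
  have "{x \<in> space (expos {1..Suc q}). real (sorted_list_of_set A ! (j - 1)) - 1 < real n * (psum x j / psum x (Suc q)) \<and>
        real n * (psum x j / psum x (Suc q)) \<le> real (sorted_list_of_set A ! (j - 1))} \<in> sets (expos {1..Suc q})"
    if "j \<in> {1..q}" for j
    using that
    by (intro sets.sets_Collect_conj borel_measurable_less borel_measurable_le borel_measurable_times
          borel_measurable_divide borel_measurable_const measurable_expos_psum) auto
  then show ?thesis
    unfolding point_cell_def by (rule sets.sets_Collect_finite_All) simp_all
qed

context
  fixes q n :: nat and A :: "nat set"
  assumes A: "A \<subseteq> {1..n}" "card A = q"
begin

lemma points_finite: "finite A"
  using A(1) finite_subset by blast

lemma points_nth: "j \<in> {1..q} \<Longrightarrow> sorted_list_of_set A ! (j - 1) \<in> {1..n}"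
proof -
  assume "j \<in> {1..q}"
  then have "sorted_list_of_set A ! (j - 1) \<in> set (sorted_list_of_set A)"
    using A by (intro nth_mem) auto
  then show ?thesis using A(1) points_finite by auto
qed

lemma points_strict: "strict_mono_on {1..q} (\<lambda>j. sorted_list_of_set A ! (j - 1))"
proof (rule strict_mono_onI)
  fix i j assume ij: "i \<in> {1..q}" "j \<in> {1..q}" "i < j"
  have "sorted_wrt (<) (sorted_list_of_set A)" by (rule strict_sorted_list_of_set)
  then show "sorted_list_of_set A ! (i - 1) < sorted_list_of_set A ! (j - 1)"
    by (rule sorted_wrt_nth_less) (use ij A in auto)
qed

lemma points_image: "(\<lambda>j. sorted_list_of_set A ! (j - 1)) ` {1..q} = A"
proof -
  have "(\<lambda>j. sorted_list_of_set A ! (j - 1)) ` {1..q} = (\<lambda>i. sorted_list_of_set A ! i) ` ((\<lambda>j. j - 1) ` {1..q})"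
    by (simp only: image_image)
  also have "(\<lambda>j. j - 1) ` {1..q} = {..<length (sorted_list_of_set A)}"
  proof -
    have "{1..q} = Suc ` {..<q}" by (simp add: lessThan_atLeast0 image_Suc_atLeastLessThan atLeastLessThanSuc_atLeastAtMost)
    then show ?thesis using A by (simp add: image_image)
  qed
  also have "(\<lambda>i. sorted_list_of_set A ! i) ` {..<length (sorted_list_of_set A)} = set (sorted_list_of_set A)"
    by (auto simp: set_conv_nth)
  also have "\<dots> = A" using points_finite by simp
  finally show ?thesis .
qed

lemma point_cell_prob: "n > 0 \<Longrightarrow> measure (expos {1..Suc q}) (point_cell q n A) = fact q / real n ^ q"
  unfolding point_cell_def by (rule expos_cell_prob[OF _ points_strict points_nth])

text \<open>A half-open interval of length one ending at an integer determines the ceiling. Hence a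
  sample lies in the cell of at most one \<open>A\<close>, and that set can be read off from the
  sample.\<close>

lemma point_cell_unique:
  assumes "x \<in> point_cell q n A"
  shows "(\<lambda>j. nat \<lceil>real n * (psum x j / psum x (Suc q))\<rceil>) ` {1..q} = A"
proof -
  have "nat \<lceil>real n * (psum x j / psum x (Suc q))\<rceil> = sorted_list_of_set A ! (j - 1)" if j: "j \<in> {1..q}" for j
  proof -
    have "\<lceil>real n * (psum x j / psum x (Suc q))\<rceil> = int (sorted_list_of_set A ! (j - 1))"
      using assms j unfolding point_cell_def by (intro ceiling_unique) simp_all
    then show ?thesis by simp
  qed
  then have "(\<lambda>j. nat \<lceil>real n * (psum x j / psum x (Suc q))\<rceil>) ` {1..q} = (\<lambda>j. sorted_list_of_set A ! (j - 1)) ` {1..q}"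
    by (rule image_cong[OF refl])
  then show ?thesis using points_image by simp
qed

end

text \<open>
  The cell indicators select, for almost every sample, the set of rounded normalized partial sums
  as soon as these are distinct, and that set is uniformly distributed by the cell probabilities.
\<close>

lemma scaled_sum_point_stats_tendsto:
  fixes f :: "real \<times> real \<times> real \<times> real \<Rightarrow> real"
  assumes cont: "continuous_on UNIV f" and bound: "\<And>z. \<bar>f z\<bar> \<le> K"
  shows "(\<lambda>n. (\<Sum>A | A \<subseteq> {1..n} \<and> card A = q. f (point_stats n A)) * (fact q / real n ^ q))
     \<longlonglongrightarrow> (\<integral>x. f (limit_stats q x) \<partial>expos {1..Suc q})"
proof -
  define S where "S n = {A. A \<subseteq> {1..n} \<and> card A = q}" for n :: nat
  have S: "finite (S n)" for n unfolding S_def by (rule finite_subset[of _ "Pow {1..n}"]) auto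
  define V where "V n x = (\<lambda>j. nat \<lceil>real n * (psum x j / psum x (Suc q))\<rceil>) ` {1..q}" for n and x :: "nat \<Rightarrow> real"
  define g where "g n x = (\<Sum>A\<in>S n. f (point_stats n A) * indicator (point_cell q n A) x)" for n x
  \<comment> \<open>At most one summand survives, namely the one for the rounded set
    \<open>V n x\<close>; this yields both the uniform bound and the pointwise limit of
    \<open>g n\<close>.\<close>
  have g_eq: "g n x = (if V n x \<in> S n \<and> x \<in> point_cell q n (V n x) then f (point_stats n (V n x)) else 0)" for n x
  proof -
    have "f (point_stats n A) * indicator (point_cell q n A) x
        = (if A = V n x then (if x \<in> point_cell q n (V n x) then f (point_stats n (V n x)) else 0) else 0)" if "A \<in> S n" for A
    proof (cases "x \<in> point_cell q n A")
      case True
      have "V n x = A"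
        unfolding V_def by (rule point_cell_unique[OF _ _ True]) (use that in \<open>simp_all add: S_def\<close>)
      then show ?thesis using True by simp
    qed auto
    then have "g n x = (\<Sum>A\<in>S n. if A = V n x then (if x \<in> point_cell q n (V n x) then f (point_stats n (V n x)) else 0) else 0)"
      unfolding g_def by (rule sum.cong[OF refl])
    then show ?thesis using S[of n] by (simp add: sum.delta)
  qed
  have K: "K \<ge> 0" using bound[of undefined] by linarith
  have "(\<lambda>n. \<integral>x. g n x \<partial>expos {1..Suc q}) \<longlonglongrightarrow> (\<integral>x. f (limit_stats q x) \<partial>expos {1..Suc q})"
  proof (rule integral_dominated_convergence[where w = "\<lambda>_. K"])
    show "(\<lambda>x. f (limit_stats q x)) \<in> borel_measurable (expos {1..Suc q})"
      by (rule measurable_compose[OF measurable_limit_stats borel_measurable_continuous_onI[OF cont]])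
    show "g n \<in> borel_measurable (expos {1..Suc q})" for n
      unfolding g_def
      by (intro borel_measurable_sum borel_measurable_times borel_measurable_const borel_measurable_indicator sets_point_cell)
    show "integrable (expos {1..Suc q}) (\<lambda>_. K)"
      by (rule finite_measure.integrable_const[OF prob_space.finite_measure[OF prob_space_expos]])
    show "AE x in expos {1..Suc q}. norm (g n x) \<le> K" for n
      using bound K by (intro AE_I2) (simp add: g_eq)
    show "AE x in expos {1..Suc q}. (\<lambda>n. g n x) \<longlonglongrightarrow> f (limit_stats q x)"
      using AE_expos_pos[of "{1..Suc q}", OF finite_atLeastAtMost] AE_space
    proof eventually_elim
      case (elim x)
      interpret x: positive_point q x by unfold_locales (use elim in auto)
      have V: "V n x = x.V n ` {1..q}" for n by (simp only: V_def x.V_def[abs_def] x.r_def[abs_def])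
      have "isCont f (limit_stats q x)" using cont continuous_on_eq_continuous_at[OF open_UNIV, of f] by blast
      then have "(\<lambda>n. f (point_stats n (V n x))) \<longlonglongrightarrow> f (limit_stats q x)"
        unfolding V by (rule isCont_tendsto_compose[OF _ x.point_stats_tendsto])
      moreover have "eventually (\<lambda>n. f (point_stats n (V n x)) = g n x) sequentially"
        using x.eventually_strict
      proof eventually_elim
        case (elim n)
        then have mono: "strict_mono_on {1..q} (x.V n)" and range: "\<And>j. j \<in> {1..q} \<Longrightarrow> x.V n j \<in> {1..n}" by auto
        have "V n x \<in> S n"
          unfolding S_def V using range card_image[OF strict_mono_on_imp_inj_on[OF mono]] by auto
        moreover have "x \<in> point_cell q n (V n x)"
        proof -
          have "sorted_list_of_set (V n x) ! (j - 1) = x.V n j" if "j \<in> {1..q}" for j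
            unfolding V sorted_list_of_set_image_strict_mono[OF mono] using that
            by (subst nth_map) (auto simp del: upt_Suc)
          moreover have "real (x.V n j) - 1 < real n * (psum x j / psum x (Suc q)) \<and> real n * (psum x j / psum x (Suc q)) \<le> real (x.V n j)"
            if "j \<in> {1..q}" for j
            \<comment> \<open>The rounded value is at least 1, so the conversion to a natural number
              did not truncate the ceiling.\<close>
            using range[OF that] unfolding x.V_def x.r_def by simp linarith
          ultimately show ?thesis
            using \<open>x \<in> space (expos {1..Suc q})\<close> unfolding point_cell_def by simp
        qed
        ultimately show ?case by (simp add: g_eq)
      qed
      ultimately show ?case by (rule Lim_transform_eventually)
    qed
  qed
  moreover have "eventually (\<lambda>n. (\<integral>x. g n x \<partial>expos {1..Suc q})
      = (\<Sum>A | A \<subseteq> {1..n} \<and> card A = q. f (point_stats n A)) * (fact q / real n ^ q)) sequentially"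
    using eventually_gt_at_top[of 0]
  proof eventually_elim
    case (elim n)
    have "integrable (expos {1..Suc q}) (\<lambda>x. f (point_stats n A) * indicator (point_cell q n A) x)" for A
    proof (intro integrable_mult_right integrable_real_indicator sets_point_cell)
      show "emeasure (expos {1..Suc q}) (point_cell q n A) < \<infinity>"
        unfolding infinity_ennreal_def less_top[symmetric]
        by (rule finite_measure.emeasure_finite[OF prob_space.finite_measure[OF prob_space_expos]])
    qed
    then have "(\<integral>x. g n x \<partial>expos {1..Suc q})
      = (\<Sum>A\<in>S n. \<integral>x. f (point_stats n A) * indicator (point_cell q n A) x \<partial>expos {1..Suc q})"
      unfolding g_def by (rule Bochner_Integration.integral_sum)
    also have "\<dots> = (\<Sum>A\<in>S n. f (point_stats n A) * (fact q / real n ^ q))"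
    proof (rule sum.cong[OF refl])
      fix A assume "A \<in> S n"
      then have A: "A \<subseteq> {1..n}" "card A = q" by (auto simp: S_def)
      have "point_cell q n A \<inter> space (expos {1..Suc q}) = point_cell q n A" by (auto simp: point_cell_def)
      then show "(\<integral>x. f (point_stats n A) * indicator (point_cell q n A) x \<partial>expos {1..Suc q})
        = f (point_stats n A) * (fact q / real n ^ q)"
        using point_cell_prob[OF A elim] by simp
    qed
    finally show ?case by (simp only: S_def sum_distrib_right)
  qed
  ultimately show ?thesis by (rule Lim_transform_eventually)
qed

text \<open>A cell has mass \<open>fact q / n ^ q\<close> rather than one over the binomial
  coefficient. The test function 1 shows that the quotient of the two tends to 1, and dividing by
  this special case normalizes the means.\<close>

lemma mean_point_stats_tendsto:
  fixes f :: "real \<times> real \<times> real \<times> real \<Rightarrow> real"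
  assumes cont: "continuous_on UNIV f" and bound: "\<And>z. \<bar>f z\<bar> \<le> K"
  shows "(\<lambda>n. (\<Sum>A | A \<subseteq> {1..n} \<and> card A = q. f (point_stats n A)) / (n choose q))
     \<longlonglongrightarrow> (\<integral>x. f (limit_stats q x) \<partial>expos {1..Suc q})"
proof -
  have "(\<lambda>n. (\<Sum>A | A \<subseteq> {1..n} \<and> card A = q. 1) * (fact q / real n ^ q)) \<longlonglongrightarrow> (\<integral>x. 1 \<partial>expos {1..Suc q})"
    by (rule scaled_sum_point_stats_tendsto[where f = "\<lambda>_. 1" and K = 1]) simp_all
  then have one: "(\<lambda>n. real (n choose q) * (fact q / real n ^ q)) \<longlonglongrightarrow> 1"
    using prob_space.prob_space[OF prob_space_expos[of "{1..Suc q}"]] by (simp add: n_subsets)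
  have "(\<lambda>n. ((\<Sum>A | A \<subseteq> {1..n} \<and> card A = q. f (point_stats n A)) * (fact q / real n ^ q)) / (real (n choose q) * (fact q / real n ^ q)))
    \<longlonglongrightarrow> (\<integral>x. f (limit_stats q x) \<partial>expos {1..Suc q}) / 1"
    by (rule tendsto_divide[OF scaled_sum_point_stats_tendsto[OF cont bound] one]) simp
  moreover have "eventually (\<lambda>n. ((\<Sum>A | A \<subseteq> {1..n} \<and> card A = q. f (point_stats n A)) * (fact q / real n ^ q)) / (real (n choose q) * (fact q / real n ^ q))
     = (\<Sum>A | A \<subseteq> {1..n} \<and> card A = q. f (point_stats n A)) / (n choose q)) sequentially"
    using eventually_gt_at_top[of 0]
  proof eventually_elim
    case (elim n)
    then have "fact q / real n ^ q \<noteq> (0 :: real)" by simp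
    then show ?case by (rule nonzero_mult_divide_mult_cancel_right)
  qed
  ultimately show ?thesis by (simp add: Lim_transform_eventually)
qed

section \<open>The limit law as a Poisson mixture\<close>

lemma measurable_normalized_expos:
  "(\<lambda>x. x (Suc q) / (real (Suc q) * psum x (Suc q))) \<in> borel_measurable (expos {1..Suc q})"
  "(\<lambda>x. (\<Sum>i=1..Suc q. x i / real i) / psum x (Suc q)) \<in> borel_measurable (expos {1..Suc q})"
  by (intro borel_measurable_divide borel_measurable_times borel_measurable_const measurable_expos_psum
        borel_measurable_sum measurable_coordinate; simp)+

lemma distr_eqI_nn_integral:
  assumes "f \<in> borel_measurable M" "g \<in> borel_measurable M"
    and "\<And>A. A \<in> sets borel \<Longrightarrow> (\<integral>\<^sup>+x. indicator A (f x) \<partial>M) = (\<integral>\<^sup>+x. indicator A (g x) \<partial>M)"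
  shows "distr M borel f = distr M borel g"
proof (rule measure_eqI)
  fix A assume "A \<in> sets (distr M borel f)"
  then have A: "A \<in> sets borel" by simp
  have "emeasure (distr M borel h) A = (\<integral>\<^sup>+x. indicator A (h x) \<partial>M)" if "h \<in> borel_measurable M" for h
    using nn_integral_distr[OF that, of "indicator A"] A by (simp add: nn_integral_indicator)
  then show "emeasure (distr M borel f) A = emeasure (distr M borel g) A"
    using assms A by simp
qed simp

text \<open>Equality of laws is tested on indicators, which are the functions
  \<open>indicator A (s / t)\<close> of the pair (minimum, total).\<close>

lemma distr_min_spacing:
  "distr (expos {1..Suc q}) borel (\<lambda>x. Min (x ` {1..Suc q}) / psum x (Suc q))
   = distr (expos {1..Suc q}) borel (\<lambda>x. x (Suc q) / (real (Suc q) * psum x (Suc q)))"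
proof (rule distr_eqI_nn_integral)
  fix A :: "real set" assume A [measurable]: "A \<in> sets borel"
  have "(\<lambda>(s, t). indicator A (s / t) :: ennreal) \<in> borel_measurable (borel \<Otimes>\<^sub>M borel)" by measurable
  then have g: "(\<lambda>(s, t). indicator A (s / t) :: ennreal) \<in> borel_measurable borel"
    by (simp only: borel_prod)
  show "(\<integral>\<^sup>+x. indicator A (Min (x ` {1..Suc q}) / psum x (Suc q)) \<partial>expos {1..Suc q})
    = (\<integral>\<^sup>+x. indicator A (x (Suc q) / (real (Suc q) * psum x (Suc q))) \<partial>expos {1..Suc q})"
    using expos_Min_sum[OF _ _ g, of "{1..Suc q}" q] by simp
qed (intro borel_measurable_divide measurable_expos_psum measurable_expos_Min_Max measurable_normalized_expos; simp)+

lemma distr_max_spacing: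
  "distr (expos {1..Suc q}) borel (\<lambda>x. Max (x ` {1..Suc q}) / psum x (Suc q))
   = distr (expos {1..Suc q}) borel (\<lambda>x. (\<Sum>i=1..Suc q. x i / real i) / psum x (Suc q))"
proof (rule distr_eqI_nn_integral)
  fix A :: "real set" assume A [measurable]: "A \<in> sets borel"
  have "(\<lambda>(s, t). indicator A (s / t) :: ennreal) \<in> borel_measurable (borel \<Otimes>\<^sub>M borel)" by measurable
  then have g: "(\<lambda>(s, t). indicator A (s / t) :: ennreal) \<in> borel_measurable borel"
    by (simp only: borel_prod)
  have "(\<integral>\<^sup>+x. indicator A (Max (x ` {1..Suc q}) / psum x (Suc q)) \<partial>expos {1..Suc q})
    = (\<integral>\<^sup>+x. (\<lambda>(s, t). indicator A (s / t)) (Max (insert 0 (x ` {1..Suc q})), psum x (Suc q)) \<partial>expos {1..Suc q})"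
  proof (rule nn_integral_cong_AE, use AE_expos_pos[of "{1..Suc q}", OF finite_atLeastAtMost] in eventually_elim)
    case (elim x)
    \<comment> \<open>On positive samples the inserted 0 does not change the maximum.\<close>
    have "0 \<le> Max (x ` {1..Suc q})"
      using elim by (auto simp: Max_ge_iff intro!: bexI[of _ "Suc q"] less_imp_le simp del: image_insert)
    then have "Max (insert 0 (x ` {1..Suc q})) = Max (x ` {1..Suc q})"
      by (subst Max_insert) (simp_all add: max_absorb2)
    then show ?case by (simp only: prod.case)
  qed
  also have "\<dots> = renyi (card {1..Suc q}) (\<lambda>(s, t). indicator A (s / t))"
    by (rule expos_Max_sum[OF _ g]) simp
  finally show "(\<integral>\<^sup>+x. indicator A (Max (x ` {1..Suc q}) / psum x (Suc q)) \<partial>expos {1..Suc q})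
    = (\<integral>\<^sup>+x. indicator A ((\<Sum>i=1..Suc q. x i / real i) / psum x (Suc q)) \<partial>expos {1..Suc q})"
    by (simp only: renyi_def card_atLeastAtMost prod.case diff_Suc_1)
qed (intro borel_measurable_divide measurable_expos_psum measurable_expos_Min_Max measurable_normalized_expos; simp)+

lemma Collect_space_vimage: "{x \<in> space M. f x \<in> A} = f -` A \<inter> space M"
  by auto

lemma integral_indicator_Collect:
  "(\<integral>\<omega>. indicator A (f \<omega>) \<partial>M) = measure M {\<omega> \<in> space M. f \<omega> \<in> A}"
proof -
  have "(\<integral>\<omega>. indicator A (f \<omega>) \<partial>M) = (\<integral>\<omega>. indicator {\<omega> \<in> space M. f \<omega> \<in> A} \<omega> \<partial>M :: real)"
    by (rule Bochner_Integration.integral_cong) (auto simp: indicator_def)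
  also have "\<dots> = measure M ({\<omega> \<in> space M. f \<omega> \<in> A} \<inter> space M)"
    by (rule Bochner_Integration.integral_indicator)
  also have "{\<omega> \<in> space M. f \<omega> \<in> A} \<inter> space M = {\<omega> \<in> space M. f \<omega> \<in> A}" by auto
  finally show ?thesis .
qed

section \<open>Expectations with a Poisson number of exponential variables\<close>

locale poisson_exponentials = prob_space N for N :: "'b measure" +
  fixes \<nu> :: "'b \<Rightarrow> nat" and X :: "nat \<Rightarrow> 'b \<Rightarrow> real" and t :: real
  assumes poisson: "poisson_distributed N \<nu> t"
    and exponential: "\<And>i. i \<ge> 1 \<Longrightarrow> distributed N lborel (X i) (exponential_density 1)"
    and indep: "indep_vars (\<lambda>_. borel) (\<lambda>i \<omega>. if i = 0 then real (\<nu> \<omega>) else X i \<omega>) (UNIV :: nat set)"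
begin

lemma measurable_\<nu> [measurable]: "\<nu> \<in> measurable N (count_space UNIV)"
  using poisson by (simp add: poisson_distributed_def)

lemma measurable_X: "i \<ge> 1 \<Longrightarrow> X i \<in> borel_measurable N"
  using distributed_measurable[OF exponential] by simp

definition p :: "nat \<Rightarrow> real" where "p q = t ^ q / fact q * exp (- t)"

lemma prob_\<nu>: "prob {\<omega> \<in> space N. \<nu> \<omega> = q} = p q"
  using poisson by (simp add: poisson_distributed_def p_def)

text \<open>The length \<open>q + 1\<close> is deterministic, so the law is a plain product; the
  random length \<open>\<nu> \<omega>\<close> is inserted afterwards, level by level.\<close>

definition sample :: "nat \<Rightarrow> 'b \<Rightarrow> nat \<Rightarrow> real" where
  "sample q \<omega> = (\<lambda>i\<in>{1..Suc q}. X i \<omega>)"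

lemma measurable_sample: "sample q \<in> measurable N (expos {1..Suc q})"
  unfolding sample_def[abs_def]
  by (rule measurable_restrict) (use measurable_X in \<open>simp cong: measurable_cong_sets\<close>)

lemma distr_sample: "distr N (expos {1..Suc q}) (sample q) = expos {1..Suc q}"
proof -
  have "indep_vars (\<lambda>_. borel) (\<lambda>i \<omega>. if i = 0 then real (\<nu> \<omega>) else X i \<omega>) {1..Suc q}"
    by (rule indep_vars_subset[OF indep]) simp
  then have "indep_vars (\<lambda>_. borel) X {1..Suc q}"
    by (subst indep_vars_cong[OF refl, of _ X "\<lambda>i \<omega>. if i = 0 then real (\<nu> \<omega>) else X i \<omega>"]) auto
  then have "distr N (\<Pi>\<^sub>M i\<in>{1..Suc q}. borel) (\<lambda>\<omega>. \<lambda>i\<in>{1..Suc q}. X i \<omega>) = (\<Pi>\<^sub>M i\<in>{1..Suc q}. distr N borel (X i))"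
    by (subst (asm) indep_vars_iff_distr_eq_PiM') (auto intro: measurable_X)
  also have "\<dots> = expos {1..Suc q}"
  proof (rule PiM_cong[OF refl])
    fix i assume "i \<in> {1..Suc q}"
    then have "distr N lborel (X i) = expo"
      unfolding expo_def by (intro distributed_distr_eq_density exponential) simp
    moreover have "distr N lborel (X i) = distr N borel (X i)" by (rule distr_cong) simp_all
    ultimately show "distr N borel (X i) = expo" by simp
  qed
  finally have "distr N (\<Pi>\<^sub>M i\<in>{1..Suc q}. borel) (sample q) = expos {1..Suc q}"
    by (simp add: sample_def[abs_def])
  moreover have "distr N (\<Pi>\<^sub>M i\<in>{1..Suc q}. borel) (sample q) = distr N (expos {1..Suc q}) (sample q)"
    by (rule distr_cong[OF refl _ refl], rule sets_PiM_cong) simp_all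
  ultimately show ?thesis by simp
qed

text \<open>The blocks \<open>{0}\<close> and \<open>{1..Suc q}\<close> of the independent family
  are independent of each other; the first decides whether \<open>\<nu> = q\<close>, the second
  determines the sample.\<close>

lemma expectation_on_level:
  fixes h :: "(nat \<Rightarrow> real) \<Rightarrow> real"
  assumes h: "h \<in> borel_measurable (expos {1..Suc q})" and bound: "\<And>x. \<bar>h x\<bar> \<le> K"
  shows "integrable N (\<lambda>\<omega>. indicator {q} (\<nu> \<omega>) * h (sample q \<omega>))"
    and "(\<integral>\<omega>. indicator {q} (\<nu> \<omega>) * h (sample q \<omega>) \<partial>N) = p q * (\<integral>x. h x \<partial>expos {1..Suc q})"
proof -
  let ?Y = "\<lambda>i \<omega>. if i = 0 then real (\<nu> \<omega>) else X i \<omega>"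
  have sets: "sets (\<Pi>\<^sub>M i\<in>{1..Suc q}. borel) = sets (expos {1..Suc q})"
    by (rule sets_PiM_cong) simp_all
  have h': "h \<in> borel_measurable (\<Pi>\<^sub>M i\<in>{1..Suc q}. borel)"
    using h measurable_cong_sets[OF sets refl, of borel] by simp
  have f: "(\<lambda>y. indicator {real q} (y 0) :: real) \<in> borel_measurable (\<Pi>\<^sub>M i\<in>{0::nat}. borel)"
    by (rule measurable_compose[OF measurable_component_singleton]) simp_all
  have "indep_var (\<Pi>\<^sub>M i\<in>{0}. borel) (\<lambda>\<omega>. restrict (\<lambda>i. ?Y i \<omega>) {0}) (\<Pi>\<^sub>M i\<in>{1..Suc q}. borel) (\<lambda>\<omega>. restrict (\<lambda>i. ?Y i \<omega>) {1..Suc q})"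
    by (rule indep_var_restrict[OF indep]) auto
  from indep_var_compose[OF this f h']
  have ind: "indep_var borel (\<lambda>\<omega>. indicator {q} (\<nu> \<omega>)) borel (\<lambda>\<omega>. h (sample q \<omega>))"
  proof -
    assume *: "indep_var borel ((\<lambda>y. indicator {real q} (y 0) :: real) \<circ> (\<lambda>\<omega>. restrict (\<lambda>i. ?Y i \<omega>) {0})) borel (h \<circ> (\<lambda>\<omega>. restrict (\<lambda>i. ?Y i \<omega>) {1..Suc q}))"
    have "restrict (\<lambda>i. ?Y i \<omega>) {1..Suc q} = sample q \<omega>" for \<omega>
      unfolding sample_def by (rule restrict_ext) simp
    then show ?thesis using * by (simp add: comp_def indicator_def)
  qed
  have i1: "integrable N (\<lambda>\<omega>. indicator {q} (\<nu> \<omega>) :: real)"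
    by (rule integrable_const_bound[where B = 1]) (auto simp: indicator_def)
  have i2: "integrable N (\<lambda>\<omega>. h (sample q \<omega>))"
    by (rule integrable_const_bound[where B = K]) (use bound measurable_compose[OF measurable_sample h] in auto)
  show "integrable N (\<lambda>\<omega>. indicator {q} (\<nu> \<omega>) * h (sample q \<omega>))"
    by (rule indep_var_integrable[OF ind i1 i2])
  have "(\<integral>\<omega>. indicator {q} (\<nu> \<omega>) * h (sample q \<omega>) \<partial>N)
     = (\<integral>\<omega>. indicator {q} (\<nu> \<omega>) \<partial>N) * (\<integral>\<omega>. h (sample q \<omega>) \<partial>N)"
    by (rule indep_var_lebesgue_integral[OF ind i1 i2])
  also have "(\<integral>\<omega>. h (sample q \<omega>) \<partial>N) = (\<integral>x. h x \<partial>distr N (expos {1..Suc q}) (sample q))"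
    by (rule integral_distr[OF measurable_sample h, symmetric])
  also have "(\<integral>\<omega>. indicator {q} (\<nu> \<omega>) \<partial>N) = p q"
  proof -
    have "(\<integral>\<omega>. indicator {q} (\<nu> \<omega>) \<partial>N) = (\<integral>\<omega>. indicator {\<omega> \<in> space N. \<nu> \<omega> = q} \<omega> \<partial>N :: real)"
      by (rule Bochner_Integration.integral_cong) (auto simp: indicator_def)
    also have "\<dots> = prob ({\<omega> \<in> space N. \<nu> \<omega> = q} \<inter> space N)" by (rule Bochner_Integration.integral_indicator)
    also have "{\<omega> \<in> space N. \<nu> \<omega> = q} \<inter> space N = {\<omega> \<in> space N. \<nu> \<omega> = q}" by auto
    finally show ?thesis using prob_\<nu> by simp
  qed
  finally show "(\<integral>\<omega>. indicator {q} (\<nu> \<omega>) * h (sample q \<omega>) \<partial>N) = p q * (\<integral>x. h x \<partial>expos {1..Suc q})"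
    unfolding distr_sample .
qed

lemma p_nonneg: "p q \<ge> 0"
  unfolding prob_\<nu>[symmetric] by simp

lemma summable_p: "summable p"
proof -
  have "summable (\<lambda>q. t ^ q / fact q)"
    using summable_exp[of t] by (simp add: divide_inverse mult.commute)
  from summable_mult2[OF this, of "exp (- t)"] show ?thesis by (simp add: p_def[abs_def])
qed

text \<open>At each \<open>\<omega>\<close> only the level \<open>q = \<nu> \<omega>\<close>
  contributes. Sum and expectation may be exchanged because level \<open>q\<close> has norm at most
  \<open>p q * K\<close> and the Poisson weights are summable.\<close>

lemma expectation_mixture:
  fixes h :: "nat \<Rightarrow> (nat \<Rightarrow> real) \<Rightarrow> real"
  assumes h: "\<And>q. h q \<in> borel_measurable (expos {1..Suc q})" and bound: "\<And>q x. \<bar>h q x\<bar> \<le> K"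
  shows "(\<integral>\<omega>. h (\<nu> \<omega>) (sample (\<nu> \<omega>) \<omega>) \<partial>N) = (\<Sum>q. p q * (\<integral>x. h q x \<partial>expos {1..Suc q}))"
proof -
  define F where "F q \<omega> = indicator {q} (\<nu> \<omega>) * h q (sample q \<omega>)" for q \<omega>
  have F: "F q \<omega> = 0" if "q \<noteq> \<nu> \<omega>" for q \<omega> using that by (simp add: F_def)
  have "(\<lambda>q. F q \<omega>) sums F (\<nu> \<omega>) \<omega>" for \<omega>
    using sums_finite[of "{\<nu> \<omega>}" "\<lambda>q. F q \<omega>"] F by simp
  then have sum: "h (\<nu> \<omega>) (sample (\<nu> \<omega>) \<omega>) = (\<Sum>q. F q \<omega>)" for \<omega>
    by (simp add: sums_iff F_def)
  have F_abs: "norm (F q \<omega>) = indicator {q} (\<nu> \<omega>) * \<bar>h q (sample q \<omega>)\<bar>" for q \<omega>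
    by (simp add: F_def indicator_def)
  have habs: "(\<lambda>x. \<bar>h q x\<bar>) \<in> borel_measurable (expos {1..Suc q})" for q
    using h by measurable
  have "(\<integral>\<omega>. (\<Sum>q. F q \<omega>) \<partial>N) = (\<Sum>q. \<integral>\<omega>. F q \<omega> \<partial>N)"
  proof (rule integral_suminf)
    show "integrable N (F q)" for q
      unfolding F_def using h bound by (rule expectation_on_level(1))
    show "AE \<omega> in N. summable (\<lambda>q. norm (F q \<omega>))"
      by (intro AE_I2 summable_finite[of "{\<nu> _}"]) (auto intro: F)
    show "summable (\<lambda>q. \<integral>\<omega>. norm (F q \<omega>) \<partial>N)"
    proof (rule summable_comparison_test'[of "\<lambda>q. p q * K" 0])
      show "summable (\<lambda>q. p q * K)" by (rule summable_mult2[OF summable_p])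
      fix q :: nat
      have "(\<integral>\<omega>. norm (F q \<omega>) \<partial>N) = p q * (\<integral>x. \<bar>h q x\<bar> \<partial>expos {1..Suc q})"
        unfolding F_abs by (rule expectation_on_level(2)[OF habs]) (use bound in simp)
      also have "\<dots> \<le> p q * (\<integral>x. K \<partial>expos {1..Suc q})"
      proof (intro mult_left_mono integral_mono p_nonneg bound)
        show "integrable (expos {1..Suc q}) (\<lambda>_. K)"
          by (rule finite_measure.integrable_const[OF prob_space.finite_measure[OF prob_space_expos]])
        show "integrable (expos {1..Suc q}) (\<lambda>x. \<bar>h q x\<bar>)"
          by (rule finite_measure.integrable_const_bound[OF prob_space.finite_measure[OF prob_space_expos], where B = K])
             (use bound habs in auto)
      qed
      finally show "norm (\<integral>\<omega>. norm (F q \<omega>) \<partial>N) \<le> p q * K"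
        using prob_space.prob_space[OF prob_space_expos[of "{1..Suc q}"]] by simp
    qed
  qed
  also have "\<dots> = (\<Sum>q. p q * (\<integral>x. h q x \<partial>expos {1..Suc q}))"
    unfolding F_def by (rule suminf_cong) (rule expectation_on_level(2)[OF h bound])
  finally show ?thesis unfolding sum .
qed

lemma measurable_mixture:
  assumes "\<And>q. G q \<in> measurable (expos {1..Suc q}) L"
  shows "(\<lambda>\<omega>. G (\<nu> \<omega>) (sample (\<nu> \<omega>) \<omega>)) \<in> measurable N L"
  by (rule measurable_compose_countable[OF measurable_compose[OF measurable_sample assms] measurable_\<nu>])

lemma measure_mixture:
  fixes G :: "nat \<Rightarrow> (nat \<Rightarrow> real) \<Rightarrow> 'c"
  assumes G: "\<And>q. G q \<in> measurable (expos {1..Suc q}) L" and A: "A \<in> sets L"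
  shows "measure N {\<omega> \<in> space N. G (\<nu> \<omega>) (sample (\<nu> \<omega>) \<omega>) \<in> A}
    = (\<Sum>q. p q * measure (expos {1..Suc q}) {x \<in> space (expos {1..Suc q}). G q x \<in> A})"
proof -
  have "(\<integral>\<omega>. indicator A (G (\<nu> \<omega>) (sample (\<nu> \<omega>) \<omega>)) \<partial>N)
     = (\<Sum>q. p q * (\<integral>x. indicator A (G q x) \<partial>expos {1..Suc q}))"
    by (rule expectation_mixture[where K = 1, OF measurable_compose[OF G borel_measurable_indicator[OF A]]])
       (auto simp: indicator_def)
  then show ?thesis unfolding integral_indicator_Collect .
qed

text \<open>Both laws are mixtures with the same weights, so an identity in law for every fixed
  number of points passes to the random number. This carries Renyi's representation from
  \<open>q\<close> to \<open>\<nu>\<close>.\<close>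

lemma distr_mixture_cong:
  assumes G: "\<And>q. G q \<in> measurable (expos {1..Suc q}) L" and G': "\<And>q. G' q \<in> measurable (expos {1..Suc q}) L"
    and eq: "\<And>q. distr (expos {1..Suc q}) L (G q) = distr (expos {1..Suc q}) L (G' q)"
  shows "distr N L (\<lambda>\<omega>. G (\<nu> \<omega>) (sample (\<nu> \<omega>) \<omega>)) = distr N L (\<lambda>\<omega>. G' (\<nu> \<omega>) (sample (\<nu> \<omega>) \<omega>))"
proof (rule measure_eqI)
  fix A assume "A \<in> sets (distr N L (\<lambda>\<omega>. G (\<nu> \<omega>) (sample (\<nu> \<omega>) \<omega>)))"
  then have A: "A \<in> sets L" by simp
  have "measure (expos {1..Suc q}) {x \<in> space (expos {1..Suc q}). G q x \<in> A}
      = measure (expos {1..Suc q}) {x \<in> space (expos {1..Suc q}). G' q x \<in> A}" for q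
    unfolding Collect_space_vimage measure_distr[OF G A, symmetric] measure_distr[OF G' A, symmetric] eq ..
  then have "measure N {\<omega> \<in> space N. G (\<nu> \<omega>) (sample (\<nu> \<omega>) \<omega>) \<in> A} = measure N {\<omega> \<in> space N. G' (\<nu> \<omega>) (sample (\<nu> \<omega>) \<omega>) \<in> A}"
    unfolding measure_mixture[OF G A] measure_mixture[OF G' A] by simp
  then show "emeasure (distr N L (\<lambda>\<omega>. G (\<nu> \<omega>) (sample (\<nu> \<omega>) \<omega>))) A = emeasure (distr N L (\<lambda>\<omega>. G' (\<nu> \<omega>) (sample (\<nu> \<omega>) \<omega>))) A"
    unfolding emeasure_distr[OF measurable_mixture[OF G] A] emeasure_distr[OF measurable_mixture[OF G'] A]
      emeasure_eq_measure Collect_space_vimage by simp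
qed simp

end

text \<open>The limit variables lie in \<open>{0..1}\<close> only almost surely; clipping makes this hold everywhere.\<close>

definition clip :: "real \<Rightarrow> real" where "clip s = max 0 (min 1 s)"

lemma clip_range: "clip s \<in> {0..1}"
  by (simp add: clip_def)

text \<open>At levels in \<open>[0, 1)\<close> clipping leaves the events unchanged, so the
  distribution functions can be computed from the unclipped variables.\<close>

lemma clip_le_iff: "0 \<le> y \<Longrightarrow> y < 1 \<Longrightarrow> clip s \<le> y \<longleftrightarrow> s \<le> y"
  by (auto simp: clip_def)

lemma AE_limit_stats_clip:
  "AE x in expos {1..Suc q}. x 1 / psum x (Suc q) \<in> {0..1} \<and> psum x q / psum x (Suc q) \<in> {0..1}"
  using AE_expos_pos[of "{1..Suc q}", OF finite_atLeastAtMost]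
proof eventually_elim
  case (elim x)
  have T: "psum x (Suc q) > 0" by (rule sum_pos) (use elim in auto)
  have "x 1 \<le> psum x (Suc q)"
    by (rule member_le_sum) (use elim in \<open>auto intro: less_imp_le\<close>)
  moreover have "0 \<le> psum x q"
    by (rule sum_nonneg) (use elim in \<open>auto intro: less_imp_le\<close>)
  moreover have "0 \<le> x 1" "psum x q \<le> psum x (Suc q)"
    using elim by (simp_all add: less_imp_le)
  ultimately show ?case using T by (simp add: divide_le_eq_1 del: sum.cl_ivl_Suc)
qed

lemma fixed_points_stats:
  "(real (min_fixed n \<pi>) / real n, real (max_fixed n \<pi>) / real n,
    real (min_spacing n \<pi>) / real n, real (max_spacing n \<pi>) / real n) = point_stats n (fixed_points n \<pi>)"
  by (simp add: point_stats_def min_fixed_def max_fixed_def min_spacing_def max_spacing_def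
        spacings_def point_spacings_def)

section \<open>The limit vector and its marginal laws\<close>

context poisson_exponentials
begin

definition limit_vector :: "'b \<Rightarrow> real \<times> real \<times> real \<times> real" where
  "limit_vector \<omega> = limit_stats (\<nu> \<omega>) (sample (\<nu> \<omega>) \<omega>)"

lemma measurable_limit_vector: "limit_vector \<in> borel_measurable N"
  unfolding limit_vector_def[abs_def] by (rule measurable_mixture[OF measurable_limit_stats])

lemma AE_limit_vector_range: "AE \<omega> in N. fst (limit_vector \<omega>) \<in> {0..1} \<and> fst (snd (limit_vector \<omega>)) \<in> {0..1}"
proof -
  have "AE x in distr N (expos {1..Suc q}) (sample q). fst (limit_stats q x) \<in> {0..1} \<and> fst (snd (limit_stats q x)) \<in> {0..1}" for q
    unfolding distr_sample using AE_limit_stats_clip[of q] by (simp only: limit_stats_def fst_conv snd_conv)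
  then have "AE \<omega> in N. fst (limit_stats q (sample q \<omega>)) \<in> {0..1} \<and> fst (snd (limit_stats q (sample q \<omega>))) \<in> {0..1}" for q
    by (rule AE_distrD[OF measurable_sample])
  \<comment> \<open>One null set serves all \<open>q\<close>, so the random value
    \<open>\<nu> \<omega>\<close> may be inserted.\<close>
  then have "AE \<omega> in N. \<forall>q. fst (limit_stats q (sample q \<omega>)) \<in> {0..1} \<and> fst (snd (limit_stats q (sample q \<omega>))) \<in> {0..1}"
    unfolding AE_all_countable by blast
  then show ?thesis by eventually_elim (simp add: limit_vector_def)
qed

text \<open>The expectations converge to a Poisson mixture of integrals over
  \<open>expos {1..Suc q}\<close>, and \<open>expectation_mixture\<close> recognizes that mixture as
  a single expectation under \<open>N\<close>.\<close>

lemma converges_limit_vector: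
  assumes \<theta>: "\<And>k. k \<ge> 1 \<Longrightarrow> \<theta> k \<ge> 0" "\<theta> 1 = t"
    and ratio: "(\<lambda>n. perm_norm \<theta> (n - 1) / perm_norm \<theta> n) \<longlonglongrightarrow> 1"
  shows "converges_in_distribution (weighted_perm \<theta>) (\<lambda>n \<pi>. point_stats n (fixed_points n \<pi>)) N limit_vector"
  unfolding converges_in_distribution_def
proof (intro allI impI, elim conjE)
  fix f :: "real \<times> real \<times> real \<times> real \<Rightarrow> real"
  assume cont: "continuous_on UNIV f" and "bounded (range f)"
  then obtain K where K: "\<And>z. \<bar>f z\<bar> \<le> K" by (auto simp: bounded_iff)
  have "(\<lambda>n. \<integral>\<pi>. f (point_stats n (fixed_points n \<pi>)) \<partial>weighted_perm \<theta> n)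
     \<longlonglongrightarrow> (\<Sum>q. \<theta> 1 ^ q / fact q * exp (- \<theta> 1) * (\<integral>x. f (limit_stats q x) \<partial>expos {1..Suc q}))"
    by (rule integral_weighted_perm_tendsto[OF \<theta>(1) ratio K mean_point_stats_tendsto[OF cont K]])
  also have "(\<Sum>q. \<theta> 1 ^ q / fact q * exp (- \<theta> 1) * (\<integral>x. f (limit_stats q x) \<partial>expos {1..Suc q})) = (\<integral>\<omega>. f (limit_vector \<omega>) \<partial>N)"
    unfolding limit_vector_def p_def[symmetric] \<theta>(2)
    by (rule expectation_mixture[symmetric, where K = K])
       (use K measurable_compose[OF measurable_limit_stats borel_measurable_continuous_onI[OF cont]] in auto)
  finally show "(\<lambda>n. \<integral>\<pi>. f (point_stats n (fixed_points n \<pi>)) \<partial>weighted_perm \<theta> n) \<longlonglongrightarrow> (\<integral>\<omega>. f (limit_vector \<omega>) \<partial>N)" .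
qed

text \<open>The generating function of the Poisson law; \<open>y = 1\<close> gives total mass
  one.\<close>

lemma sum_p_power: "(\<Sum>q. p q * y ^ q) = exp (t * (y - 1))" "summable (\<lambda>q. p q * y ^ q)"
proof -
  have eq: "p q * y ^ q = exp (- t) * ((t * y) ^ q / fact q)" for q
    by (simp add: p_def power_mult_distrib)
  have sm: "summable (\<lambda>q. (t * y) ^ q / fact q)"
    using summable_exp[of "t * y"] by (simp add: divide_inverse mult.commute)
  then show "summable (\<lambda>q. p q * y ^ q)" unfolding eq by (rule summable_mult)
  have "(\<Sum>q. p q * y ^ q) = exp (- t) * exp (t * y)"
    unfolding eq suminf_mult[OF sm] exp_real_suminf ..
  then show "(\<Sum>q. p q * y ^ q) = exp (t * (y - 1))"
    by (simp add: mult_exp_exp algebra_simps)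
qed

text \<open>Given \<open>q\<close> points the distribution function is
  \<open>1 - (1 - y) ^ q\<close>, so its Poisson average is the difference of two values of the
  generating function, at 1 and at \<open>1 - y\<close>.\<close>

lemma prob_first_le:
  assumes y: "0 \<le> y" "y < 1"
  shows "prob {\<omega> \<in> space N. fst (limit_vector \<omega>) \<le> y} = 1 - exp (- t * y)"
proof -
  have "prob {\<omega> \<in> space N. limit_vector \<omega> \<in> {z. fst z \<le> y}}
     = (\<Sum>q. p q * measure (expos {1..Suc q}) {x \<in> space (expos {1..Suc q}). limit_stats q x \<in> {z. fst z \<le> y}})"
    unfolding limit_vector_def
    by (rule measure_mixture[OF measurable_limit_stats]) (auto intro!: borel_closed closed_Collect_le continuous_on_fst continuous_on_snd continuous_on_id continuous_on_const)
  also have "\<dots> = (\<Sum>q. p q * 1 ^ q - p q * (1 - y) ^ q)"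
    using expos_first_le[OF y] by (intro suminf_cong) (simp add: limit_stats_def right_diff_distrib)
  also have "\<dots> = (\<Sum>q. p q * 1 ^ q) - (\<Sum>q. p q * (1 - y) ^ q)"
    by (rule suminf_diff[OF sum_p_power(2) sum_p_power(2), symmetric])
  also have "\<dots> = 1 - exp (- t * y)"
    unfolding sum_p_power by simp
  finally show ?thesis by simp
qed

lemma prob_last_le:
  assumes y: "0 \<le> y" "y < 1"
  shows "prob {\<omega> \<in> space N. fst (snd (limit_vector \<omega>)) \<le> y} = exp (t * (y - 1))"
proof -
  have "prob {\<omega> \<in> space N. limit_vector \<omega> \<in> {z. fst (snd z) \<le> y}}
     = (\<Sum>q. p q * measure (expos {1..Suc q}) {x \<in> space (expos {1..Suc q}). limit_stats q x \<in> {z. fst (snd z) \<le> y}})"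
    unfolding limit_vector_def
    by (rule measure_mixture[OF measurable_limit_stats]) (auto intro!: borel_closed closed_Collect_le continuous_on_fst continuous_on_snd continuous_on_id continuous_on_const)
  also have "\<dots> = (\<Sum>q. p q * y ^ q)"
    using expos_last_ge[OF y] by (intro suminf_cong) (simp add: limit_stats_def)
  finally show ?thesis unfolding sum_p_power by simp
qed

lemma sum_sample: "(\<Sum>i=1..Suc (\<nu> \<omega>). f i (sample (\<nu> \<omega>) \<omega> i)) = (\<Sum>i=1..\<nu> \<omega> + 1. f i (X i \<omega>))"
  by (rule sum.cong) (simp_all add: sample_def)

lemma distr_min_gap:
  "distr N borel (\<lambda>\<omega>. fst (snd (snd (limit_vector \<omega>)))) = distr N borel
      (\<lambda>\<omega>. X (\<nu> \<omega> + 1) \<omega> / (real (\<nu> \<omega> + 1) * (\<Sum>i=1..\<nu> \<omega> + 1. X i \<omega>)))"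
proof -
  have "distr N borel (\<lambda>\<omega>. fst (snd (snd (limit_vector \<omega>))))
      = distr N borel (\<lambda>\<omega>. (\<lambda>q x. Min (x ` {1..Suc q}) / psum x (Suc q)) (\<nu> \<omega>) (sample (\<nu> \<omega>) \<omega>))"
    by (simp only: limit_vector_def limit_stats_def fst_conv snd_conv)
  also have "\<dots> = distr N borel (\<lambda>\<omega>. (\<lambda>q x. x (Suc q) / (real (Suc q) * psum x (Suc q))) (\<nu> \<omega>) (sample (\<nu> \<omega>) \<omega>))"
    by (rule distr_mixture_cong[OF _ measurable_normalized_expos(1) distr_min_spacing])
       (intro borel_measurable_divide measurable_expos_psum measurable_expos_Min_Max; simp)
  also have "(\<lambda>\<omega>. (\<lambda>q x. x (Suc q) / (real (Suc q) * psum x (Suc q))) (\<nu> \<omega>) (sample (\<nu> \<omega>) \<omega>))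
     = (\<lambda>\<omega>. X (\<nu> \<omega> + 1) \<omega> / (real (\<nu> \<omega> + 1) * (\<Sum>i=1..\<nu> \<omega> + 1. X i \<omega>)))"
    using sum_sample[of "\<lambda>_ y. y"] by (auto simp: sample_def)
  finally show ?thesis .
qed

lemma distr_max_gap:
  "distr N borel (\<lambda>\<omega>. snd (snd (snd (limit_vector \<omega>)))) = distr N borel
      (\<lambda>\<omega>. (\<Sum>i=1..\<nu> \<omega> + 1. X i \<omega> / real i) / (\<Sum>i=1..\<nu> \<omega> + 1. X i \<omega>))"
proof -
  have "distr N borel (\<lambda>\<omega>. snd (snd (snd (limit_vector \<omega>))))
      = distr N borel (\<lambda>\<omega>. (\<lambda>q x. Max (x ` {1..Suc q}) / psum x (Suc q)) (\<nu> \<omega>) (sample (\<nu> \<omega>) \<omega>))"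
    by (simp only: limit_vector_def limit_stats_def fst_conv snd_conv)
  also have "\<dots> = distr N borel (\<lambda>\<omega>. (\<lambda>q x. (\<Sum>i=1..Suc q. x i / real i) / psum x (Suc q)) (\<nu> \<omega>) (sample (\<nu> \<omega>) \<omega>))"
    by (rule distr_mixture_cong[OF _ measurable_normalized_expos(2) distr_max_spacing])
       (intro borel_measurable_divide measurable_expos_psum measurable_expos_Min_Max; simp)
  also have "(\<lambda>\<omega>. (\<lambda>q x. (\<Sum>i=1..Suc q. x i / real i) / psum x (Suc q)) (\<nu> \<omega>) (sample (\<nu> \<omega>) \<omega>))
     = (\<lambda>\<omega>. (\<Sum>i=1..\<nu> \<omega> + 1. X i \<omega> / real i) / (\<Sum>i=1..\<nu> \<omega> + 1. X i \<omega>))"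
    by (simp only: sum_sample[of "\<lambda>_ y. y"] sum_sample[of "\<lambda>i y. y / real i"])
  finally show ?thesis .
qed

end

theorem proposition6:
  fixes \<theta> :: "nat \<Rightarrow> real"
    and N :: "'b measure" and \<nu> :: "'b \<Rightarrow> nat" and X :: "nat \<Rightarrow> 'b \<Rightarrow> real"
  assumes theta_nonneg: "\<And>k. k \<ge> 1 \<Longrightarrow> \<theta> k \<ge> 0"
    and ratio: "(\<lambda>n. perm_norm \<theta> (n - 1) / perm_norm \<theta> n) \<longlonglongrightarrow> 1"
    and N: "prob_space N"
    and poisson: "poisson_distributed N \<nu> (\<theta> 1)"
    and exponential: "\<And>i. i \<ge> 1 \<Longrightarrow> distributed N lborel (X i) (exponential_density 1)"
    and indep: "prob_space.indep_vars N (\<lambda>_. borel)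
                  (\<lambda>i \<omega>. if i = 0 then real (\<nu> \<omega>) else X i \<omega>) (UNIV :: nat set)"
  shows "\<exists>(Q :: (real \<times> real \<times> real \<times> real) measure) m M \<delta> \<Delta>.
    prob_space Q \<and>
    m \<in> borel_measurable Q \<and> M \<in> borel_measurable Q \<and>
    \<delta> \<in> borel_measurable Q \<and> \<Delta> \<in> borel_measurable Q \<and>
    (\<forall>\<omega>\<in>space Q. m \<omega> \<in> {0..1} \<and> M \<omega> \<in> {0..1}) \<and>
    converges_in_distribution
      (weighted_perm \<theta>)
      (\<lambda>n \<pi>. (real (min_fixed n \<pi>) / real n, real (max_fixed n \<pi>) / real n,
              real (min_spacing n \<pi>) / real n, real (max_spacing n \<pi>) / real n))
      Q (\<lambda>\<omega>. (m \<omega>, M \<omega>, \<delta> \<omega>, \<Delta> \<omega>)) \<and>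
    (\<forall>x\<in>{0..<1}. measure Q {\<omega> \<in> space Q. m \<omega> \<le> x} = 1 - exp (- \<theta> 1 * x)) \<and>
    (\<forall>x\<in>{0..<1}. measure Q {\<omega> \<in> space Q. M \<omega> \<le> x} = exp (\<theta> 1 * (x - 1))) \<and>
    distr Q borel \<delta> = distr N borel
      (\<lambda>\<omega>. X (\<nu> \<omega> + 1) \<omega> / (real (\<nu> \<omega> + 1) * (\<Sum>i=1..\<nu> \<omega> + 1. X i \<omega>))) \<and>
    distr Q borel \<Delta> = distr N borel
      (\<lambda>\<omega>. (\<Sum>i=1..\<nu> \<omega> + 1. X i \<omega> / real i) / (\<Sum>i=1..\<nu> \<omega> + 1. X i \<omega>))"
proof -
  interpret poisson_exponentials N \<nu> X "\<theta> 1"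
    by (intro poisson_exponentials.intro poisson_exponentials_axioms.intro N poisson exponential indep)
  \<comment> \<open>The claim asks for a measure on four-tuples: the law of
    \<open>limit_vector\<close> is taken, with the coordinates as variables. Only the first two need
    clipping, to lie in \<open>[0, 1]\<close> at every point.\<close>
  define Q where "Q = distr N borel limit_vector"
  note Z = measurable_limit_vector
  have spaceQ: "space Q = UNIV" and setsQ: "sets Q = sets borel" by (simp_all add: Q_def)
  define m M \<delta> \<Delta> :: "real \<times> real \<times> real \<times> real \<Rightarrow> real"
    where "m = (\<lambda>z. clip (fst z))" and "M = (\<lambda>z. clip (fst (snd z)))"
      and "\<delta> = (\<lambda>z. fst (snd (snd z)))" and "\<Delta> = (\<lambda>z. snd (snd (snd z)))"
  have "continuous_on UNIV m" "continuous_on UNIV M" "continuous_on UNIV \<delta>" "continuous_on UNIV \<Delta>"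
    unfolding m_def M_def \<delta>_def \<Delta>_def clip_def by (intro continuous_intros)+
  then have meas: "m \<in> borel_measurable borel" "M \<in> borel_measurable borel"
      "\<delta> \<in> borel_measurable borel" "\<Delta> \<in> borel_measurable borel"
    by (simp_all add: borel_measurable_continuous_onI)
  have measQ: "h \<in> borel_measurable Q" if "h \<in> borel_measurable borel" for h :: "real \<times> real \<times> real \<times> real \<Rightarrow> real"
    using that measurable_cong_sets[OF setsQ refl] by blast
  have proj: "(fst :: real \<times> real \<times> real \<times> real \<Rightarrow> real) \<in> borel_measurable borel"
      "(\<lambda>z :: real \<times> real \<times> real \<times> real. fst (snd z)) \<in> borel_measurable borel"
    by (intro borel_measurable_continuous_onI continuous_on_fst continuous_on_snd continuous_on_id)+
  have AE_id: "AE \<omega> in N. (m (limit_vector \<omega>), M (limit_vector \<omega>), \<delta> (limit_vector \<omega>), \<Delta> (limit_vector \<omega>)) = limit_vector \<omega>"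
    using AE_limit_vector_range
    by eventually_elim (auto simp: m_def M_def \<delta>_def \<Delta>_def clip_def prod_eq_iff)
  have conv: "converges_in_distribution (weighted_perm \<theta>)
      (\<lambda>n \<pi>. point_stats n (fixed_points n \<pi>)) Q (\<lambda>\<omega>. (m \<omega>, M \<omega>, \<delta> \<omega>, \<Delta> \<omega>))"
    unfolding converges_in_distribution_def
  proof (intro allI impI)
    fix f :: "real \<times> real \<times> real \<times> real \<Rightarrow> real"
    assume f: "continuous_on UNIV f \<and> bounded (range f)"
    have fm: "f \<in> borel_measurable borel" using f by (intro borel_measurable_continuous_onI) blast
    have "(\<lambda>z. (m z, M z, \<delta> z, \<Delta> z)) \<in> borel_measurable borel"
      by (intro borel_measurable_Pair meas)
    then have g: "(\<lambda>z. f (m z, M z, \<delta> z, \<Delta> z)) \<in> borel_measurable borel"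
      by (rule measurable_compose[OF _ fm])
    have "(\<integral>z. f (m z, M z, \<delta> z, \<Delta> z) \<partial>Q)
       = (\<integral>\<omega>. f (m (limit_vector \<omega>), M (limit_vector \<omega>), \<delta> (limit_vector \<omega>), \<Delta> (limit_vector \<omega>)) \<partial>N)"
      unfolding Q_def by (rule integral_distr[OF Z g])
    \<comment> \<open>Clipping alters the vector only on a null set, so the expectations are
      unaffected.\<close>
    also have "\<dots> = (\<integral>\<omega>. f (limit_vector \<omega>) \<partial>N)"
    proof (rule integral_cong_AE)
      show "(\<lambda>\<omega>. f (m (limit_vector \<omega>), M (limit_vector \<omega>), \<delta> (limit_vector \<omega>), \<Delta> (limit_vector \<omega>))) \<in> borel_measurable N"
        by (rule measurable_compose[OF Z g])
      show "(\<lambda>\<omega>. f (limit_vector \<omega>)) \<in> borel_measurable N" by (rule measurable_compose[OF Z fm])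
      show "AE \<omega> in N. f (m (limit_vector \<omega>), M (limit_vector \<omega>), \<delta> (limit_vector \<omega>), \<Delta> (limit_vector \<omega>)) = f (limit_vector \<omega>)"
        using AE_id by eventually_elim (simp only:)
    qed
    finally show "(\<lambda>n. \<integral>\<pi>. f (point_stats n (fixed_points n \<pi>)) \<partial>weighted_perm \<theta> n)
        \<longlonglongrightarrow> (\<integral>z. f (m z, M z, \<delta> z, \<Delta> z) \<partial>Q)"
      using converges_limit_vector[OF theta_nonneg refl ratio] f
      unfolding converges_in_distribution_def by simp
  qed
  have lawQ: "measure Q {z \<in> space Q. clip (h z) \<le> y} = measure N {\<omega> \<in> space N. h (limit_vector \<omega>) \<le> y}"
    if y: "y \<in> {0..<1}" and h: "h \<in> borel_measurable borel" for h :: "real \<times> real \<times> real \<times> real \<Rightarrow> real" and y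
  proof -
    have "{z \<in> space Q. clip (h z) \<le> y} = {z. h z \<le> y}" using y by (auto simp: spaceQ clip_le_iff)
    moreover have "{z. h z \<le> y} \<in> sets borel" using h by measurable
    moreover have "limit_vector -` {z. h z \<le> y} \<inter> space N = {\<omega> \<in> space N. h (limit_vector \<omega>) \<le> y}" by auto
    ultimately show ?thesis unfolding Q_def by (simp add: measure_distr[OF Z])
  qed
  have comp: "distr Q borel h = distr N borel (\<lambda>\<omega>. h (limit_vector \<omega>))" if "h \<in> borel_measurable borel"
    for h :: "real \<times> real \<times> real \<times> real \<Rightarrow> real"
    unfolding Q_def by (subst distr_distr[OF that Z]) (simp add: comp_def)
  show ?thesis
  proof (rule exI[of _ Q], rule exI[of _ m], rule exI[of _ M], rule exI[of _ \<delta>], rule exI[of _ \<Delta>], intro conjI)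
    show "prob_space Q" unfolding Q_def by (rule prob_space_distr[OF Z])
    show "m \<in> borel_measurable Q" "M \<in> borel_measurable Q" "\<delta> \<in> borel_measurable Q" "\<Delta> \<in> borel_measurable Q"
      using meas by (auto intro: measQ)
    show "\<forall>\<omega>\<in>space Q. m \<omega> \<in> {0..1} \<and> M \<omega> \<in> {0..1}"
      unfolding m_def M_def using clip_range by blast
    show "converges_in_distribution (weighted_perm \<theta>)
      (\<lambda>n \<pi>. (real (min_fixed n \<pi>) / real n, real (max_fixed n \<pi>) / real n,
              real (min_spacing n \<pi>) / real n, real (max_spacing n \<pi>) / real n))
      Q (\<lambda>\<omega>. (m \<omega>, M \<omega>, \<delta> \<omega>, \<Delta> \<omega>))"
      unfolding fixed_points_stats by (rule conv)
    show "\<forall>x\<in>{0..<1}. measure Q {\<omega> \<in> space Q. m \<omega> \<le> x} = 1 - exp (- \<theta> 1 * x)"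
      unfolding m_def
    proof
      fix y :: real assume y: "y \<in> {0..<1}"
      then show "measure Q {z \<in> space Q. clip (fst z) \<le> y} = 1 - exp (- \<theta> 1 * y)"
        using lawQ[OF y, of "fst"] prob_first_le[of y] proj by simp
    qed
    show "\<forall>x\<in>{0..<1}. measure Q {\<omega> \<in> space Q. M \<omega> \<le> x} = exp (\<theta> 1 * (x - 1))"
      unfolding M_def
    proof
      fix y :: real assume y: "y \<in> {0..<1}"
      then show "measure Q {z \<in> space Q. clip (fst (snd z)) \<le> y} = exp (\<theta> 1 * (y - 1))"
        using lawQ[OF y, of "\<lambda>z. fst (snd z)"] prob_last_le[of y] proj by simp
    qed
    show "distr Q borel \<delta> = distr N borel
      (\<lambda>\<omega>. X (\<nu> \<omega> + 1) \<omega> / (real (\<nu> \<omega> + 1) * (\<Sum>i=1..\<nu> \<omega> + 1. X i \<omega>)))"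
      unfolding comp[OF meas(3)] unfolding \<delta>_def by (rule distr_min_gap)
    show "distr Q borel \<Delta> = distr N borel
      (\<lambda>\<omega>. (\<Sum>i=1..\<nu> \<omega> + 1. X i \<omega> / real i) / (\<Sum>i=1..\<nu> \<omega> + 1. X i \<omega>))"
      unfolding comp[OF meas(4)] unfolding \<Delta>_def by (rule distr_max_gap)
  qed
qed

end
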